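(* For each $n\ge 5$, the groups $A_n$ and $S_n$ have presentations with $3$ generators, $7$ relations and bit-length $O(\log n)$, using a bounded number of exponents (the implied constant and the bound on the number of exponents being absolute, independent of $n$).
   Context: A presentation $\langle X\mid R\rangle$ has $|X|$ generators and $|R|$ relations. Its bit-length is the total number of bits required to write the presentation: all exponents are encoded as binary strings, the sum of whose lengths enters into the bit-length, as does the space required to enumerate the list of generators and relations. The bit-length $bl(w)$ of a word $w$ (words may be written using nested powers) is required to satisfy $bl(x)=1$ for $x\in X$; $bl(w^m)\le bl(w)+\log|m|$ for $m\in\mathbb{Z}\setminus\{0,1,-1\}$; and $bl(ww')\le bl(w)+bl(w')$ for all words $w,w'$. Logarithms are to the base $2$. The number of exponents means the total number of exponents used in writing the presentation. *)

theory Defs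
  imports Complex_Main "HOL-Algebra.Sym_Groups"
begin

section \<open>Free groups\<close>

text \<open>The letter \<open>(x, True)\<close> stands for the generator \<open>x\<close> and \<open>(x, False)\<close> for its
  formal inverse. The elements of the free group are the freely reduced words.\<close>

type_synonym 'a letter = "'a \<times> bool"

definition inv_letter :: "'a letter \<Rightarrow> 'a letter"
  where "inv_letter a = (fst a, \<not> snd a)"

fun cons_reduced :: "'a letter \<Rightarrow> 'a letter list \<Rightarrow> 'a letter list"
  where
    "cons_reduced a [] = [a]"
  | "cons_reduced a (b # w) = (if b = inv_letter a then w else a # b # w)"

definition reduce :: "'a letter list \<Rightarrow> 'a letter list"
  where "reduce w = foldr cons_reduced w []"

fun reduced :: "'a letter list \<Rightarrow> bool"
  where
    "reduced [] \<longleftrightarrow> True"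
  | "reduced [a] \<longleftrightarrow> True"
  | "reduced (a # b # w) \<longleftrightarrow> b \<noteq> inv_letter a \<and> reduced (b # w)"

definition free_group :: "'a set \<Rightarrow> 'a letter list monoid"
  where "free_group X =
    \<lparr> carrier = {w. set w \<subseteq> X \<times> UNIV \<and> reduced w},
      mult = (\<lambda>u v. reduce (u @ v)),
      one = [] \<rparr>"

lemma inv_letter_inv_letter [simp]: "inv_letter (inv_letter a) = a"
  by (simp add: inv_letter_def)

lemma inv_letter_neq [simp]: "inv_letter a \<noteq> a" "a \<noteq> inv_letter a"
  by (simp_all add: inv_letter_def prod_eq_iff)

lemma fst_inv_letter [simp]: "fst (inv_letter a) = fst a"
  by (simp add: inv_letter_def)

lemma reduced_tl: "reduced (a # w) \<Longrightarrow> reduced w"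
  by (cases w) auto

lemma reduced_cons_reduced: "reduced w \<Longrightarrow> reduced (cons_reduced a w)"
  by (cases w) (auto dest: reduced_tl)

lemma set_cons_reduced: "set (cons_reduced a w) \<subseteq> insert a (set w)"
  by (cases w) auto

lemma cons_reduced_cancel:
  "reduced w \<Longrightarrow> cons_reduced (inv_letter a) (cons_reduced a w) = w"
proof (cases w)
  case (Cons b v)
  then show "reduced w \<Longrightarrow> ?thesis" by (cases v) auto
qed auto

lemma reduced_foldr: "reduced w \<Longrightarrow> reduced (foldr cons_reduced u w)"
  by (induction u) (auto intro: reduced_cons_reduced)

lemma set_foldr_cons_reduced: "set (foldr cons_reduced u w) \<subseteq> set u \<union> set w"
proof (induction u)
  case (Cons a u)
  then show ?case using set_cons_reduced[of a "foldr cons_reduced u w"] by auto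
qed auto

lemma reduced_reduce: "reduced (reduce w)"
  by (simp add: reduce_def reduced_foldr)

lemma set_reduce: "set (reduce w) \<subseteq> set w"
  using set_foldr_cons_reduced[of w "[]"] by (simp add: reduce_def)

lemma reduce_reduced: "reduced w \<Longrightarrow> reduce w = w"
proof (induction w)
  case (Cons a w)
  then have "reduce w = w" using reduced_tl by blast
  with Cons.prems show ?case by (cases w) (auto simp: reduce_def)
qed (simp add: reduce_def)

lemma foldr_cons_reduced:
  assumes "reduced w" "reduced v"
  shows "foldr cons_reduced (cons_reduced a v) w = cons_reduced a (foldr cons_reduced v w)"
proof (cases v)
  case (Cons b v')
  show ?thesis
  proof (cases "b = inv_letter a")
    case True
    have "reduced (foldr cons_reduced v' w)" using assms(1) by (rule reduced_foldr)
    from cons_reduced_cancel[OF this, of "inv_letter a"] show ?thesis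
      using Cons True by simp
  qed (use Cons in simp)
qed simp

lemma foldr_reduce:
  "reduced w \<Longrightarrow> foldr cons_reduced (reduce u) w = foldr cons_reduced u w"
proof (induction u)
  case (Cons a u)
  have "reduce (a # u) = cons_reduced a (reduce u)" by (simp add: reduce_def)
  then show ?case using Cons foldr_cons_reduced[OF Cons.prems reduced_reduce, of a u] by simp
qed (simp add: reduce_def)

lemma reduce_append_reduce:
  "reduce (reduce u @ v) = reduce (u @ v)" "reduce (u @ reduce v) = reduce (u @ v)"
proof -
  have "reduce (reduce u @ v) = foldr cons_reduced (reduce u) (reduce v)"
    by (simp add: reduce_def)
  also have "\<dots> = foldr cons_reduced u (reduce v)"
    using reduced_reduce by (rule foldr_reduce)
  also have "\<dots> = reduce (u @ v)" by (simp add: reduce_def)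
  finally show "reduce (reduce u @ v) = reduce (u @ v)" .
  have "reduce (u @ reduce v) = foldr cons_reduced u (reduce (reduce v))"
    by (simp add: reduce_def)
  also have "\<dots> = reduce (u @ v)"
    using reduce_reduced[OF reduced_reduce, of v] by (simp add: reduce_def)
  finally show "reduce (u @ reduce v) = reduce (u @ v)" .
qed

lemma reduce_inverse: "reduce (map inv_letter (rev w) @ w) = []"
proof (induction w)
  case (Cons a w)
  have red: "reduced (foldr cons_reduced w [])" by (simp add: reduced_foldr)
  have "reduce (map inv_letter (rev (a # w)) @ a # w) = reduce (map inv_letter (rev w) @ w)"
    by (simp add: reduce_def cons_reduced_cancel[OF red])
  with Cons.IH show ?case by simp
qed (simp add: reduce_def)

lemma group_free_group: "group (free_group X)"
proof (rule groupI)
  fix x y assume "x \<in> carrier (free_group X)" "y \<in> carrier (free_group X)"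
  then show "x \<otimes>\<^bsub>free_group X\<^esub> y \<in> carrier (free_group X)"
    using set_reduce[of "x @ y"] by (auto simp: free_group_def reduced_reduce)
next
  fix x y z
  show "x \<otimes>\<^bsub>free_group X\<^esub> y \<otimes>\<^bsub>free_group X\<^esub> z = x \<otimes>\<^bsub>free_group X\<^esub> (y \<otimes>\<^bsub>free_group X\<^esub> z)"
    by (simp add: free_group_def reduce_append_reduce)
next
  fix x assume x: "x \<in> carrier (free_group X)"
  show "\<exists>y\<in>carrier (free_group X). y \<otimes>\<^bsub>free_group X\<^esub> x = \<one>\<^bsub>free_group X\<^esub>"
  proof
    let ?y = "reduce (map inv_letter (rev x))"
    have "set ?y \<subseteq> inv_letter ` set x" using set_reduce[of "map inv_letter (rev x)"] by simp
    also have "\<dots> \<subseteq> X \<times> UNIV" using x by (auto simp: free_group_def inv_letter_def)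
    finally show "?y \<in> carrier (free_group X)" by (simp add: free_group_def reduced_reduce)
    show "?y \<otimes>\<^bsub>free_group X\<^esub> x = \<one>\<^bsub>free_group X\<^esub>"
      by (simp add: free_group_def reduce_append_reduce reduce_inverse)
  qed
qed (auto simp: free_group_def reduce_reduced)


section \<open>Words with nested powers\<close>

text \<open>An element of this type is a word as it is written down, so different expressions may
  denote the same element of the free group. Inverses are written as powers with exponent
  \<open>-1\<close>.\<close>

datatype 'a word_expr =
    Gen 'a
  | Mul "'a word_expr" "'a word_expr"
  | Pow "'a word_expr" int

fun word_eval :: "('b, 'c) monoid_scheme \<Rightarrow> ('a \<Rightarrow> 'b) \<Rightarrow> 'a word_expr \<Rightarrow> 'b"
  where
    "word_eval G f (Gen x) = f x"
  | "word_eval G f (Mul u v) = word_eval G f u \<otimes>\<^bsub>G\<^esub> word_eval G f v"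
  | "word_eval G f (Pow u m) = word_eval G f u [^]\<^bsub>G\<^esub> m"

definition free_eval :: "'a set \<Rightarrow> 'a word_expr \<Rightarrow> 'a letter list"
  where "free_eval X = word_eval (free_group X) (\<lambda>x. [(x, True)])"

text \<open>An exponent \<open>m\<close> with \<open>\<bar>m\<bar> \<ge> 2\<close> is charged \<open>log \<bar>m\<bar>\<close>; the exponents \<open>0, 1, -1\<close> are
  not free but are charged one bit.\<close>

definition exponent_bits :: "int \<Rightarrow> real"
  where "exponent_bits m = (if \<bar>m\<bar> \<ge> 2 then log 2 \<bar>of_int m\<bar> else 1)"

fun bl :: "'a word_expr \<Rightarrow> real"
  where
    "bl (Gen x) = 1"
  | "bl (Mul u v) = bl u + bl v"
  | "bl (Pow u m) = bl u + exponent_bits m"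

text \<open>Exponents are counted with multiplicity, those in \<open>{0, 1, -1}\<close> included.\<close>

fun num_exponents :: "'a word_expr \<Rightarrow> nat"
  where
    "num_exponents (Gen x) = 0"
  | "num_exponents (Mul u v) = num_exponents u + num_exponents v"
  | "num_exponents (Pow u m) = num_exponents u + 1"


section \<open>Presentations\<close>

definition normal_closure :: "('b, 'c) monoid_scheme \<Rightarrow> 'b set \<Rightarrow> 'b set"
  where "normal_closure G S = \<Inter>{N. N \<lhd> G \<and> S \<subseteq> N}"

definition presented_group :: "'a set \<Rightarrow> 'a word_expr set \<Rightarrow> 'a letter list set monoid"
  where "presented_group X R =
    free_group X Mod normal_closure (free_group X) (free_eval X ` R)"

definition is_presentation_of ::
    "'a set \<Rightarrow> 'a word_expr set \<Rightarrow> ('b, 'c) monoid_scheme \<Rightarrow> bool"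
  where "is_presentation_of X R G \<longleftrightarrow>
    (\<forall>r\<in>R. set_word_expr r \<subseteq> X) \<and> presented_group X R \<cong> G"

text \<open>For finite \<open>X\<close> and \<open>R\<close> only. The first two summands account for listing the
  generators and the relations.\<close>

definition presentation_bit_length :: "'a set \<Rightarrow> 'a word_expr set \<Rightarrow> real"
  where "presentation_bit_length X R = real (card X) + real (card R) + (\<Sum>r\<in>R. bl r)"

definition presentation_num_exponents :: "'a word_expr set \<Rightarrow> nat"
  where "presentation_num_exponents R = (\<Sum>r\<in>R. num_exponents r)"

end

theory Submission
  imports Defs "HOL-Number_Theory.Number_Theory" "HOL-Library.Discrete_Functions"
begin

text \<open>
  By Carmichael, elements \<open>x\<^sub>i\<close> with \<open>x\<^sub>i\<^sup>3 = (x\<^sub>i x\<^sub>j)\<^sup>2 = 1\<close>, which stand for the 3-cycles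
  \<open>(\<infinity> \<infinity>' i)\<close>, generate at most an alternating group. For an odd prime \<open>p\<close> the generators
  \<open>a\<close>, \<open>b\<close> of the affine group of the line over the field with \<open>p\<close> elements permute \<open>p\<close> such
  elements doubly transitively (\<open>b\<close> also inverts them), so that the single relation
  \<open>(x x\<^sup>a)\<^sup>2 = 1\<close> gives all of Carmichael's relations on \<open>p + 2\<close> points.

  To reach \<open>n\<close> points, an element \<open>c\<close> that becomes a cycle of length \<open>L = n - 3 - f\<close> is forced to
  agree with \<open>b\<close> on a window of \<open>p - 1 - f\<close> consecutive powers of a primitive root modulo \<open>p\<close>.
  Because \<open>L < 2 (p - 1 - f)\<close>, any two of the \<open>L\<close> elements conjugate to a generator under \<open>c\<close> lie
  in a common translate of the window, so no relation has to be added for the new pairs. As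
  \<open>c\<close> commutes with \<open>x\<close> and \<open>f \<le> 3\<close> is chosen such that 3 does not divide \<open>L\<close>, both are powers of
  one generator \<open>z\<close>. The group is \<open>A\<^sub>n\<close> if \<open>L\<close> is odd and \<open>S\<^sub>n\<close> if \<open>L\<close> is even. A suitable prime is
  provided by a form of Bertrand's postulate, and all words have a fixed shape with exponents
  of size \<open>O(n)\<close>.
\<close>

section \<open>Groups as a type class\<close>

text \<open>The constraint is the number seven, so several relations serve twice. The relation
  \<open>a ^ p = z ^ (3 * L)\<close> replaces two statements about orders; the other relations must
  force both sides to be trivial. Writing \<open>cj a b = a ^ r\<close> as
  \<open>cj (a ^ s) b = a ^ (s - 1)\<close> exhibits \<open>a\<close> as a commutator of
  \<open>a ^ (s - 1)\<close> and \<open>b\<close>, so that \<open>a\<close> follows \<open>b\<close>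
  into the group generated by the 3-cycles. Agreement of \<open>c\<close> with \<open>b\<close> on a
  whole window costs one relation because \<open>wE\<close>, a conjugate of \<open>b\<close>,
  carries \<open>z ^ L\<close> through the window: two elements that act alike on
  \<open>z ^ L\<close> and conjugate \<open>wE\<close> to the same element act alike on the window.
  The last two relations bring \<open>b\<close> and \<open>c ^ 2\<close> into the group of 3-cycles:
  collecting powers of \<open>b\<close> and \<open>c\<close> on the left turns them into
  \<open>b ^ p \<nu> = b ^ (p - 1)\<close> and \<open>c ^ (L + 2) \<nu> = 1\<close>, where \<nu> is
  a product of 3-cycles. The order is then bounded above by Carmichael's count, and explicit
  permutations attain the bound.\<close>

text \<open>Words are computed with in a type class, free of carrier conditions; a group given by a
  carrier enters through its Cayley representation.\<close>

class mgroup = monoid_mult + inverse +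
  assumes linv [simp]: "inverse a * a = 1"
begin

lemma linv_assoc [simp]: "inverse a * (a * b) = b"
  by (simp flip: mult.assoc)

lemma rinv [simp]: "a * inverse a = 1"
proof -
  have "a * inverse a = inverse (inverse a) * (inverse a * (a * inverse a))"
    by (rule linv_assoc[symmetric])
  also have "inverse a * (a * inverse a) = inverse a" by (rule linv_assoc)
  finally show ?thesis by simp
qed

lemma rinv_assoc [simp]: "a * (inverse a * b) = b"
  by (simp flip: mult.assoc)

lemma inverse_unique: "a * b = 1 \<Longrightarrow> inverse a = b"
  by (metis linv_assoc mult_1_right)

lemma inverse_one [simp]: "inverse 1 = 1"
  by (rule inverse_unique) simp

lemma inverse_invol [simp]: "inverse (inverse a) = a"
  by (rule inverse_unique) simp

lemma inverse_times [simp]: "inverse (a * b) = inverse b * inverse a"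
  by (rule inverse_unique) (simp add: mult.assoc)

lemma lcancel [simp]: "a * b = a * c \<longleftrightarrow> b = c"
  by (metis linv_assoc)

lemma rcancel [simp]: "b * a = c * a \<longleftrightarrow> b = c"
  by (metis rinv mult.assoc mult_1_right)

lemma inverse_inj [simp]: "inverse a = inverse b \<longleftrightarrow> a = b"
  by (metis inverse_invol)

lemma inverse_pow: "inverse (a ^ n) = inverse a ^ n"
  by (induction n) (simp_all add: power_commutes)

end

section \<open>Conjugation and generated subgroups\<close>

definition cj :: "'g::mgroup \<Rightarrow> 'g \<Rightarrow> 'g"
  where "cj g h = inverse h * g * h"

lemma cj_times: "cj (g * k) h = cj g h * cj k h"
  and cj_inverse: "cj (inverse g) h = inverse (cj g h)"
  and cj_one [simp]: "cj 1 h = 1" "cj g 1 = g"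
  and cj_cj: "cj (cj g h) k = cj g (h * k)"
  by (simp_all add: cj_def mult.assoc)

lemma cj_power: "cj (g ^ n) h = cj g h ^ n"
  by (induction n) (simp_all add: cj_times)

lemma cj_eq_iff [simp]: "cj g h = cj k h \<longleftrightarrow> g = k"
  by (simp add: cj_def)

lemma cj_eq_one_iff [simp]: "cj g h = 1 \<longleftrightarrow> g = 1"
  using cj_eq_iff[of g h 1] by simp

lemma cj_swap: "g * h = h * cj g h"
  by (simp add: cj_def mult.assoc)

lemma cj_eq_self: "g * h = h * g \<Longrightarrow> cj g h = g"
  by (simp add: cj_def mult.assoc)

lemma cj_inverse_eqI: "cj g h = k \<Longrightarrow> cj k (inverse h) = g"
  by (auto simp: cj_def mult.assoc)

text \<open>Generators are multiplied on the right one at a time, as coset counting requires: a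
  union of right cosets that contains 1 and is closed under these steps contains the generated
  group.\<close>

inductive_set gen :: "'g::mgroup set \<Rightarrow> 'g set" for S
  where
    gen_one: "1 \<in> gen S"
  | gen_step: "g \<in> gen S \<Longrightarrow> s \<in> S \<Longrightarrow> g * s \<in> gen S"
  | gen_step_inv: "g \<in> gen S \<Longrightarrow> s \<in> S \<Longrightarrow> g * inverse s \<in> gen S"

lemma gen_base: "s \<in> S \<Longrightarrow> s \<in> gen S"
  using gen_step[OF gen_one] by force

lemma gen_times: "h \<in> gen S \<Longrightarrow> g \<in> gen S \<Longrightarrow> g * h \<in> gen S"
  by (induction rule: gen.induct) (auto simp flip: mult.assoc intro: gen.intros)

lemma gen_inverse:
  assumes "g \<in> gen S"
  shows "inverse g \<in> gen S"
  using assms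
proof (induction rule: gen.induct)
  case (gen_step g s)
  have "1 * inverse s \<in> gen S" using gen_step_inv[OF gen_one gen_step(2)] .
  from gen_times[OF gen_step(3) this] show ?case by simp
next
  case (gen_step_inv g s)
  from gen_times[OF gen_step_inv(3) gen_base[OF gen_step_inv(2)]] show ?case by simp
qed (simp add: gen_one)

lemma gen_power: "g \<in> gen S \<Longrightarrow> g ^ n \<in> gen S"
  by (induction n) (auto intro: gen_one gen_times)

lemma gen_inverse_iff [simp]: "inverse g \<in> gen S \<longleftrightarrow> g \<in> gen S"
  using gen_inverse by fastforce

lemma gen_subset: "S \<subseteq> gen T \<Longrightarrow> gen S \<subseteq> gen T"
proof
  fix g assume "S \<subseteq> gen T" and "g \<in> gen S"
  from this(2,1) show "g \<in> gen T"
    by (induction rule: gen.induct) (auto intro: gen_one gen_times gen_inverse)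
qed

lemma gen_mono: "S \<subseteq> T \<Longrightarrow> gen S \<subseteq> gen T"
  by (rule gen_subset) (auto intro: gen_base)

lemma gen_cj:
  assumes "\<And>s. s \<in> S \<Longrightarrow> cj s h \<in> gen T"
  shows "g \<in> gen S \<Longrightarrow> cj g h \<in> gen T"
  by (induction rule: gen.induct)
    (auto simp: cj_times cj_inverse intro: gen_one gen_times gen_inverse assms)

text \<open>Moving all the \<open>h\<close> in \<open>(h k)\<^sup>n\<close> to the left conjugates the \<open>k\<close> by powers of \<open>h\<close>.\<close>

lemma collect_power:
  assumes k: "k \<in> gen S" and h: "\<And>g. g \<in> gen S \<Longrightarrow> cj g h \<in> gen S"
  shows "\<exists>\<nu>\<in>gen S. (h * k) ^ n = h ^ n * \<nu>"
proof (induction n)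
  case (Suc n)
  then obtain \<nu> where \<nu>: "\<nu> \<in> gen S" "(h * k) ^ n = h ^ n * \<nu>" by blast
  have "(h * k) ^ Suc n = (h * k) ^ n * (h * k)" by (simp only: power_Suc2)
  also have "\<dots> = h ^ Suc n * (cj \<nu> h * k)"
    by (simp add: \<nu> power_Suc2 mult.assoc del: power_Suc) (simp add: cj_def mult.assoc)
  finally show ?case using \<nu> k h gen_times by blast
qed (auto intro: gen_one)

section \<open>Carmichael's generators\<close>

lemma cube_inverse: "(x::'g::mgroup) ^ 3 = 1 \<Longrightarrow> inverse x = x * x"
  by (rule inverse_unique) (simp add: power3_eq_cube mult.assoc)

lemma inverse_times_inverse: "(x::'g::mgroup) ^ 3 = 1 \<Longrightarrow> inverse x * inverse x = x"
  by (metis cube_inverse inverse_invol inverse_times)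

lemma sq_inverse: "((x::'g::mgroup) * y) ^ 2 = 1 \<Longrightarrow> y * x * y = inverse x"
  by (metis inverse_unique mult.assoc power2_eq_square)

lemma sq_commute: "((x::'g::mgroup) * y) ^ 2 = 1 \<longleftrightarrow> (y * x) ^ 2 = 1"
proof -
  have "(y * x) ^ 2 = cj ((x * y) ^ 2) x"
    by (simp add: cj_def power2_eq_square mult.assoc)
  then show ?thesis by simp
qed

lemma sq_swap:
  assumes "((x::'g::mgroup) * y) ^ 2 = 1"
  shows "x * y = inverse y * inverse x" "y * x = inverse x * inverse y"
proof -
  have "x * y * (x * y) = 1" "y * x * (y * x) = 1"
    using assms assms[unfolded sq_commute[of x y]] by (simp_all only: power2_eq_square)
  then show "x * y = inverse y * inverse x" "y * x = inverse x * inverse y"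
    by (simp_all flip: inverse_times add: inverse_unique)
qed

lemma sq_inverse_inverse: "(inverse (x::'g::mgroup) * inverse y) ^ 2 = 1 \<longleftrightarrow> (x * y) ^ 2 = 1"
proof -
  have "(inverse x * inverse y) ^ 2 = inverse ((y * x) ^ 2)"
    by (simp add: power2_eq_square mult.assoc)
  then show ?thesis using inverse_inj[of _ 1] sq_commute by (metis inverse_one)
qed

text \<open>If \<open>X\<close> and \<open>Y\<close> are the 3-cycles \<open>(\<infinity> \<infinity>' x)\<close> and \<open>(\<infinity> \<infinity>' y)\<close>, then \<open>dbl X Y\<close> is the double
  transposition \<open>(\<infinity> \<infinity>') (x y)\<close>.\<close>

definition dbl :: "'g::mgroup \<Rightarrow> 'g \<Rightarrow> 'g"
  where "dbl X Y = X * inverse Y * X"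

lemma cj_dbl_dbl: "cj (dbl X Y) h = dbl (cj X h) (cj Y h)"
  by (simp add: dbl_def cj_times cj_inverse)

context
  fixes X Y :: "'g::mgroup"
  assumes X: "X ^ 3 = 1" and Y: "Y ^ 3 = 1" and XY: "(X * Y) ^ 2 = 1"
begin

lemma dbl_sq: "dbl X Y * dbl X Y = 1"
proof -
  have XX: "X * X = inverse X" using cube_inverse[OF X] by simp
  have "inverse Y * inverse X * inverse Y = X"
    using sq_inverse[OF XY] by (simp flip: inverse_times add: mult.assoc)
  moreover have "dbl X Y * dbl X Y = X * (inverse Y * (X * X) * inverse Y) * X"
    by (simp add: dbl_def mult.assoc)
  ultimately show ?thesis by (simp add: XX)
qed

lemma inverse_dbl: "inverse (dbl X Y) = dbl X Y"
  using dbl_sq by (rule inverse_unique)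

lemma dbl_inverse_inverse: "dbl (inverse X) (inverse Y) = dbl X Y"
  using inverse_dbl by (simp add: dbl_def mult.assoc)

text \<open>A double transposition exchanges the points of \<open>X\<close> and \<open>Y\<close>,
  and also \<infinity> with \<infinity>', which reverses each 3-cycle; hence the inverses. This
  lemma and the next two derive the effect from Carmichael's relations alone.\<close>

lemma cj_dbl_1: "cj X (dbl X Y) = inverse Y"
proof -
  have "cj X (dbl X Y) = X * inverse Y * X ^ 3 * inverse Y * X"
    by (simp add: cj_def inverse_dbl) (simp add: dbl_def power3_eq_cube mult.assoc)
  also have "\<dots> = X * (inverse Y * inverse Y) * X" by (simp add: X mult.assoc)
  also have "inverse Y * inverse Y = Y" by (rule inverse_times_inverse[OF Y])
  also have "X * Y * X = inverse Y" using sq_inverse[of Y X] XY sq_commute by blast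
  finally show ?thesis .
qed

lemma cj_dbl_2: "cj Y (dbl X Y) = inverse X"
proof -
  have "cj (inverse Y) (dbl X Y) = cj (cj X (dbl X Y)) (dbl X Y)" by (simp add: cj_dbl_1)
  also have "\<dots> = X" by (simp add: cj_cj dbl_sq)
  finally show ?thesis by (simp add: cj_inverse) (metis inverse_invol)
qed

lemma cj_dbl_3:
  assumes Z: "Z ^ 3 = 1" "(X * Z) ^ 2 = 1" "(Y * Z) ^ 2 = 1"
  shows "cj Z (dbl X Y) = inverse Z"
proof -
  have xzx: "X * Z * X = inverse Z" using Z(2) sq_commute sq_inverse by blast
  have "Y * Z * Y = inverse Z" using Z(3) sq_commute sq_inverse by blast
  then have yzy: "inverse Y * inverse Z * inverse Y = Z" by (simp flip: inverse_times add: mult.assoc)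
  have "cj Z (dbl X Y) = X * (inverse Y * (X * Z * X) * inverse Y) * X"
    by (simp add: cj_def inverse_dbl) (simp add: dbl_def mult.assoc)
  then show ?thesis by (simp add: xzx yzy)
qed

end

text \<open>The right cosets of the stabilizer \<open>gen S\<close> of the point that belongs to \<open>X\<close>, one for each
  possible image of that point.\<close>

lemma carmichael_step:
  fixes X :: "'g::mgroup"
  assumes S: "\<And>s. s \<in> S \<Longrightarrow> s ^ 3 = 1"
    and SS: "\<And>s t. s \<in> S \<Longrightarrow> t \<in> S \<Longrightarrow> s \<noteq> t \<Longrightarrow> (s * t) ^ 2 = 1"
    and X: "X ^ 3 = 1" and XS: "\<And>s. s \<in> S \<Longrightarrow> (X * s) ^ 2 = 1"
  shows "gen (insert X S) \<subseteq> (\<lambda>(h, t). h * t) ` (gen S \<times> ({1, X, inverse X} \<union> (*) (inverse X) ` S))"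
    (is "_ \<subseteq> ?U")
proof -
  have UI: "g * inverse t \<in> gen S \<Longrightarrow> t \<in> {1, X, inverse X} \<union> (*) (inverse X) ` S \<Longrightarrow> g \<in> ?U" for g t
    by (rule image_eqI[of _ _ "(g * inverse t, t)"]) (auto simp: mult.assoc)
  have XX: "X * X = inverse X" using cube_inverse[OF X] by simp
  have mul: "g * s \<in> ?U" if "g \<in> ?U" and s: "s \<in> insert X S" for g s
  proof -
    from that(1) obtain h t where h: "h \<in> gen S" and g: "g = h * t"
      and t: "t \<in> {1, X, inverse X} \<union> (*) (inverse X) ` S" by auto
    \<comment> \<open>The witness \<open>t'\<close> is read off from permutations: \<open>t\<close>
      stands for the image of the point of \<open>X\<close>, and \<open>t'\<close> for the point to
      which \<open>s\<close> moves that image.\<close>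
    have main: "\<exists>t'\<in>{1, X, inverse X} \<union> (*) (inverse X) ` S. t * s * inverse t' \<in> gen S"
    proof (cases "s = X")
      case True
      show ?thesis
        using t
      proof (elim UnE imageE insertE emptyE)
        assume "t = 1"
        then show ?thesis using True by (intro bexI[of _ X]) (auto simp: gen_one)
      next
        assume "t = X"
        then show ?thesis using True XX by (intro bexI[of _ "inverse X"]) (auto simp: gen_one mult.assoc)
      next
        assume "t = inverse X"
        then show ?thesis using True by (intro bexI[of _ 1]) (auto simp: gen_one)
      next
        fix u assume u: "t = inverse X * u" "u \<in> S"
        have uxu: "u * X * u = inverse X" using XS[OF u(2)] sq_inverse by blast
        have "u * X = inverse X * inverse u" using XS[OF u(2)] by (rule sq_swap)
        then have "t * s * inverse t = inverse X * inverse X * (inverse u * inverse u) * X"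
          by (simp add: u True mult.assoc)
        also have "inverse u * inverse u = u" by (rule inverse_times_inverse[OF S[OF u(2)]])
        also have "inverse X * inverse X = X" by (rule inverse_times_inverse[OF X])
        also have "X * u * X = inverse u" using XS[OF u(2)] sq_inverse sq_commute by blast
        finally show ?thesis using u t by (intro bexI[of _ t]) (auto simp: gen_base)
      qed
    next
      case False
      then have s: "s \<in> S" using that by simp
      have xsx: "X * s * X = inverse s" using XS[OF s] sq_inverse sq_commute by blast
      show ?thesis
        using t
      proof (elim UnE imageE insertE emptyE)
        assume "t = 1"
        then show ?thesis using s by (intro bexI[of _ 1]) (auto simp: gen_base)
      next
        assume "t = X"
        then show ?thesis using s xsx by (intro bexI[of _ "inverse X"]) (auto simp: gen_base)
      next
        assume "t = inverse X"
        then show ?thesis using s by (intro bexI[of _ "inverse X * s"]) (auto simp: gen_one mult.assoc)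
      next
        fix u assume u: "t = inverse X * u" "u \<in> S"
        show ?thesis
        proof (cases "u = s")
          case True
          have "t * s = inverse X * (s * s)" using u True by (simp add: mult.assoc)
          also have "s * s = inverse s" using cube_inverse[OF S[OF s]] by simp
          also have "inverse X * inverse s = inverse (s * X)" by simp
          also have "s * X = inverse X * inverse s"
            using XS[OF s] by (rule sq_swap)
          finally have "t * s = s * X" by simp
          then show ?thesis using s by (intro bexI[of _ X]) (auto simp: gen_base mult.assoc)
        next
          case False
          have xux: "X * u * X = inverse u" using XS[OF u(2)] sq_inverse sq_commute by blast
          have us: "u * s = inverse s * inverse u"
            using SS[OF u(2) s False] by (rule sq_swap)
          have sX: "inverse X * inverse s = s * X"
            using XS[OF s] by (rule sq_swap[symmetric])
          have "t * s * inverse t = inverse X * inverse s * (inverse u * inverse u) * X"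
            using u us by (simp add: mult.assoc)
          also have "inverse u * inverse u = u" by (rule inverse_times_inverse[OF S[OF u(2)]])
          also have "inverse X * inverse s * u * X = s * (X * u * X)" by (simp only: sX mult.assoc)
          finally have "t * s * inverse t = s * inverse u" by (simp only: xux)
          then show ?thesis using t u s by (intro bexI[of _ t]) (auto intro: gen_times gen_base gen_inverse)
        qed
      qed
    qed
    then obtain t' where t': "t' \<in> {1, X, inverse X} \<union> (*) (inverse X) ` S" "t * s * inverse t' \<in> gen S" by blast
    have "g * s * inverse t' = h * (t * s * inverse t')" by (simp add: g mult.assoc)
    then show ?thesis using UI[OF _ t'(1)] gen_times[OF t'(2) h] by simp
  qed
  \<comment> \<open>As \<open>s\<close> has order 3, its inverse acts as two multiplications by
    \<open>s\<close>.\<close>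
  have inv: "g * inverse s \<in> ?U" if "g \<in> ?U" and s: "s \<in> insert X S" for g s
  proof -
    have "s ^ 3 = 1" using s S X by blast
    then show ?thesis using mul[OF mul[OF that] s] by (simp add: cube_inverse mult.assoc)
  qed
  show ?thesis
  proof
    fix g assume "g \<in> gen (insert X S)"
    then show "g \<in> ?U"
    proof (induction rule: gen.induct)
      case gen_one
      show ?case by (rule UI[of _ 1]) (auto simp: gen.gen_one)
    next
      case (gen_step g s)
      from mul[OF gen_step(3,2)] show ?case .
    next
      case (gen_step_inv g s)
      from inv[OF gen_step_inv(3,2)] show ?case .
    qed
  qed
qed

text \<open>Each further generator multiplies the order by at most the number
  \<open>3 + card S\<close> of cosets; the induction starts with the trivial group and
  \<open>2 * 1 = fact 2\<close>.\<close>

lemma carmichael: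
  fixes S :: "'g::mgroup set"
  assumes "finite S"
    and "\<And>s. s \<in> S \<Longrightarrow> s ^ 3 = 1"
    and "\<And>s t. s \<in> S \<Longrightarrow> t \<in> S \<Longrightarrow> s \<noteq> t \<Longrightarrow> (s * t) ^ 2 = 1"
  shows "finite (gen S) \<and> 2 * card (gen S) \<le> fact (card S + 2)"
  using assms
proof (induction S)
  case empty
  have "g = 1" if "g \<in> gen {}" for g :: 'g
    using that by (induction rule: gen.induct) auto
  then have "gen ({} :: 'g set) = {1}" by (auto intro: gen_one)
  then show ?case by simp
next
  case (insert X S)
  let ?T = "{1, X, inverse X} \<union> (*) (inverse X) ` S"
  have IH: "finite (gen S)" "2 * card (gen S) \<le> fact (card S + 2)"
    using insert by auto
  have sub: "gen (insert X S) \<subseteq> (\<lambda>(h, t). h * t) ` (gen S \<times> ?T)"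
    using insert by (intro carmichael_step) auto
  have fin: "finite (gen S \<times> ?T)" using IH insert by simp
  have "card ?T \<le> card {1, X, inverse X} + card ((*) (inverse X) ` S)" by (rule card_Un_le)
  also have "\<dots> \<le> 3 + card S"
    using card_image_le[OF insert(1), of "(*) (inverse X)"] by (intro add_mono) (auto simp: card_insert_if)
  finally have T: "card ?T \<le> 3 + card S" .
  have "card (gen (insert X S)) \<le> card (gen S \<times> ?T)"
    by (rule surj_card_le[OF fin sub])
  then have "2 * card (gen (insert X S)) \<le> 2 * (card (gen S) * (3 + card S))"
    using T by (simp add: card_cartesian_product) (meson le_trans mult_le_mono2)
  also have "\<dots> \<le> fact (card S + 2) * (3 + card S)"
    using IH(2) by (metis mult.assoc mult_le_mono1)
  also have "\<dots> = fact (card (insert X S) + 2)" using insert by (simp add: algebra_simps)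
  finally show ?case using sub fin finite_subset by blast
qed

text \<open>Only the cosets of \<open>1\<close> and \<open>c\<close> occur. This is the factor 2
  between alternating and symmetric groups.\<close>

lemma gen_insert_normalizing:
  fixes c :: "'g::mgroup"
  assumes fin: "finite (gen S)" and cj: "\<And>g. g \<in> gen S \<Longrightarrow> cj g c \<in> gen S" and c2: "c ^ 2 \<in> gen S"
  shows "finite (gen (insert c S)) \<and> card (gen (insert c S)) \<le> 2 * card (gen S)"
proof -
  let ?H = "gen S \<union> (*) c ` gen S"
  have finH: "finite ?H" using fin by simp
  have "card ?H \<le> card (gen S) + card (gen S)"
    using fin card_image_le[of "gen S" "(*) c"] by (intro order.trans[OF card_Un_le]) simp
  then have card: "card ?H \<le> 2 * card (gen S)" by simp
  have mul_S: "g * h \<in> ?H" if "g \<in> ?H" "h \<in> gen S" for g h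
    using that by (auto simp: mult.assoc intro: gen_times)
  have mul_c: "g * c \<in> ?H" if "g \<in> ?H" for g
    using that
  proof
    assume "g \<in> gen S"
    then show ?thesis using cj_swap[of g c] cj[of g] by auto
  next
    assume "g \<in> (*) c ` gen S"
    then obtain h where h: "g = c * h" "h \<in> gen S" by blast
    then have "g * c = c ^ 2 * cj h c" by (simp add: cj_def power2_eq_square mult.assoc)
    then show ?thesis using h cj c2 by (auto intro: gen_times)
  qed
  have mul_c': "g * inverse c \<in> ?H" if "g \<in> ?H" for g
  proof -
    have "g * inverse c = g * c * inverse (c ^ 2)" by (simp add: power2_eq_square mult.assoc)
    then show ?thesis using mul_S[OF mul_c[OF that], of "inverse (c ^ 2)"] c2 by simp
  qed
  have sub: "gen (insert c S) \<subseteq> ?H"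
  proof
    fix g assume "g \<in> gen (insert c S)"
    then show "g \<in> ?H"
    proof (induction rule: gen.induct)
      case (gen_step g t)
      then show ?case using mul_S[OF gen_step(3), of t] mul_c[OF gen_step(3)] by (auto dest: gen_base)
    next
      case (gen_step_inv g t)
      then show ?case using mul_S[OF gen_step_inv(3), of "inverse t"] mul_c'[OF gen_step_inv(3)]
        by (auto dest: gen_base)
    qed (simp add: gen_one)
  qed
  then show ?thesis using card card_mono[OF finH sub] finite_subset[OF sub finH] by linarith
qed

section \<open>The seven relations\<close>

lemma power_cong_nat:
  fixes g :: "'g::monoid_mult"
  assumes "g ^ m = 1" and "[i = j] (mod m)"
  shows "g ^ i = g ^ j"
proof -
  have "g ^ k = g ^ (k mod m)" for k
  proof -
    have "g ^ k = g ^ (m * (k div m) + k mod m)" by simp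
    also have "\<dots> = g ^ (k mod m)" by (simp only: power_add power_mult assms(1)) simp
    finally show ?thesis .
  qed
  then show ?thesis using assms(2) by (metis cong_def)
qed

text \<open>The words of the presentation, with \<open>z\<close> standing for the product of commuting powers of
  the 3-cycle \<open>z ^ L\<close> and of the \<open>L\<close>-cycle \<open>z ^ 3\<close>.\<close>

definition wY :: "nat \<Rightarrow> 'g::mgroup \<Rightarrow> 'g \<Rightarrow> 'g"
  where "wY L a z = cj (z ^ L) a"

definition wV :: "nat \<Rightarrow> 'g::mgroup \<Rightarrow> 'g \<Rightarrow> 'g \<Rightarrow> 'g"
  where "wV L a b z = b * wY L a z * inverse b"

text \<open>The double transposition for the exponents 0 and 1 of the primitive root; the conjugate
  by \<open>b\<close> already is the inverse 3-cycle that \<open>dbl\<close> has in the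
  middle.\<close>

definition wD :: "nat \<Rightarrow> 'g::mgroup \<Rightarrow> 'g \<Rightarrow> 'g \<Rightarrow> 'g"
  where "wD L a b z = wY L a z * cj (wY L a z) b * wY L a z"

text \<open>The product of \<open>b\<close> with the conjugates of \<open>wD\<close> by
  \<open>b ^ 0\<close>, ..., \<open>b ^ (f - 1)\<close>, telescoped. Each factor removes one
  exponent from the cycle of \<open>b\<close>.\<close>

definition wB :: "nat \<Rightarrow> nat \<Rightarrow> 'g::mgroup \<Rightarrow> 'g \<Rightarrow> 'g \<Rightarrow> 'g"
  where "wB f L a b z = b * (wD L a b z * inverse b) ^ f * b ^ f"

text \<open>The conjugate of \<open>b\<close> by an involution that exchanges the point 0 with the
  last power of the root. Unlike \<open>b\<close>, which only inverts \<open>z ^ L\<close>, it moves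
  \<open>z ^ L\<close> to other 3-cycles.\<close>

definition wE :: "nat \<Rightarrow> 'g::mgroup \<Rightarrow> 'g \<Rightarrow> 'g \<Rightarrow> 'g"
  where "wE L a b z = z ^ L * wV L a b z * z ^ L * b * (z ^ L * wV L a b z * z ^ L)"

text \<open>The exponents on the left of the last two relations are the lengths of the cycles that
  the two products become. The power \<open>b ^ (p - 1)\<close>, trivial for the intended
  permutations, is there to leave a single \<open>b\<close> after cancellation.\<close>

definition relations :: "nat \<Rightarrow> nat \<Rightarrow> nat \<Rightarrow> nat \<Rightarrow> 'g::mgroup \<Rightarrow> 'g \<Rightarrow> 'g \<Rightarrow> bool"
  where "relations p s f L a b z \<longleftrightarrow>
    a ^ p = z ^ (3 * L) \<and>
    cj (a ^ s) b = a ^ (s - 1) \<and>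
    cj (z ^ L) b = inverse (z ^ L) \<and>
    (z ^ L * wY L a z) ^ 2 = 1 \<and>
    cj (wE L a b z) (wB f L a b z) = cj (wE L a b z) (z ^ 3) \<and>
    (b * wY L a z) ^ p = b ^ (p - 1) \<and>
    (z ^ 3 * wV L a b z) ^ (L + 2) = 1"

lemma wB_Suc: "wB (Suc k) L a b z = wB k L a b z * cj (wD L a b z) (b ^ k)"
  by (simp add: wB_def cj_def power_Suc2 mult.assoc del: power_Suc) (simp add: power_commutes mult.assoc flip: power_Suc2)

definition sg :: "bool \<Rightarrow> 'g::mgroup \<Rightarrow> 'g"
  where "sg \<sigma> g = (if \<sigma> then inverse g else g)"

lemma sg_sg [simp]: "sg \<sigma> (sg \<tau> g) = sg (\<sigma> \<noteq> \<tau>) g" and sg_False [simp]: "sg False g = g"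
  and cj_sg: "cj (sg \<sigma> g) h = sg \<sigma> (cj g h)"
  by (auto simp: sg_def cj_inverse)

text \<open>Modulo \<open>p\<close>, \<open>s\<close> is the inverse of \<open>1 - r\<close>. The
  window of \<open>p - 1 - f\<close> powers is nonempty, fits into a cycle of length
  \<open>L\<close> and fills more than half of it.\<close>

locale parameters =
  fixes p r s f L :: nat
  assumes prime_p: "prime p" and odd_p: "odd p" and root: "residue_primroot p r"
    and s: "[s = 1 + r * s] (mod p)" "s > 0"
    and f: "f + 2 \<le> p" and L: "p - 1 - f \<le> L" "L < 2 * (p - 1 - f)" "\<not> 3 dvd L"
begin

lemma p_ge: "p \<ge> 3"
  using prime_ge_2_nat[OF prime_p] odd_p by (cases "p = 2") auto

lemma root_power_cong: "[r ^ i = r ^ j] (mod p) \<longleftrightarrow> [i = j] (mod (p - 1))"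
  using root prime_p by (simp add: residue_primroot_def order_divides_expdiff totient_prime coprime_commute)

lemma root_power_surj:
  assumes "\<not> p dvd v"
  shows "\<exists>i. [r ^ i = v] (mod p)"
proof -
  have bij: "bij_betw (\<lambda>i. r ^ i mod p) {..<totient p} (totatives p)"
    using root p_ge by (intro residue_primroot_is_generator) auto
  have "v mod p \<in> totatives p"
    using assms prime_p by (auto simp: totatives_def coprime_commute prime_imp_coprime
      mod_greater_zero_iff_not_dvd prime_gt_0_nat less_imp_le)
  then have "v mod p \<in> (\<lambda>i. r ^ i mod p) ` {..<totient p}"
    using bij by (simp add: bij_betw_def)
  then show ?thesis by (auto simp: cong_def)
qed

lemma s_pred: "[s - 1 = r * s] (mod p)"
proof -
  have "[1 + (s - 1) = 1 + r * s] (mod p)" using s by simp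
  then show ?thesis by (rule cong_add_lcancel_nat[THEN iffD1])
qed

lemma s_inverse: "\<exists>t. [s * t = 1] (mod p)"
proof -
  have "\<not> p dvd s"
  proof
    assume "p dvd s"
    then have "[s = 0] (mod p)" by (simp add: cong_0_iff)
    moreover from this have "[1 + r * s = 1 + r * 0] (mod p)" by (intro cong_add cong_mult cong_refl)
    ultimately have "[0 = 1] (mod p)" using s(1) by (metis cong_sym cong_trans add_0_right mult_0_right)
    then show False using p_ge by (simp add: cong_def)
  qed
  then have "coprime s p" using prime_p by (simp add: coprime_commute prime_imp_coprime)
  then show ?thesis using cong_solve_coprime_nat by simp
qed

text \<open>The cycle of the indices \<open>k\<close>, ..., \<open>p - 2\<close> with the smaller
  ones fixed; \<open>shift 0\<close> is multiplication by the root, seen on exponents.\<close>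

definition shift :: "nat \<Rightarrow> nat \<Rightarrow> nat"
  where "shift k i = (if i < k then i else if i < p - 2 then Suc i else k)"

end

locale related = parameters +
  fixes a b z :: "'g::mgroup"
  assumes rel: "relations p s f L a b z"
begin

definition X :: 'g where "X = z ^ L"
definition c :: 'g where "c = z ^ 3"

lemma R1: "a ^ p = z ^ (3 * L)"
  and R2: "cj (a ^ s) b = a ^ (s - 1)"
  and R3: "cj X b = inverse X"
  and R4: "(X * wY L a z) ^ 2 = 1"
  and R5: "cj (wE L a b z) (wB f L a b z) = cj (wE L a b z) c"
  and R6: "(b * wY L a z) ^ p = b ^ (p - 1)"
  and R7: "(c * wV L a b z) ^ (L + 2) = 1"
  using rel by (simp_all add: relations_def X_def c_def)

lemma cj_X_c: "cj X c = X"
  by (rule cj_eq_self) (simp add: X_def c_def add.commute flip: power_add)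

text \<open>\<open>w = a ^ p\<close> is a power of \<open>X\<close>, hence inverted by \<open>b\<close>. Since \<open>p\<close> is odd, the sixth relation
  yields \<open>w\<^sup>2 = 1\<close>, and the \<open>p\<close>-th power of the second one reduces to \<open>w ^ s = w ^ (s - 1)\<close>.\<close>

lemma a_power_p: "a ^ p = 1"
proof -
  define w where "w = a ^ p"
  have wX: "w = X ^ 3" using R1 by (simp add: w_def X_def mult.commute flip: power_mult)
  have "cj w b = inverse w" by (simp add: wX cj_power R3 inverse_pow)
  moreover have "cj w (wY L a z) = w"
  proof -
    have "cj w a = w" by (rule cj_eq_self) (simp add: w_def power_commutes)
    moreover have "cj w (cj X a) = cj (cj (cj w (inverse a)) X) a"
      unfolding cj_cj by (simp add: cj_def mult.assoc)
    moreover have "cj w (inverse a) = w" using \<open>cj w a = w\<close> by (rule cj_inverse_eqI)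
    moreover have "cj w X = w" by (rule cj_eq_self) (simp add: wX power_commutes)
    ultimately show ?thesis by (simp add: wY_def X_def)
  qed
  ultimately have inv: "cj w b = inverse w" "cj w (b * wY L a z) = inverse w"
    by (simp_all add: cj_inverse flip: cj_cj)
  have par: "cj w (h ^ n) = (if even n then w else inverse w)" if "cj w h = inverse w" for h n
    using that by (induction n) (auto simp: cj_inverse power_Suc2 simp del: power_Suc simp flip: cj_cj)
  have "inverse w = cj w ((b * wY L a z) ^ p)" using par[OF inv(2)] odd_p by simp
  also have "\<dots> = w" using par[OF inv(1)] odd_p by (simp add: R6)
  finally have w2: "w * w = 1" by (metis linv)
  have "inverse w ^ s = cj (w ^ s) b" by (simp add: cj_power inv)
  also have "\<dots> = cj (a ^ s) b ^ p" by (simp add: w_def mult.commute flip: power_mult cj_power)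
  also have "\<dots> = w ^ (s - 1)" by (simp add: R2 w_def mult.commute flip: power_mult)
  finally have "w ^ s = w ^ (s - 1)" using w2 inverse_unique[of w w] by simp
  moreover have "w ^ s = w ^ (s - 1) * w" using s(2) by (simp flip: power_Suc2)
  ultimately have "w = 1" by (metis lcancel mult_1_right)
  then show ?thesis by (simp add: w_def)
qed

lemma X_cube: "X ^ 3 = 1"
  using a_power_p R1 by (simp add: X_def mult.commute flip: power_mult)

lemma c_power_L: "c ^ L = 1"
  using a_power_p R1 by (simp add: c_def flip: power_mult)

text \<open>Both sides have the same \<open>s\<close>-th power and trivial \<open>p\<close>-th
  power, and \<open>s\<close> is invertible modulo \<open>p\<close>.\<close>

lemma cj_a_b: "cj a b = a ^ r"
proof -
  obtain t where t: "[s * t = 1] (mod p)" using s_inverse by blast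
  have "cj a b ^ s = a ^ (s - 1)" by (simp add: R2 flip: cj_power)
  also have "\<dots> = (a ^ r) ^ s"
    using power_cong_nat[OF a_power_p s_pred] by (simp add: power_mult)
  finally have eq: "cj a b ^ s = (a ^ r) ^ s" .
  have "cj a b ^ p = 1" "(a ^ r) ^ p = 1"
    by (simp_all add: a_power_p flip: cj_power power_mult)
      (simp add: power_mult mult.commute[of r] a_power_p)
  from this[THEN power_cong_nat, OF t] eq show ?thesis by (simp add: power_mult)
qed

section \<open>The 3-cycles belonging to the affine line\<close>

definition x :: "nat \<Rightarrow> 'g" where "x v = cj X (a ^ v)"

lemma x_cong: "[u = v] (mod p) \<Longrightarrow> x u = x v"
  by (simp add: x_def power_cong_nat[OF a_power_p])

lemma x_0: "x 0 = X" and x_1: "x (Suc 0) = wY L a z"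
  by (simp_all add: x_def wY_def X_def)

lemma x_cube: "x v ^ 3 = 1"
  by (simp add: x_def X_cube flip: cj_power)

lemma cj_x_a: "cj (x v) (a ^ u) = x (v + u)"
  by (simp add: x_def cj_cj power_add)

lemma cj_x_b: "cj (x v) b = inverse (x (r * v))"
proof -
  have "cj (cj X (a ^ v)) b = cj (cj X b) (cj (a ^ v) b)"
    by (simp add: cj_def mult.assoc)
  then show ?thesis by (simp add: x_def R3 cj_power cj_a_b cj_inverse power_mult)
qed

definition y :: "nat \<Rightarrow> 'g" where "y i = x (r ^ i)"

lemma y_cong: "[i = j] (mod (p - 1)) \<Longrightarrow> y i = y j"
  unfolding y_def by (intro x_cong) (simp add: root_power_cong)

lemma y_0: "y 0 = wY L a z"
  by (simp add: y_def x_1)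

lemma y_cube: "y i ^ 3 = 1"
  by (simp add: y_def x_cube)

lemma cj_y_b: "cj (y i) b = inverse (y (Suc i))"
  by (simp add: y_def cj_x_b)

lemma y_last: "y (Suc (p - 2)) = y 0"
proof -
  have "Suc (p - 2) = p - 1" using p_ge by simp
  then show ?thesis by (intro y_cong) (simp add: cong_def)
qed

text \<open>Conjugation by \<open>b\<close> inverts \<open>X\<close> and turns \<open>y i\<close>
  into the inverse of \<open>y (Suc i)\<close>; inverting both factors preserves the
  relation.\<close>

lemma X_y: "(X * y i) ^ 2 = 1"
proof (induction i)
  case 0
  then show ?case using R4 by (simp add: y_0)
next
  case (Suc i)
  have "(cj X b * cj (y i) b) ^ 2 = 1" by (simp add: Suc flip: cj_times cj_power)
  then show ?case by (simp only: R3 cj_y_b sq_inverse_inverse)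
qed

text \<open>A translation takes the smaller index to 0; the other one becomes a power of the
  primitive root, where \<open>X_y\<close> applies.\<close>

lemma x_x:
  assumes "\<not> [u = v] (mod p)"
  shows "(x u * x v) ^ 2 = 1"
proof -
  have main: "(x u * x v) ^ 2 = 1" if "u \<le> v" "\<not> [u = v] (mod p)" for u v
  proof -
    have "\<not> p dvd v - u" using that by (metis cong_altdef_nat cong_sym_eq)
    then obtain i where i: "[r ^ i = v - u] (mod p)" using root_power_surj by blast
    have "(x u * x v) ^ 2 = cj ((x 0 * x (v - u)) ^ 2) (a ^ u)"
      using that by (simp add: cj_power cj_times cj_x_a)
    moreover have "x (v - u) = y i" using x_cong[OF i] by (simp add: y_def)
    ultimately show ?thesis by (simp add: x_0 X_y)
  qed
  show ?thesis
    using main[of u v] main[of v u] assms sq_commute[of "x u" "x v"] cong_sym_eq[of u v p]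
    by (cases u v rule: linorder_le_cases) auto
qed

lemma y_y: "\<not> [i = j] (mod (p - 1)) \<Longrightarrow> (y i * y j) ^ 2 = 1"
  unfolding y_def by (intro x_x) (simp add: root_power_cong)

lemma y_y': "i < p - 1 \<Longrightarrow> j < p - 1 \<Longrightarrow> i \<noteq> j \<Longrightarrow> (y i * y j) ^ 2 = 1"
  by (intro y_y) (simp add: cong_def)

lemma cj_dbl_y:
  assumes "i < p - 1" "j < p - 1" "k < p - 1" "i \<noteq> j"
  shows "cj (y k) (dbl (y i) (y j)) = inverse (y (if k = i then j else if k = j then i else k))"
  using assms by (auto intro!: cj_dbl_1 cj_dbl_2 cj_dbl_3 y_cube y_y')

lemma cj_dbl_y_X:
  assumes "i < p - 1" "j < p - 1" "i \<noteq> j"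
  shows "cj X (dbl (y i) (y j)) = inverse X"
  using assms sq_commute X_y by (auto intro!: cj_dbl_3 y_cube y_y' X_cube)

lemma cj_wD: "Suc k < p - 1 \<Longrightarrow> cj (wD L a b z) (b ^ k) = dbl (y k) (y (Suc k))"
proof (induction k)
  case 0
  then show ?case by (simp add: wD_def dbl_def cj_y_b flip: y_0)
next
  case (Suc k)
  have "cj (wD L a b z) (b ^ Suc k) = cj (cj (wD L a b z) (b ^ k)) b"
    by (simp add: cj_cj power_Suc2 del: power_Suc)
  also have "\<dots> = dbl (inverse (y (Suc k))) (inverse (y (Suc (Suc k))))"
    using Suc by (simp add: cj_dbl_dbl cj_y_b)
  also have "\<dots> = dbl (y (Suc k)) (y (Suc (Suc k)))"
    using Suc.prems by (intro dbl_inverse_inverse y_cube y_y') auto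
  finally show ?case .
qed

text \<open>Each of the \<open>k + 1\<close> factors of \<open>wB k\<close> exchanges \<infinity>
  and \<infinity>', so an inverse appears exactly for even \<open>k\<close>. The next factor
  exchanges the indices \<open>k\<close> and \<open>Suc k\<close>, which closes the cycle one place
  later.\<close>

lemma cj_wB:
  assumes "k + 2 \<le> p"
  shows "cj X (wB k L a b z) = sg (even k) X"
    and "i < p - 1 \<Longrightarrow> cj (y i) (wB k L a b z) = sg (even k) (y (shift k i))"
proof -
  from assms have "cj X (wB k L a b z) = sg (even k) X \<and>
    (\<forall>i < p - 1. cj (y i) (wB k L a b z) = sg (even k) (y (shift k i)))"
  proof (induction k)
    case 0
    have "cj (y i) b = inverse (y (shift 0 i))" if "i < p - 1" for i
    proof (cases "i < p - 2")
      case False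
      then have "i = p - 2" using that by simp
      then show ?thesis by (simp add: cj_y_b shift_def y_last)
    qed (simp add: cj_y_b shift_def)
    then show ?case by (simp add: wB_def R3 sg_def)
  next
    case (Suc k)
    have k: "Suc k < p - 1" using Suc.prems by simp
    have IH: "cj X (wB k L a b z) = sg (even k) X"
      "\<And>i. i < p - 1 \<Longrightarrow> cj (y i) (wB k L a b z) = sg (even k) (y (shift k i))"
      using Suc by auto
    have "cj (y i) (wB (Suc k) L a b z) = sg (even (Suc k)) (y (shift (Suc k) i))" if i: "i < p - 1" for i
    proof -
      have "shift k i < p - 1" using i k by (auto simp: shift_def)
      then have "cj (y (shift k i)) (cj (wD L a b z) (b ^ k)) =
          inverse (y (if shift k i = k then Suc k else if shift k i = Suc k then k else shift k i))"
        using k by (simp add: cj_wD cj_dbl_y)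
      also have "(if shift k i = k then Suc k else if shift k i = Suc k then k else shift k i) = shift (Suc k) i"
        using i k by (auto simp: shift_def split: if_splits)
      finally show ?thesis using i
        by (simp add: wB_Suc IH cj_sg flip: cj_cj) (simp add: sg_def)
    qed
    moreover have "cj X (wB (Suc k) L a b z) = sg (even (Suc k)) X"
      using k by (simp add: wB_Suc IH cj_sg cj_wD cj_dbl_y_X flip: cj_cj) (simp add: sg_def)
    ultimately show ?case by blast
  qed
  then show "cj X (wB k L a b z) = sg (even k) X"
    "i < p - 1 \<Longrightarrow> cj (y i) (wB k L a b z) = sg (even k) (y (shift k i))" by auto
qed

lemma wV_eq: "wV L a b z = inverse (y (p - 2))"
proof -
  have "cj (inverse (y (p - 2))) b = y 0" by (simp add: cj_inverse cj_y_b y_last)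
  from cj_inverse_eqI[OF this] show ?thesis by (simp add: wV_def y_0 cj_def)
qed

text \<open>The chain \<open>X\<close>, \<open>y 0\<close>, ..., \<open>y (p - 3)\<close>:
  conjugation by \<open>d\<close> puts \<open>X\<close> in the place of \<open>y (p - 2)\<close> in
  the cycle of \<open>b\<close>.\<close>

lemma cj_wE: "cj X (wE L a b z) = inverse (y 0)"
  "Suc i < p - 2 \<Longrightarrow> cj (y i) (wE L a b z) = inverse (y (Suc i))"
proof -
  define d where "d = dbl X (y (p - 2))"
  have wE: "wE L a b z = d * b * d" by (simp add: wE_def d_def dbl_def wV_eq X_def mult.assoc)
  have d_y: "cj (y k) d = inverse (y k)" if "k < p - 2" for k
    unfolding d_def using that by (intro cj_dbl_3 X_cube y_cube X_y y_y') auto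
  have d_X: "cj X d = inverse (y (p - 2))" unfolding d_def by (intro cj_dbl_1 X_cube y_cube X_y)
  show "cj X (wE L a b z) = inverse (y 0)"
    using p_ge by (simp add: wE d_X cj_inverse cj_y_b d_y y_last flip: cj_cj)
  assume "Suc i < p - 2"
  then show "cj (y i) (wE L a b z) = inverse (y (Suc i))"
    by (simp add: wE cj_inverse cj_y_b d_y flip: cj_cj)
qed

text \<open>The fifth relation makes \<open>c\<close> act on \<open>X\<close> and the \<open>y i\<close>, except for the last one, as
  \<open>wB f\<close> does up to sign.\<close>

lemma cj_y_c:
  assumes "i < p - 2"
  shows "cj (y i) c = y (shift f i)"
proof -
  let ?B = "wB f L a b z" and ?E = "wE L a b z"
  define P where "P g \<longleftrightarrow> cj g c = cj (sg (even f) g) ?B" for g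
  \<comment> \<open>By the fifth relation \<open>c\<close> and \<open>?B\<close> conjugate
    \<open>?E\<close> to the same element, so agreement on \<open>g\<close> up to sign passes to the
    conjugate of \<open>g\<close> by \<open>?E\<close>.\<close>
  have P_E: "P (cj g ?E)" if "P g" for g
  proof -
    have "cj (cj g ?E) c = cj (cj g c) (cj ?E c)" by (simp add: cj_def mult.assoc)
    also have "\<dots> = cj (cj (sg (even f) g) ?B) (cj ?E ?B)" using that by (simp add: P_def R5)
    also have "\<dots> = cj (sg (even f) (cj g ?E)) ?B" by (simp add: cj_def mult.assoc sg_def)
    finally show ?thesis by (simp add: P_def)
  qed
  have "sg \<sigma> (inverse g) = inverse (sg \<sigma> g)" for \<sigma> and g :: 'g by (simp add: sg_def)
  then have P_inv: "P (inverse g) \<longleftrightarrow> P g" for g by (simp add: P_def cj_inverse)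
  have P_X: "P X" using f by (simp add: P_def cj_X_c cj_sg cj_wB)
  have "P (y i)" using assms
  proof (induction i)
    case 0
    then show ?case using P_E[OF P_X] by (simp add: cj_wE P_inv)
  next
    case (Suc i)
    then have "P (cj (y i) ?E)" by (intro P_E) simp
    then show ?case using Suc.prems by (simp add: cj_wE P_inv)
  qed
  then show ?thesis using assms f by (simp add: P_def cj_sg cj_wB)
qed

section \<open>The 3-cycles along the long cycle\<close>

definition Z :: "nat \<Rightarrow> 'g" where "Z j = cj (y f) (c ^ j)"

lemma Z_cong: "[i = j] (mod L) \<Longrightarrow> Z i = Z j"
  by (simp add: Z_def power_cong_nat[OF c_power_L])

lemma cj_Z: "cj (Z i) (c ^ j) = Z (i + j)"
  by (simp add: Z_def cj_cj power_add)

lemma Z_y: "f + j < p - 1 \<Longrightarrow> Z j = y (f + j)"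
proof (induction j)
  case (Suc j)
  then have "Z (Suc j) = cj (y (f + j)) c" using cj_Z[of j 1] by simp
  moreover have "f + j < p - 2" using Suc.prems by simp
  ultimately show ?case by (simp add: cj_y_c shift_def)
qed (simp add: Z_def)

lemma cj_X_c_power: "cj X (c ^ j) = X"
  by (induction j) (simp_all add: cj_X_c flip: cj_cj)

lemma cj_y_c_power: "i < f \<Longrightarrow> cj (y i) (c ^ j) = y i"
  using f by (induction j) (auto simp: cj_y_c shift_def simp flip: cj_cj)

text \<open>As \<open>Z\<close> has period \<open>L < 2 (p - 1 - f)\<close>, the distance of two indices modulo \<open>L\<close> is less than the
  length of the window in one of the two directions.\<close>

lemma Z_Z:
  assumes "i < j" "j < L"
  shows "(Z i * Z j) ^ 2 = 1"
proof -
  have near: "(Z k * Z (k + d)) ^ 2 = 1" if "0 < d" "f + d < p - 1" for k d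
  proof -
    have "(Z k * Z (k + d)) ^ 2 = cj ((Z 0 * Z d) ^ 2) (c ^ k)"
      by (simp add: cj_power cj_times cj_Z add.commute)
    moreover have "Z 0 * Z d = y f * y (f + d)" using that by (simp add: Z_y)
    ultimately show ?thesis using that y_y'[of f "f + d"] by simp
  qed
  show ?thesis
  proof (cases "f + (j - i) < p - 1")
    case True
    then show ?thesis using near[of "j - i" i] assms by simp
  next
    case False
    then have "(Z j * Z (j + (L - (j - i)))) ^ 2 = 1" using assms L by (intro near) auto
    moreover have "Z (j + (L - (j - i))) = Z i" using assms by (intro Z_cong) (simp add: cong_def)
    ultimately show ?thesis using sq_commute by metis
  qed
qed

definition S :: "'g set" where "S = insert X (y ` {..<f} \<union> Z ` {..<L})"

text \<open>\<open>S\<close> has at most one generator for each of the \<open>f + L + 1\<close>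
  points other than \<infinity> and \<infinity>'.\<close>

lemma gen_S: "finite (gen S) \<and> 2 * card (gen S) \<le> fact (f + L + 3)"
proof -
  have fin: "finite S" by (simp add: S_def)
  have cube: "t ^ 3 = 1" if "t \<in> S" for t
    using that by (auto simp: S_def X_cube y_cube Z_def simp flip: cj_power)
  have y_Z: "(y i * Z j) ^ 2 = 1" if "i < f" for i j
  proof -
    have "(y i * Z j) ^ 2 = cj ((y i * y f) ^ 2) (c ^ j)"
      using that by (simp add: cj_power cj_times cj_y_c_power Z_def)
    then show ?thesis using that f y_y'[of i f] by simp
  qed
  have X_Z: "(X * Z j) ^ 2 = 1" for j
  proof -
    have "(X * Z j) ^ 2 = cj ((X * y f) ^ 2) (c ^ j)"
      by (simp add: cj_power cj_times cj_X_c_power Z_def)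
    then show ?thesis by (simp add: X_y)
  qed
  have yy: "(y i * y j) ^ 2 = 1" if "i < f" "j < f" "y i \<noteq> y j" for i j
    using that f by (intro y_y') auto
  have ZZ: "(Z i * Z j) ^ 2 = 1" if "i < L" "j < L" "Z i \<noteq> Z j" for i j
    using that Z_Z[of i j] Z_Z[of j i] sq_commute by (metis linorder_neqE_nat)
  have pair: "(t * u) ^ 2 = 1" if "t \<in> S" "u \<in> S" "t \<noteq> u" for t u
    using that sq_commute X_y X_Z y_Z yy ZZ unfolding S_def by blast
  have "card S \<le> Suc (card (y ` {..<f} \<union> Z ` {..<L}))"
    by (simp add: S_def card_insert_if)
  also have "\<dots> \<le> Suc (card (y ` {..<f}) + card (Z ` {..<L}))"
    by (simp add: card_Un_le)
  also have "\<dots> \<le> Suc (f + L)"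
    using card_image_le[of "{..<f}" y] card_image_le[of "{..<L}" Z] by simp
  finally have "fact (card S + 2) \<le> (fact (f + L + 3) :: nat)" by (intro fact_mono_nat) simp
  then show ?thesis using carmichael[OF fin cube pair] by force
qed

section \<open>Locating the given generators in the group of 3-cycles\<close>

lemma y_in: "y i \<in> gen S"
proof -
  have "y i = y (i mod (p - 1))" by (rule y_cong) (simp add: cong_def)
  moreover have "y j \<in> gen S" if "j < p - 1" for j
  proof (cases "j < f")
    case False
    then have "y j = Z (j - f)" using that Z_y[of "j - f"] by simp
    moreover have "j - f < L" using that L False by linarith
    ultimately show ?thesis by (auto simp: S_def intro!: gen_base)
  qed (auto simp: S_def intro!: gen_base)
  ultimately show ?thesis using p_ge by simp
qed

lemma x_in: "x v \<in> gen (range x)"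
  by (rule gen_base) simp

lemma gen_x_subset: "gen (range x) \<subseteq> gen S"
proof (rule gen_subset, safe)
  fix v show "x v \<in> gen S"
  proof (cases "p dvd v")
    case True
    then have "x v = X" using x_cong[of v 0] by (simp add: x_0 cong_0_iff)
    then show ?thesis by (auto simp: S_def intro: gen_base)
  next
    case False
    then obtain i where "[r ^ i = v] (mod p)" using root_power_surj by blast
    from x_cong[OF this] y_in[of i] show ?thesis by (simp add: y_def)
  qed
qed

text \<open>Since \<open>b\<close> normalizes the group of the \<open>x v\<close>, the left side of
  the sixth relation is \<open>b ^ p\<close> times an element of that group, and its right side is
  \<open>b ^ (p - 1)\<close>.\<close>

lemma b_in: "b \<in> gen (range x)"
proof -
  have "cj g b \<in> gen (range x)" if "g \<in> gen (range x)" for g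
    using that by (rule gen_cj[rotated]) (auto simp: cj_x_b x_in)
  from collect_power[OF x_in[of 1] this, of p] obtain \<nu>
    where \<nu>: "\<nu> \<in> gen (range x)" "(b * x 1) ^ p = b ^ p * \<nu>" by blast
  then have "b ^ p * \<nu> = b ^ (p - 1)" using R6 by (simp add: x_1)
  moreover have "b ^ p = b ^ (p - 1) * b" using p_ge by (simp flip: power_Suc2)
  ultimately have "b * \<nu> = 1" by (simp add: mult.assoc) (metis lcancel mult_1_right)
  then have "b = inverse \<nu>" by (metis inverse_invol inverse_unique)
  then show ?thesis using \<nu> by simp
qed

text \<open>The second relation writes \<open>a\<close> as a conjugate of \<open>b\<close> by a
  power of \<open>a\<close>, times \<open>inverse b\<close>; conjugation by \<open>a\<close>
  permutes the \<open>x v\<close>.\<close>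

lemma a_in: "a \<in> gen (range x)"
proof -
  have "a ^ (s - 1) * a = a ^ s" using s(2) by (simp flip: power_Suc2)
  also have "\<dots> = b * cj (a ^ s) b * inverse b" by (simp add: cj_def mult.assoc)
  also have "cj (a ^ s) b = a ^ (s - 1)" by (rule R2)
  finally have "a ^ (s - 1) * a = b * a ^ (s - 1) * inverse b" .
  then have "a = inverse (a ^ (s - 1)) * (b * a ^ (s - 1) * inverse b)" by (metis linv_assoc)
  then have "a = cj b (a ^ (s - 1)) * inverse b" by (simp add: cj_def mult.assoc)
  moreover have "cj b (a ^ (s - 1)) \<in> gen (range x)"
    using b_in by (rule gen_cj[rotated]) (auto simp: cj_x_a x_in)
  ultimately show ?thesis using b_in by (metis gen_inverse gen_times)
qed

lemma cj_gen_S_c: "g \<in> gen S \<Longrightarrow> cj g c \<in> gen S"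
proof (rule gen_cj)
  fix t assume t: "t \<in> S"
  have Z: "Z j \<in> gen S" for j
  proof -
    have "Z j = Z (j mod L)" by (rule Z_cong) (simp add: cong_def)
    then show ?thesis using L by (auto simp: S_def intro!: gen_base)
  qed
  show "cj t c \<in> gen S"
    using t cj_X_c_power[of 1] cj_y_c_power[of _ 1] cj_Z[of _ 1] Z y_in
    by (auto simp: S_def intro: gen_base)
qed

text \<open>The exponent \<open>L + 2\<close> exceeds the period of \<open>c\<close> by 2, so
  exactly \<open>c ^ 2\<close> is captured. For odd \<open>L\<close> this yields \<open>c\<close>
  itself.\<close>

lemma c_square_in: "c ^ 2 \<in> gen S"
proof -
  have "wV L a b z \<in> gen S" by (simp add: wV_eq y_in)
  from collect_power[OF this cj_gen_S_c, of "L + 2"] obtain \<nu>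
    where \<nu>: "\<nu> \<in> gen S" "(c * wV L a b z) ^ (L + 2) = c ^ (L + 2) * \<nu>" by blast
  then have "c ^ 2 * \<nu> = 1" using R7 by (simp only: power_add c_power_L) simp
  then have "c ^ 2 = inverse \<nu>" by (metis inverse_invol inverse_unique)
  then show ?thesis using \<nu> by simp
qed

lemma c_in: "odd L \<Longrightarrow> c \<in> gen S"
proof -
  assume "odd L"
  then obtain k where "L = 2 * k + 1" by (auto elim: oddE)
  then have "c = c ^ (2 * k + 1) * c" using c_power_L by simp
  also have "\<dots> = (c ^ 2) ^ Suc k" by (simp add: power_mult power_Suc2 power2_eq_square mult.assoc del: power_Suc)
  finally show ?thesis using gen_power[OF c_square_in] by metis
qed

text \<open>Division of \<open>L\<close> by 3 reduces \<open>z ^ L\<close> to \<open>z\<close> or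
  \<open>z ^ 2\<close>, and \<open>z ^ 3\<close> turns \<open>z ^ 2\<close> into
  \<open>z\<close>.\<close>

lemma z_in: "X \<in> gen T \<Longrightarrow> c \<in> gen T \<Longrightarrow> z \<in> gen T"
proof -
  assume T: "X \<in> gen T" "c \<in> gen T"
  define k where "k = L div 3"
  have L': "L = 3 * k + L mod 3" by (simp add: k_def)
  then have "X = c ^ k * z ^ (L mod 3)" unfolding X_def c_def
    by (metis power_add power_mult)
  then have zm: "z ^ (L mod 3) \<in> gen T"
    using T by (metis gen_inverse gen_power gen_times linv_assoc)
  have "L mod 3 = 1 \<or> L mod 3 = 2" using L(3) by presburger
  then show ?thesis
  proof
    assume "L mod 3 = 2"
    then have "z = c * inverse (z ^ (L mod 3))" by (simp add: c_def power3_eq_cube power2_eq_square mult.assoc)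
    then show ?thesis using T zm by (metis gen_inverse gen_times)
  qed (use zm in simp)
qed

theorem card_gen:
  "finite (gen {a, b, z}) \<and> card (gen {a, b, z}) \<le> fact (f + L + 3) \<and>
    (odd L \<longrightarrow> 2 * card (gen {a, b, z}) \<le> fact (f + L + 3))"
proof (cases "odd L")
  case True
  have "{a, b, z} \<subseteq> gen S"
    using a_in b_in gen_x_subset z_in[of S] c_in[OF True] by (auto simp: S_def intro: gen_base)
  from gen_subset[OF this] have "finite (gen {a, b, z})" "card (gen {a, b, z}) \<le> card (gen S)"
    using gen_S by (auto intro: finite_subset card_mono)
  then show ?thesis using gen_S by linarith
next
  case False
  have "gen S \<subseteq> gen (insert c S)" by (rule gen_mono) blast
  then have "{a, b, z} \<subseteq> gen (insert c S)"
    using a_in b_in gen_x_subset z_in[of "insert c S"] by (auto simp: S_def intro: gen_base)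
  from gen_subset[OF this] have "finite (gen {a, b, z})" "card (gen {a, b, z}) \<le> 2 * card (gen S)"
    using gen_insert_normalizing[OF _ cj_gen_S_c c_square_in] gen_S
    by (auto intro: finite_subset order.trans[OF card_mono])
  then show ?thesis using False gen_S by linarith
qed

end

section \<open>Presentations and groups of bijections\<close>

text \<open>Bijections compose from left to right, so that \<open>cj g h\<close> is \<open>g\<close> with its points renamed
  by \<open>h\<close>.\<close>

typedef 'b bijn = "{h :: 'b \<Rightarrow> 'b. bij h}"
  morphisms act Bijn
  by (rule exI[of _ id]) simp

lemma bij_act [simp]: "bij (act g)"
  using act[of g] by simp

lemma act_Bijn: "bij h \<Longrightarrow> act (Bijn h) = h"
  by (simp add: Bijn_inverse)

instantiation bijn :: (type) mgroup
begin

definition "1 = Bijn id"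
definition "g * h = Bijn (act h \<circ> act g)"
definition "inverse g = Bijn (inv' (act g))"
definition "divide g h = g * inverse (h :: 'a bijn)"

instance
proof
  fix g h k :: "'a bijn"
  show "g * h * k = g * (h * k)"
    by (simp add: times_bijn_def act_Bijn bij_comp comp_assoc)
  show "1 * g = g" "g * 1 = g"
    by (simp_all add: times_bijn_def one_bijn_def act_Bijn act_inverse)
  show "inverse g * g = 1"
    by (simp add: times_bijn_def one_bijn_def inverse_bijn_def act_Bijn bij_imp_bij_inv
      surj_iff[THEN iffD1] bij_is_surj)
qed

end

lemma act_one [simp]: "act 1 = id"
  and act_times [simp]: "act (g * h) = act h \<circ> act g"
  and act_inverse_eq: "act (inverse g) = inv' (act g)"
  by (simp_all add: one_bijn_def times_bijn_def inverse_bijn_def act_Bijn bij_comp bij_imp_bij_inv)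

lemma bijn_eqI: "(\<And>q. act g q = act h q) \<Longrightarrow> g = h"
  by (simp add: act_inject[symmetric] fun_eq_iff)

lemma act_inverse_act [simp]: "act (inverse g) (act g q) = q" "act g (act (inverse g) q) = q"
  using act_times[of g "inverse g", THEN fun_cong, of q] act_times[of "inverse g" g, THEN fun_cong, of q]
  by simp_all

lemma act_inject_iff [simp]: "act g q = act g q' \<longleftrightarrow> q = q'"
  by (metis act_inverse_act(1))

lemma act_cj: "act (cj g h) (act h q) = act h (act g q)"
  by (simp add: cj_def)

section \<open>Evaluation of words and the Cayley representation\<close>

fun weval :: "('a \<Rightarrow> 'g::mgroup) \<Rightarrow> 'a word_expr \<Rightarrow> 'g"
  where
    "weval h (Gen x) = h x"
  | "weval h (Mul u v) = weval h u * weval h v"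
  | "weval h (Pow u m) = (if m < 0 then inverse (weval h u ^ nat (- m)) else weval h u ^ nat m)"

lemma word_eval_closed:
  assumes "group G" and "f ` X \<subseteq> carrier G" and "set_word_expr w \<subseteq> X"
  shows "word_eval G f w \<in> carrier G"
proof -
  interpret group G by fact
  show ?thesis using assms(2,3) by (induction w) auto
qed

lemma word_eval_hom:
  assumes "group_hom G H \<phi>" and "f ` X \<subseteq> carrier G" and "set_word_expr w \<subseteq> X"
  shows "word_eval H (\<lambda>x. \<phi> (f x)) w = \<phi> (word_eval G f w)"
proof -
  interpret group_hom G H \<phi> by fact
  show ?thesis using assms(2,3)
    by (induction w) (auto simp: word_eval_closed[OF G.is_group] hom_int_pow)
qed

lemma weval_hom:
  fixes \<rho> :: "'b \<Rightarrow> 'g::mgroup"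
  assumes "group G" and "f ` X \<subseteq> carrier G"
    and hom: "\<And>g h. g \<in> carrier G \<Longrightarrow> h \<in> carrier G \<Longrightarrow> \<rho> (g \<otimes>\<^bsub>G\<^esub> h) = \<rho> g * \<rho> h"
    and "set_word_expr w \<subseteq> X"
  shows "weval (\<lambda>x. \<rho> (f x)) w = \<rho> (word_eval G f w)"
proof -
  interpret group G by fact
  have one: "\<rho> \<one>\<^bsub>G\<^esub> = 1" using hom[of "\<one>\<^bsub>G\<^esub>" "\<one>\<^bsub>G\<^esub>"] lcancel[of "\<rho> \<one>\<^bsub>G\<^esub>" "\<rho> \<one>\<^bsub>G\<^esub>" 1] by simp
  have pow: "\<rho> (g [^]\<^bsub>G\<^esub> n) = \<rho> g ^ n" if "g \<in> carrier G" for g and n :: nat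
    using that by (induction n) (simp_all add: one hom power_Suc2 del: power_Suc)
  have inv: "\<rho> (inv\<^bsub>G\<^esub> g) = inverse (\<rho> g)" if "g \<in> carrier G" for g
    using hom[of g "inv\<^bsub>G\<^esub> g"] that one inverse_unique[of "\<rho> g" "\<rho> (inv\<^bsub>G\<^esub> g)"] by simp
  show ?thesis using assms(4)
  proof (induction w)
    case (Mul u v)
    then have "word_eval G f u \<in> carrier G" "word_eval G f v \<in> carrier G"
      by (auto intro: word_eval_closed[OF assms(1,2)])
    then show ?case using Mul by (simp add: hom)
  next
    case (Pow u m)
    then have "word_eval G f u \<in> carrier G" by (auto intro: word_eval_closed[OF assms(1,2)])
    moreover from Pow have "weval (\<lambda>x. \<rho> (f x)) u = \<rho> (word_eval G f u)" by simp
    ultimately show ?case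
      by (cases "m < 0") (simp_all only: word_eval.simps weval.simps int_pow_def2 inv nat_pow_closed pow if_True if_False)
  qed simp
qed

text \<open>Right multiplication fits the composition from left to right; it is extended by the
  identity to the elements of the type outside the carrier.\<close>

lemma cayley_representation:
  assumes "group (G :: ('b, 'm) monoid_scheme)"
  obtains \<rho> :: "'b \<Rightarrow> 'b bijn" where "inj_on \<rho> (carrier G)"
    and "\<And>g h. g \<in> carrier G \<Longrightarrow> h \<in> carrier G \<Longrightarrow> \<rho> (g \<otimes>\<^bsub>G\<^esub> h) = \<rho> g * \<rho> h"
    and "\<rho> \<one>\<^bsub>G\<^esub> = 1"
proof
  interpret group G by fact
  define \<rho> where "\<rho> g = Bijn (\<lambda>q. if q \<in> carrier G then q \<otimes>\<^bsub>G\<^esub> g else q)" for g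
  have act_\<rho>: "act (\<rho> g) = (\<lambda>q. if q \<in> carrier G then q \<otimes>\<^bsub>G\<^esub> g else q)" if "g \<in> carrier G" for g
    unfolding \<rho>_def using that
    by (intro act_Bijn o_bij[of "\<lambda>q. if q \<in> carrier G then q \<otimes>\<^bsub>G\<^esub> inv\<^bsub>G\<^esub> g else q"])
      (auto simp: fun_eq_iff m_assoc)
  show "\<rho> (g \<otimes>\<^bsub>G\<^esub> h) = \<rho> g * \<rho> h" if "g \<in> carrier G" "h \<in> carrier G" for g h
    using that by (intro bijn_eqI) (auto simp: act_\<rho> m_assoc)
  show "\<rho> \<one>\<^bsub>G\<^esub> = 1" by (intro bijn_eqI) (simp add: act_\<rho>)
  show "inj_on \<rho> (carrier G)"
  proof
    fix g h assume gh: "g \<in> carrier G" "h \<in> carrier G" "\<rho> g = \<rho> h"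
    then have "act (\<rho> g) \<one>\<^bsub>G\<^esub> = act (\<rho> h) \<one>\<^bsub>G\<^esub>" by simp
    then show "g = h" using gh(1,2) by (simp only: act_\<rho> one_closed if_True l_one)
  qed
qed

section \<open>The universal property of the free group\<close>

context
  fixes H :: "('b, 'm) monoid_scheme" and X :: "'a set" and f :: "'a \<Rightarrow> 'b"
  assumes H: "group H" and f: "f ` X \<subseteq> carrier H"
begin

interpretation H: group H by (rule H)

definition letter_eval :: "'a letter \<Rightarrow> 'b"
  where "letter_eval l = (if snd l then f (fst l) else inv\<^bsub>H\<^esub> f (fst l))"

definition list_eval :: "'a letter list \<Rightarrow> 'b"
  where "list_eval w = foldr (\<lambda>l g. letter_eval l \<otimes>\<^bsub>H\<^esub> g) w \<one>\<^bsub>H\<^esub>"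

lemma letter_eval_closed: "fst l \<in> X \<Longrightarrow> letter_eval l \<in> carrier H"
  using f by (auto simp: letter_eval_def)

lemma list_eval_closed: "fst ` set w \<subseteq> X \<Longrightarrow> list_eval w \<in> carrier H"
  by (induction w) (auto simp: list_eval_def letter_eval_closed)

lemma list_eval_cons_reduced:
  assumes "fst l \<in> X" "fst ` set w \<subseteq> X"
  shows "list_eval (cons_reduced l w) = letter_eval l \<otimes>\<^bsub>H\<^esub> list_eval w"
proof (cases w)
  case (Cons k v)
  show ?thesis
  proof (cases "k = inv_letter l")
    case True
    have "list_eval w = letter_eval (inv_letter l) \<otimes>\<^bsub>H\<^esub> list_eval v"
      using Cons True by (simp add: list_eval_def)
    moreover have "letter_eval l \<otimes>\<^bsub>H\<^esub> letter_eval (inv_letter l) = \<one>\<^bsub>H\<^esub>"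
      using assms(1) f by (auto simp: letter_eval_def inv_letter_def)
    moreover have "letter_eval l \<in> carrier H" "letter_eval (inv_letter l) \<in> carrier H" "list_eval v \<in> carrier H"
      using assms Cons by (auto intro: letter_eval_closed list_eval_closed)
    ultimately show ?thesis using Cons True by (simp flip: H.m_assoc)
  qed (use Cons in \<open>simp add: list_eval_def\<close>)
qed (simp add: list_eval_def)

lemma list_eval_foldr:
  assumes "fst ` set u \<subseteq> X" "fst ` set w \<subseteq> X"
  shows "list_eval (foldr cons_reduced u w) = list_eval u \<otimes>\<^bsub>H\<^esub> list_eval w"
  using assms
proof (induction u)
  case Nil
  then show ?case using list_eval_closed[of w] by (simp add: list_eval_def)
next
  case (Cons l u)
  have "fst ` set (foldr cons_reduced u w) \<subseteq> X"
  proof -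
    have "fst ` set (foldr cons_reduced u w) \<subseteq> fst ` (set u \<union> set w)"
      by (intro image_mono set_foldr_cons_reduced)
    also have "\<dots> \<subseteq> X" using Cons.prems by (simp add: image_Un)
    finally show ?thesis .
  qed
  moreover have "list_eval (l # u) = letter_eval l \<otimes>\<^bsub>H\<^esub> list_eval u" by (simp add: list_eval_def)
  ultimately show ?case
    using Cons by (simp add: list_eval_cons_reduced H.m_assoc letter_eval_closed list_eval_closed)
qed

lemma list_eval_group_hom: "group_hom (free_group X) H list_eval"
proof (intro group_hom.intro group_free_group H group_hom_axioms.intro homI)
  fix u v assume "u \<in> carrier (free_group X)" "v \<in> carrier (free_group X)"
  then have *: "fst ` set u \<subseteq> X" "fst ` set v \<subseteq> X" "reduced v" by (auto simp: free_group_def)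
  then have "reduce (u @ v) = foldr cons_reduced u v"
    using reduce_reduced[of v] by (simp add: reduce_def)
  then show "list_eval (u \<otimes>\<^bsub>free_group X\<^esub> v) = list_eval u \<otimes>\<^bsub>H\<^esub> list_eval v"
    using * by (simp add: free_group_def list_eval_foldr)
next
  fix u assume "u \<in> carrier (free_group X)"
  then show "list_eval u \<in> carrier H" by (intro list_eval_closed) (auto simp: free_group_def)
qed

lemma list_eval_free_eval:
  assumes "set_word_expr w \<subseteq> X"
  shows "list_eval (free_eval X w) = word_eval H f w"
proof -
  have "(\<lambda>x. [(x, True)]) ` X \<subseteq> carrier (free_group X)" by (auto simp: free_group_def)
  from word_eval_hom[OF list_eval_group_hom this assms]
  have "list_eval (free_eval X w) = word_eval H (\<lambda>x. list_eval [(x, True)]) w"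
    by (simp add: free_eval_def)
  also have "\<dots> = word_eval H f w"
    using assms f by (induction w) (auto simp: list_eval_def letter_eval_def)
  finally show ?thesis .
qed

end

lemma normal_closure_normal:
  assumes "group G" "S \<subseteq> carrier G"
  shows "normal_closure G S \<lhd> G"
proof -
  interpret group G by fact
  have "subgroup (\<Inter>{N. N \<lhd> G \<and> S \<subseteq> N}) G"
    using assms normal_self by (intro subgroups_Inter) (auto simp: normal_imp_subgroup)
  then show ?thesis
    unfolding normal_closure_def normal_inv_iff by (auto simp: normal_inv_iff)
qed

text \<open>The Cayley representation of the presented group turns the bound for groups of bijections into a bound for
  its order, which leaves no room for a kernel of the map onto \<open>H\<close>.\<close>

theorem presentation_criterion:
  fixes H :: "('b, 'm) monoid_scheme" and X :: "'a set" and f :: "'a \<Rightarrow> 'b"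
  assumes H: "group H" "finite (carrier H)" and f: "f ` X \<subseteq> carrier H"
    and words: "\<And>w. w \<in> R \<Longrightarrow> set_word_expr w \<subseteq> X"
    and rels: "\<And>w. w \<in> R \<Longrightarrow> word_eval H f w = \<one>\<^bsub>H\<^esub>"
    and gens: "\<And>K. subgroup K H \<Longrightarrow> f ` X \<subseteq> K \<Longrightarrow> carrier H \<subseteq> K"
    and bound: "\<And>h :: 'a \<Rightarrow> 'a letter list set bijn. (\<And>w. w \<in> R \<Longrightarrow> weval h w = 1) \<Longrightarrow>
      finite (gen (h ` X)) \<and> card (gen (h ` X)) \<le> card (carrier H)"
  shows "is_presentation_of X R H"
proof -
  let ?F = "free_group X" and ?\<phi> = "list_eval H f"
  note mult_FactGroup [simp del] one_FactGroup [simp del]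
  define N where "N = normal_closure ?F (free_eval X ` R)"
  let ?Q = "?F Mod N"
  interpret \<phi>: group_hom ?F H ?\<phi> by (rule list_eval_group_hom[OF H(1) f])
  have letters: "(\<lambda>x. [(x, True)]) ` X \<subseteq> carrier ?F" by (auto simp: free_group_def)
  have R_carrier: "free_eval X ` R \<subseteq> carrier ?F"
    using word_eval_closed[OF group_free_group letters words] by (auto simp: free_eval_def)
  interpret N: normal N ?F
    unfolding N_def using group_free_group R_carrier by (rule normal_closure_normal)
  interpret Q: group ?Q by (rule N.factorgroup_is_group)
  let ?\<pi> = "\<lambda>w. N #>\<^bsub>?F\<^esub> w"
  interpret \<pi>: group_hom ?F ?Q ?\<pi>
    by (intro group_hom.intro group_free_group Q.is_group group_hom_axioms.intro N.r_coset_hom_Mod)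
  have carrier_Q: "carrier ?Q = ?\<pi> ` carrier ?F" by (auto simp: FactGroup_def RCOSETS_def)
  \<comment> \<open>The presented group consists of cosets of words, which is why
    \<open>bound\<close> speaks of bijections of just this type.\<close>
  obtain \<rho> :: "'a letter list set \<Rightarrow> 'a letter list set bijn"
    where \<rho>_inj: "inj_on \<rho> (carrier ?Q)"
      and \<rho>_hom: "\<And>g h. g \<in> carrier ?Q \<Longrightarrow> h \<in> carrier ?Q \<Longrightarrow> \<rho> (g \<otimes>\<^bsub>?Q\<^esub> h) = \<rho> g * \<rho> h"
      and \<rho>_one: "\<rho> \<one>\<^bsub>?Q\<^esub> = 1"
    by (rule cayley_representation[OF Q.is_group]) (rule that)
  define h where "h = (\<lambda>x. \<rho> (?\<pi> [(x, True)]))"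
  have h_app: "h x = \<rho> (?\<pi> [(x, True)])" for x by (simp add: h_def)
  have h_rel: "weval h w = 1" if w: "w \<in> R" for w
  proof -
    have "(\<lambda>x. ?\<pi> [(x, True)]) ` X \<subseteq> carrier ?Q" using letters by auto
    from weval_hom[OF Q.is_group this \<rho>_hom words[OF w]]
    have "weval h w = \<rho> (word_eval ?Q (\<lambda>x. ?\<pi> [(x, True)]) w)" by (simp add: h_def)
    also have "word_eval ?Q (\<lambda>x. ?\<pi> [(x, True)]) w = ?\<pi> (free_eval X w)"
      using word_eval_hom[OF \<pi>.group_hom_axioms letters words[OF w]] by (simp add: free_eval_def)
    also have "free_eval X w \<in> N" using w by (auto simp: N_def normal_closure_def)
    then have "?\<pi> (free_eval X w) = \<one>\<^bsub>?Q\<^esub>" using N.rcos_const by (simp add: FactGroup_def)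
    also note \<rho>_one
    finally show ?thesis .
  qed
  have \<rho>_gen: "\<rho> (?\<pi> (reduce w)) \<in> gen (h ` X)" if "set w \<subseteq> X \<times> UNIV" for w
    using that
  proof (induction w)
    case Nil
    have "?\<pi> (reduce []) = \<one>\<^bsub>?Q\<^esub>" using \<pi>.hom_one by (simp add: reduce_def free_group_def)
    then show ?case using \<rho>_one by (simp add: gen_one)
  next
    case (Cons l w)
    have l: "[l] \<in> carrier ?F" and w: "reduce w \<in> carrier ?F"
      using Cons.prems set_reduce[of w] by (auto simp: free_group_def reduced_reduce mem_Times_iff)
    have "reduce (l # w) = [l] \<otimes>\<^bsub>?F\<^esub> reduce w"
      by (simp add: free_group_def reduce_append_reduce(2)[of "[l]" w, simplified])
    then have "\<rho> (?\<pi> (reduce (l # w))) = \<rho> (?\<pi> [l]) * \<rho> (?\<pi> (reduce w))"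
      using l w by (simp add: \<rho>_hom)
    moreover have "\<rho> (?\<pi> [l]) \<in> gen (h ` X)"
    proof (cases "snd l")
      case True
      then have "l = (fst l, True)" by (simp add: prod_eq_iff)
      then have "\<rho> (?\<pi> [l]) = h (fst l)" by (metis h_app)
      then show ?thesis using Cons.prems by (auto intro: gen_base)
    next
      case False
      have l': "[(fst l, True)] \<in> carrier ?F" using Cons.prems by (auto simp: free_group_def)
      have "[l] \<otimes>\<^bsub>?F\<^esub> [(fst l, True)] = \<one>\<^bsub>?F\<^esub>"
        using False by (simp add: free_group_def reduce_def inv_letter_def prod_eq_iff)
      then have "\<rho> (?\<pi> [l]) * h (fst l) = \<rho> (?\<pi> \<one>\<^bsub>?F\<^esub>)"
        using l l' \<rho>_hom by (metis h_app \<pi>.hom_closed \<pi>.hom_mult)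
      also have "\<dots> = 1" unfolding \<pi>.hom_one by (rule \<rho>_one)
      finally have "inverse (\<rho> (?\<pi> [l])) = h (fst l)" by (rule inverse_unique)
      then have "\<rho> (?\<pi> [l]) = inverse (h (fst l))" by (metis inverse_invol)
      then show ?thesis using Cons.prems by (auto intro: gen_base)
    qed
    ultimately show ?case using Cons by (auto intro: gen_times)
  qed
  have "\<rho> ` carrier ?Q \<subseteq> gen (h ` X)"
  proof safe
    fix g assume "g \<in> carrier ?Q"
    then obtain w where w: "w \<in> carrier ?F" "g = ?\<pi> w" using carrier_Q by blast
    then have "set w \<subseteq> X \<times> UNIV" "reduce w = w" by (auto simp: free_group_def reduce_reduced)
    then show "\<rho> g \<in> gen (h ` X)" using \<rho>_gen w by metis
  qed
  then have fin_Q: "finite (carrier ?Q)" and card_Q: "card (carrier ?Q) \<le> card (carrier H)"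
    using bound[OF h_rel] \<rho>_inj
    by (auto dest: finite_subset simp: finite_image_iff) (metis card_image card_mono le_trans)
  have surj: "?\<phi> ` carrier ?F = carrier H"
  proof
    have "f x = ?\<phi> [(x, True)]" if "x \<in> X" for x
      using list_eval_free_eval[OF H(1) f, of "Gen x"] that by (simp add: free_eval_def)
    then have "f ` X \<subseteq> ?\<phi> ` carrier ?F" using letters by auto
    with gens[OF \<phi>.img_is_subgroup] show "carrier H \<subseteq> ?\<phi> ` carrier ?F" by blast
  qed auto
  have "free_eval X ` R \<subseteq> kernel ?F H ?\<phi>"
    using R_carrier rels words list_eval_free_eval[OF H(1) f] by (auto simp: kernel_def)
  then have N_ker: "N \<subseteq> kernel ?F H ?\<phi>"
    using \<phi>.normal_kernel unfolding N_def normal_closure_def by blast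
  \<comment> \<open>The map induced on cosets is onto \<open>H\<close>, and its source is no larger
    than \<open>H\<close>; so it is injective and the kernel is contained in
    \<open>N\<close>.\<close>
  define \<psi> where "\<psi> C = the_elem (?\<phi> ` C)" for C
  have \<psi>: "\<psi> (?\<pi> w) = ?\<phi> w" if w: "w \<in> carrier ?F" for w
  proof -
    have "?\<phi> ` ?\<pi> w = {?\<phi> w}"
    proof
      show "?\<phi> ` ?\<pi> w \<subseteq> {?\<phi> w}"
        using w N_ker N.subset by (auto simp: r_coset_def kernel_def subset_iff)
      show "{?\<phi> w} \<subseteq> ?\<phi> ` ?\<pi> w"
        using \<phi>.G.rcos_self[OF w N.subgroup_axioms] by simp
    qed
    then show ?thesis by (simp add: \<psi>_def)
  qed
  have "\<psi> ` carrier ?Q = carrier H" using \<psi> surj unfolding carrier_Q by (force simp: image_image)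
  then have \<psi>_inj: "inj_on \<psi> (carrier ?Q)"
    using card_Q fin_Q by (intro eq_card_imp_inj_on) (auto intro!: antisym card_image_le dest: card_image_le[of _ \<psi>])
  have "kernel ?F H ?\<phi> \<subseteq> N"
  proof
    fix w assume "w \<in> kernel ?F H ?\<phi>"
    then have w: "w \<in> carrier ?F" "?\<phi> w = ?\<phi> \<one>\<^bsub>?F\<^esub>" by (auto simp: kernel_def)
    then have "\<psi> (?\<pi> w) = \<psi> (?\<pi> \<one>\<^bsub>?F\<^esub>)"
      by (simp only: \<psi>[OF w(1)] \<psi>[OF \<phi>.G.one_closed])
    then have "?\<pi> w = ?\<pi> \<one>\<^bsub>?F\<^esub>"
      by (rule inj_onD[OF \<psi>_inj]) (simp_all only: carrier_Q imageI w(1) \<phi>.G.one_closed)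
    also have "\<dots> = N" using N.subset by (rule \<phi>.G.coset_mult_one)
    finally show "w \<in> N" using \<phi>.G.rcos_self[OF w(1) N.subgroup_axioms] by simp
  qed
  then have "N = kernel ?F H ?\<phi>" using N_ker by blast
  then have "?Q \<cong> H" using \<phi>.FactGroup_iso[OF surj] by simp
  then show ?thesis using words by (simp add: is_presentation_of_def presented_group_def N_def)
qed

section \<open>Groups generated by 3-cycles\<close>

definition sw :: "nat \<Rightarrow> nat \<Rightarrow> nat bijn"
  where "sw q q' = Bijn (transpose q q')"

definition tri :: "nat \<Rightarrow> nat \<Rightarrow> nat \<Rightarrow> nat bijn"
  where "tri u v q = sw u v * sw u q"

lemma act_sw [simp]: "act (sw q q') = transpose q q'"
  by (simp add: sw_def act_Bijn)

lemma sw_commute: "sw q q' = sw q' q"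
  by (simp add: sw_def transpose_commute)

lemma cj_sw: "cj (sw q q') g = sw (act g q) (act g q')"
proof (rule bijn_eqI)
  fix t
  obtain t' where t: "t = act g t'" using act_inverse_act(2)[of g t] by metis
  show "act (cj (sw q q') g) t = act (sw (act g q) (act g q')) t"
    by (simp add: t act_cj transpose_def)
qed

lemma cj_tri: "cj (tri u v q) g = tri (act g u) (act g v) (act g q)"
  by (simp add: tri_def cj_times cj_sw)

lemma act_tri: "u \<noteq> v \<Longrightarrow> q \<noteq> u \<Longrightarrow> q \<noteq> v \<Longrightarrow>
    act (tri u v q) t = (if t = u then v else if t = v then q else if t = q then u else t)"
  by (auto simp: tri_def transpose_def)

lemma inverse_tri: "u \<noteq> v \<Longrightarrow> q \<noteq> u \<Longrightarrow> q \<noteq> v \<Longrightarrow> inverse (tri u v q) = tri v u q"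
  by (rule inverse_unique, rule bijn_eqI) (auto simp: act_tri)

lemma tri_cube: "u \<noteq> v \<Longrightarrow> q \<noteq> u \<Longrightarrow> q \<noteq> v \<Longrightarrow> tri u v q ^ 3 = 1"
  by (rule bijn_eqI) (auto simp: act_tri power3_eq_cube)

lemma tri_tri: "u \<noteq> v \<Longrightarrow> q \<noteq> u \<Longrightarrow> q \<noteq> v \<Longrightarrow> q' \<noteq> u \<Longrightarrow> q' \<noteq> v \<Longrightarrow> q \<noteq> q' \<Longrightarrow>
    (tri u v q * tri u v q') ^ 2 = 1"
  by (rule bijn_eqI) (auto simp: act_tri power2_eq_square)

lemma dbl_tri: "u \<noteq> v \<Longrightarrow> q \<noteq> u \<Longrightarrow> q \<noteq> v \<Longrightarrow> q' \<noteq> u \<Longrightarrow> q' \<noteq> v \<Longrightarrow> q \<noteq> q' \<Longrightarrow>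
    dbl (tri u v q) (tri u v q') = sw u v * sw q q'"
  by (rule bijn_eqI) (auto simp: dbl_def inverse_tri act_tri transpose_def)

lemma gen_preserves:
  assumes "\<And>s. s \<in> S \<Longrightarrow> act s m = m"
  shows "g \<in> gen S \<Longrightarrow> act g m = m"
proof (induction rule: gen.induct)
  case (gen_step_inv g s)
  then show ?case using assms[of s] act_inverse_act(1)[of s m] by simp
qed (use assms in auto)

text \<open>The lower bound matches the one of Carmichael's presentation: the stabilizer of a point
  has at least as many cosets as the point has images.\<close>

lemma card_gen_tri:
  assumes "finite I" "u \<noteq> v" "u \<notin> I" "v \<notin> I"
  shows "finite (gen (tri u v ` I)) \<and> 2 * card (gen (tri u v ` I)) = fact (card I + 2)"
proof -
  have upper: "finite (gen (tri u v ` I)) \<and> 2 * card (gen (tri u v ` I)) \<le> fact (card I + 2)"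
    if I: "finite I" "u \<notin> I" "v \<notin> I" for I
  proof -
    have "finite (gen (tri u v ` I)) \<and> 2 * card (gen (tri u v ` I)) \<le> fact (card (tri u v ` I) + 2)"
      using I assms(2) by (intro carmichael) (auto intro!: tri_cube tri_tri)
    moreover have "fact (card (tri u v ` I) + 2) \<le> (fact (card I + 2) :: nat)"
      using card_image_le[OF I(1), of "tri u v"] by (intro fact_mono_nat) simp
    ultimately show ?thesis by linarith
  qed
  from assms have "2 * card (gen (tri u v ` I)) \<ge> fact (card I + 2)"
  proof (induction I)
    case empty
    have "gen {} = {1 :: nat bijn}"
    proof -
      have "g = 1" if "g \<in> gen {}" for g :: "nat bijn"
        using that by (induction rule: gen.induct) auto
      then show ?thesis by (auto intro: gen_one)
    qed
    then show ?case by simp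
  next
    case (insert m I)
    let ?K = "gen (tri u v ` I)" and ?K' = "gen (tri u v ` insert m I)"
    have m: "m \<noteq> u" "m \<noteq> v" using insert by auto
    have KK': "?K \<subseteq> ?K'" by (intro gen_mono) auto
    have fix_m: "act g m = m" if "g \<in> ?K" for g
      using that by (rule gen_preserves[rotated]) (use insert in \<open>auto simp: tri_def transpose_def\<close>)
    have "\<exists>t\<in>?K'. act t m = q" if q: "q \<in> insert u (insert v (insert m I))" for q
    proof -
      have T: "tri u v q \<in> ?K'" if "q \<in> insert m I" for q using that by (auto intro: gen_base)
      consider "q = m" | "q = u" | "q = v" | "q \<in> I" using q by blast
      then show ?thesis
      proof cases
        case 1
        then show ?thesis by (intro bexI[of _ 1]) (auto intro: gen_one)
      next
        case 2
        then show ?thesis using T[of m] insert m by (intro bexI[of _ "tri u v m"]) (auto simp: act_tri)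
      next
        case 3
        moreover have "tri v u m \<in> ?K'"
          using T[of m] insert m by (simp flip: inverse_tri[of u v m])
        ultimately show ?thesis using insert m by (intro bexI[of _ "tri v u m"]) (auto simp: act_tri)
      next
        case 4
        then have "q \<noteq> u" "q \<noteq> v" using insert by auto
        then have "act (tri v u m * tri u v q) m = q" using m insert by (simp add: act_tri)
        moreover have "tri v u m * tri u v q \<in> ?K'"
          using 4 insert m T[of m] T[of q] by (auto simp flip: inverse_tri[of u v m] intro!: gen_times)
        ultimately show ?thesis by blast
      qed
    qed
    then obtain t where t: "\<And>q. q \<in> insert u (insert v (insert m I)) \<Longrightarrow> t q \<in> ?K' \<and> act (t q) m = q"
      by metis
    have "inj_on (\<lambda>(g, q). g * t q) (?K \<times> insert u (insert v (insert m I)))"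
    proof (rule inj_onI, clarify)
      fix g q g' q'
      assume *: "g \<in> ?K" "g' \<in> ?K" "q \<in> insert u (insert v (insert m I))"
        "q' \<in> insert u (insert v (insert m I))" "g * t q = g' * t q'"
      then have "act (g * t q) m = act (g' * t q') m" by (simp only:)
      then have "act (t q) (act g m) = act (t q') (act g' m)" by simp
      then have "q = q'" using t[OF *(3)] t[OF *(4)] fix_m[OF *(1)] fix_m[OF *(2)] by simp
      then show "g = g' \<and> q = q'" using * by simp
    qed
    moreover have "(\<lambda>(g, q). g * t q) ` (?K \<times> insert u (insert v (insert m I))) \<subseteq> ?K'"
      using t KK' by (auto intro!: gen_times)
    ultimately have "card (?K \<times> insert u (insert v (insert m I))) \<le> card ?K'"
      using upper[of "insert m I"] insert by (intro card_inj_on_le) auto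
    moreover have "card (insert u (insert v (insert m I))) = card I + 3" using insert by simp
    ultimately have le: "card ?K * (card I + 3) \<le> card ?K'" by (simp add: card_cartesian_product)
    have "fact (card (insert m I) + 2) = fact (card I + 2) * (card I + 3)"
      using insert by (simp add: algebra_simps)
    also have "\<dots> \<le> 2 * card ?K * (card I + 3)"
      by (intro mult_le_mono1 insert.IH) (use insert.prems in auto)
    also have "\<dots> \<le> 2 * card ?K'" using le by linarith
    finally show ?case .
  qed
  then show ?thesis using upper[OF assms(1,3,4)] by simp
qed

section \<open>Parity and the passage to alternating and symmetric groups\<close>

lemma gen_permutes:
  assumes "\<And>s. s \<in> S \<Longrightarrow> act s permutes I"
  shows "g \<in> gen S \<Longrightarrow> act g permutes I"
proof (induction rule: gen.induct)
  case gen_one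
  show ?case unfolding act_one by (rule permutes_id)
next
  case (gen_step g s)
  then show ?case unfolding act_times using permutes_compose assms by blast
next
  case (gen_step_inv g s)
  then show ?case unfolding act_times act_inverse_eq
    using permutes_compose permutes_inv assms by blast
qed

lemma gen_evenperm:
  assumes "\<And>s. s \<in> S \<Longrightarrow> act s permutes I" "\<And>s. s \<in> S \<Longrightarrow> evenperm (act s)" "finite I"
  shows "g \<in> gen S \<Longrightarrow> evenperm (act g)"
proof (induction rule: gen.induct)
  case gen_one
  then show ?case by (simp add: evenperm_id)
next
  case (gen_step g s)
  then have "permutation (act g)" "permutation (act s)"
    using gen_permutes[OF assms(1)] assms by (auto simp: permutation_permutes)
  then show ?case using gen_step(2,3) assms(2) unfolding act_times by (simp only: evenperm_comp)
next
  case (gen_step_inv g s)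
  then have "permutation (act g)" "permutation (act s)"
    using gen_permutes[OF assms(1)] assms by (auto simp: permutation_permutes)
  then show ?case using gen_step_inv(2,3) assms(2) unfolding act_times act_inverse_eq
    by (simp only: evenperm_comp evenperm_inv permutation_inverse)
qed

lemma tri_permutes: "u \<in> I \<Longrightarrow> v \<in> I \<Longrightarrow> q \<in> I \<Longrightarrow> act (tri u v q) permutes I"
  by (simp add: tri_def permutes_compose permutes_swap_id)

lemma evenperm_tri: "u \<noteq> v \<Longrightarrow> q \<noteq> u \<Longrightarrow> evenperm (act (tri u v q))"
  by (simp add: tri_def evenperm_comp evenperm_swap permutation_swap_id)

definition flip :: "'b bijn \<Rightarrow> 'b \<Rightarrow> 'b"
  where "flip g = act (inverse g)"

lemma inj_flip: "inj flip"
  by (rule injI) (simp add: flip_def act_inject)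

lemma gen_tri_alt_group:
  assumes "u \<in> {1..n}" "v \<in> {1..n}" "u \<noteq> v"
  shows "flip ` gen (tri u v ` ({1..n} - {u, v})) = carrier (alt_group n)"
proof -
  let ?K = "gen (tri u v ` ({1..n} - {u, v}))"
  have card: "card ({1..n} - {u, v}) + 2 = n" and n: "n \<ge> 2"
    using assms card_mono[of "{1..n}" "{u, v}"] by (auto simp: card_Diff_subset)
  have K: "finite ?K \<and> 2 * card ?K = fact n"
    using card_gen_tri[of "{1..n} - {u, v}" u v, unfolded card] assms by simp
  have "flip g \<in> carrier (alt_group n)" if g: "g \<in> ?K" for g
  proof -
    have "inverse g \<in> ?K" using g by simp
    then have "act (inverse g) permutes {1..n}" "evenperm (act (inverse g))"
      using assms by (auto intro: gen_permutes[rotated] gen_evenperm[rotated 3, of _ _ "{1..n}"]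
        intro!: tri_permutes evenperm_tri)
    then show ?thesis by (simp add: flip_def alt_group_carrier)
  qed
  then have sub: "flip ` ?K \<subseteq> carrier (alt_group n)" by blast
  have "card (flip ` ?K) = card ?K" by (intro card_image inj_on_subset[OF inj_flip]) simp
  then have "card (flip ` ?K) = card (carrier (alt_group n))"
    using K alt_group_card_carrier[OF n] by simp
  moreover have "finite (carrier (alt_group n))"
    using alt_group_card_carrier[OF n] card.infinite[of "carrier (alt_group n)"] fact_gt_zero[of n] by fastforce
  ultimately show ?thesis using sub by (intro card_subset_eq)
qed

text \<open>Inversion turns the composition from left to right into \<open>(\<circ>)\<close>.\<close>

lemma presentation_of_bijns:
  fixes H :: "(nat \<Rightarrow> nat) monoid" and h :: "'a \<Rightarrow> nat bijn"
  assumes H: "group H" "mult H = (\<circ>)" "one H = id"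
    and carrier: "carrier H = flip ` gen (h ` X)" and fin: "finite (gen (h ` X))"
    and words: "\<And>w. w \<in> R \<Longrightarrow> set_word_expr w \<subseteq> X"
    and rels: "\<And>w. w \<in> R \<Longrightarrow> weval h w = 1"
    and bound: "\<And>k :: 'a \<Rightarrow> 'a letter list set bijn. (\<And>w. w \<in> R \<Longrightarrow> weval k w = 1) \<Longrightarrow>
      finite (gen (k ` X)) \<and> card (gen (k ` X)) \<le> card (gen (h ` X))"
  shows "is_presentation_of X R H"
proof (rule presentation_criterion[where f = "\<lambda>x. flip (h x)"])
  interpret group H by fact
  show "group H" by fact
  have card: "card (carrier H) = card (gen (h ` X))"
    unfolding carrier by (intro card_image inj_on_subset[OF inj_flip]) simp
  show "finite (carrier H)" using carrier fin by simp
  show f: "(\<lambda>x. flip (h x)) ` X \<subseteq> carrier H"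
    by (auto simp: carrier intro!: imageI gen_base)
  show "set_word_expr w \<subseteq> X" if "w \<in> R" for w using words that .
  show "word_eval H (\<lambda>x. flip (h x)) w = \<one>\<^bsub>H\<^esub>" if w: "w \<in> R" for w
  proof -
    define \<rho> where "\<rho> p = inverse (Bijn p)" for p :: "nat \<Rightarrow> nat"
    have \<rho>: "\<rho> (flip g) = g" for g by (simp add: \<rho>_def flip_def act_inverse)
    have flip_\<rho>: "flip (\<rho> p) = p" if "p \<in> carrier H" for p
      using that by (auto simp: carrier \<rho>)
    have \<rho>_hom: "\<rho> (a \<otimes>\<^bsub>H\<^esub> b) = \<rho> a * \<rho> b" if "a \<in> carrier H" "b \<in> carrier H" for a b
    proof -
      obtain g g' where "a = flip g" "b = flip g'" using \<open>a \<in> carrier H\<close> \<open>b \<in> carrier H\<close> carrier by auto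
      moreover from this have "a \<otimes>\<^bsub>H\<^esub> b = flip (g * g')" by (simp add: H flip_def)
      ultimately show ?thesis by (simp add: \<rho>)
    qed
    have "weval (\<lambda>x. \<rho> (flip (h x))) w = \<rho> (word_eval H (\<lambda>x. flip (h x)) w)"
      by (rule weval_hom[OF H(1) f _ words[OF w]]) (rule \<rho>_hom)
    then have "weval h w = \<rho> (word_eval H (\<lambda>x. flip (h x)) w)" by (simp add: \<rho>)
    then have "flip (\<rho> (word_eval H (\<lambda>x. flip (h x)) w)) = flip 1" using rels[OF w] by simp
    then show ?thesis
      using flip_\<rho> word_eval_closed[OF H(1) f words[OF w]] by (simp add: flip_def H)
  qed
  show "carrier H \<subseteq> K" if K: "subgroup K H" "(\<lambda>x. flip (h x)) ` X \<subseteq> K" for K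
  proof -
    interpret K: subgroup K H by fact
    have flip_inverse: "flip (inverse g) = inv\<^bsub>H\<^esub> flip g" if "flip g \<in> carrier H" "flip (inverse g) \<in> carrier H" for g
      using that by (intro inv_equality[symmetric]) (auto simp: H flip_def fun_eq_iff)
    have "flip g \<in> K" if "g \<in> gen (h ` X)" for g
      using that
    proof (induction rule: gen.induct)
      case gen_one
      show ?case using K.one_closed by (simp only: H flip_def inverse_one act_one)
    next
      case (gen_step g s)
      then have "flip g \<otimes>\<^bsub>H\<^esub> flip s \<in> K" using K by (intro K.m_closed) auto
      then show ?case by (simp only: H flip_def inverse_times act_times)
    next
      case (gen_step_inv g s)
      then have s: "flip s \<in> K" "flip (inverse s) \<in> carrier H"
        using K carrier by (auto intro!: imageI intro: gen_base)
      then have "flip (inverse s) \<in> K" using flip_inverse K.mem_carrier K.m_inv_closed by metis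
      then have "flip g \<otimes>\<^bsub>H\<^esub> flip (inverse s) \<in> K" using gen_step_inv by (intro K.m_closed) auto
      then show ?case by (simp only: H flip_def inverse_times act_times)
    qed
    then show ?thesis using carrier by auto
  qed
  show "finite (gen (k ` X)) \<and> card (gen (k ` X)) \<le> card (carrier H)"
    if "\<And>w. w \<in> R \<Longrightarrow> weval k w = 1" for k :: "'a \<Rightarrow> 'a letter list set bijn"
    using bound[OF that] card by simp
qed

context
  fixes h :: "'a \<Rightarrow> nat bijn" and X :: "'a set" and R :: "'a word_expr set" and n u v :: nat
  assumes uv: "u \<in> {1..n}" "v \<in> {1..n}" "u \<noteq> v"
    and tri_in: "\<And>q. q \<in> {1..n} - {u, v} \<Longrightarrow> tri u v q \<in> gen (h ` X)"
    and words: "\<And>w. w \<in> R \<Longrightarrow> set_word_expr w \<subseteq> X"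
    and rels: "\<And>w. w \<in> R \<Longrightarrow> weval h w = 1"
begin

lemma gen_tri_subset: "gen (tri u v ` ({1..n} - {u, v})) \<subseteq> gen (h ` X)"
  by (intro gen_subset image_subsetI tri_in)

lemma card_gen_tri_fact: "2 * card (gen (tri u v ` ({1..n} - {u, v}))) = fact n"
proof -
  have "card ({1..n} - {u, v}) + 2 = n" using uv card_mono[of "{1..n}" "{u, v}"]
    by (auto simp: card_Diff_subset)
  from card_gen_tri[of "{1..n} - {u, v}" u v, unfolded this] show ?thesis using uv by simp
qed

text \<open>The 3-cycles alone generate \<open>fact n div 2\<close> elements, so the upper bound
  leaves nothing else in the group of the images.\<close>

lemma presentation_of_alt_group:
  assumes "finite (gen (h ` X)) \<and> 2 * card (gen (h ` X)) \<le> fact n"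
    and "\<And>k :: 'a \<Rightarrow> 'a letter list set bijn. (\<And>w. w \<in> R \<Longrightarrow> weval k w = 1) \<Longrightarrow>
      finite (gen (k ` X)) \<and> 2 * card (gen (k ` X)) \<le> fact n"
  shows "is_presentation_of X R (alt_group n)"
proof -
  have eq: "gen (tri u v ` ({1..n} - {u, v})) = gen (h ` X)"
    using assms(1) card_gen_tri_fact gen_tri_subset by (intro card_seteq) auto
  show ?thesis
  proof (rule presentation_of_bijns[OF alt_group_is_group alt_group_mult alt_group_one _ _ words rels])
    show "carrier (alt_group n) = flip ` gen (h ` X)"
      using gen_tri_alt_group[OF uv] eq by simp
    show "finite (gen (k ` X)) \<and> card (gen (k ` X)) \<le> card (gen (h ` X))"
      if "\<And>w. w \<in> R \<Longrightarrow> weval k w = 1" for k :: "'a \<Rightarrow> 'a letter list set bijn"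
      using assms(2)[OF that] card_gen_tri_fact eq by simp
  qed (use assms(1) in auto)
qed

text \<open>An odd element \<open>g\<close> adds a second coset of the group of 3-cycles, which
  makes \<open>fact n\<close> elements, hence all permutations.\<close>

lemma presentation_of_sym_group:
  assumes perm: "\<And>x. x \<in> X \<Longrightarrow> act (h x) permutes {1..n}"
    and odd: "g \<in> gen (h ` X)" "\<not> evenperm (act g)"
    and bound: "\<And>k :: 'a \<Rightarrow> 'a letter list set bijn. (\<And>w. w \<in> R \<Longrightarrow> weval k w = 1) \<Longrightarrow>
      finite (gen (k ` X)) \<and> card (gen (k ` X)) \<le> fact n"
  shows "is_presentation_of X R (sym_group n)"
proof -
  let ?K = "gen (tri u v ` ({1..n} - {u, v}))"
  have permutes: "act k permutes {1..n}" if "k \<in> gen (h ` X)" for k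
    using gen_permutes[of "h ` X" "{1..n}"] perm that by blast
  have sub: "flip ` gen (h ` X) \<subseteq> carrier (sym_group n)"
    using permutes by (auto simp: flip_def sym_group_carrier)
  have fin_sym: "finite (carrier (sym_group n))"
    using sym_group_card_carrier[of n] card.infinite[of "carrier (sym_group n)"] fact_gt_zero[of n] by fastforce
  have fin: "finite (gen (h ` X))"
    using finite_subset[OF sub fin_sym] by (rule finite_imageD) (rule inj_on_subset[OF inj_flip], simp)
  have even_K: "evenperm (act k)" if "k \<in> ?K" for k
    using that by (rule gen_evenperm[rotated 3, of _ _ "{1..n}"])
      (use uv in \<open>auto intro!: tri_permutes evenperm_tri\<close>)
  have "g * k \<notin> ?K" if "k \<in> ?K" for k
  proof
    assume "g * k \<in> ?K"
    moreover have "permutation (act g)" "permutation (act k)"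
      using permutes odd that gen_tri_subset by (auto simp: permutation_permutes)
    ultimately show False using even_K[OF that] even_K[of "g * k"] odd by (simp add: evenperm_comp)
  qed
  then have "card (?K \<union> (*) g ` ?K) = card ?K + card ((*) g ` ?K)"
    using finite_subset[OF gen_tri_subset fin] by (intro card_Un_disjoint) auto
  also have "card ((*) g ` ?K) = card ?K" by (intro card_image inj_onI) simp
  finally have "fact n = card (?K \<union> (*) g ` ?K)" using card_gen_tri_fact by simp
  also have "\<dots> \<le> card (gen (h ` X))"
    using gen_tri_subset odd by (intro card_mono fin) (auto intro: gen_times)
  finally have le: "fact n \<le> card (gen (h ` X))" .
  have card: "card (flip ` gen (h ` X)) = card (gen (h ` X))"
    by (intro card_image inj_on_subset[OF inj_flip]) simp
  have eq: "flip ` gen (h ` X) = carrier (sym_group n)"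
    using sub fin_sym le card by (intro card_seteq) (auto simp: sym_group_card_carrier)
  show ?thesis
  proof (rule presentation_of_bijns[OF sym_group_is_group sym_group_mult sym_group_one _ fin words rels])
    show "carrier (sym_group n) = flip ` gen (h ` X)" using eq by simp
    show "finite (gen (k ` X)) \<and> card (gen (k ` X)) \<le> card (gen (h ` X))"
      if "\<And>w. w \<in> R \<Longrightarrow> weval k w = 1" for k :: "'a \<Rightarrow> 'a letter list set bijn"
      using bound[OF that] le by simp
  qed auto
qed

end

section \<open>Cycles as bijections\<close>

lemma cycle_bijn:
  assumes P: "inj_on P {..<m}" and m: "m > 0"
  obtains g :: "nat bijn" where "\<And>j. j < m \<Longrightarrow> act g (P j) = P (Suc j mod m)"
    and "\<And>q. q \<notin> P ` {..<m} \<Longrightarrow> act g q = q" and "evenperm (act g) \<longleftrightarrow> odd m"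
proof -
  let ?cs = "map P [0..<m]"
  have cyc: "cycle ?cs" using P by (simp add: distinct_map atLeast0LessThan)
  have set: "set ?cs = P ` {..<m}" by (simp add: atLeast0LessThan)
  have perm: "cycle_of_list ?cs permutes set ?cs" by (rule cycle_permutes)
  define g where "g = Bijn (cycle_of_list ?cs)"
  have act: "act g = cycle_of_list ?cs" using permutes_bij[OF perm] by (simp add: g_def act_Bijn)
  have "act g (P j) = P (Suc j mod m)" if j: "j < m" for j
  proof -
    have "map (act g) ?cs ! j = rotate1 ?cs ! j" using cyclic_rotation[OF cyc, of 1] act by simp
    then show ?thesis using j by (simp add: nth_rotate1)
  qed
  moreover have "act g q = q" if "q \<notin> P ` {..<m}" for q
    using perm that set act by (auto simp: permutes_def)
  moreover have "swapidseq (m - 1) (act g)"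
    using swapidseq_ext_imp_swapidseq[OF swapidseq_ext_of_cycles[OF cyc]] act by simp
  then have "evenperm (act g) \<longleftrightarrow> odd m" using m by (simp add: evenperm_unique[OF _ refl])
  ultimately show ?thesis by (rule that)
qed

lemma cycle_power:
  assumes "\<And>j. j < m \<Longrightarrow> act g (P j) = P (Suc j mod m)" and "\<And>q. q \<notin> P ` {..<m} \<Longrightarrow> act g q = q"
  shows "g ^ m = 1"
proof (rule bijn_eqI)
  fix q
  show "act (g ^ m) q = act 1 q"
  proof (cases "q \<in> P ` {..<m}")
    case True
    then obtain j where j: "j < m" "q = P j" by blast
    have "act (g ^ k) q = P ((j + k) mod m)" for k
      using j assms(1) by (induction k) (auto simp: power_Suc2 mod_Suc_eq simp del: power_Suc)
    then show ?thesis using j by simp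
  next
    case False
    have "act (g ^ k) q = q" for k by (induction k) (simp_all add: assms(2)[OF False])
    then show ?thesis by simp
  qed
qed

section \<open>Permutations satisfying the relations\<close>

lemma power_times_commute:
  fixes g h :: "'g::monoid_mult"
  assumes "g * h = h * g"
  shows "(g * h) ^ k = g ^ k * h ^ k"
proof (induction k)
  case (Suc k)
  have "h ^ k * g = g * h ^ k" using power_commuting_commutes[of h g k] assms by simp
  then show ?case by (simp add: Suc mult.assoc power_Suc2 del: power_Suc)
    (simp flip: mult.assoc)
qed simp

lemma extend_bijn:
  assumes "f ` S \<subseteq> S" "inj_on f S" "finite S"
  obtains g :: "'b bijn" where "\<And>q. q \<in> S \<Longrightarrow> act g q = f q" "\<And>q. q \<notin> S \<Longrightarrow> act g q = q"
proof -
  have "f ` S = S" using assms by (simp add: endo_inj_surj)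
  then have "bij_betw (\<lambda>q. if q \<in> S then f q else q) (S \<union> - S) (S \<union> - S)"
    using assms(2) by (intro bij_betw_combine) (auto simp: bij_betw_def inj_on_def image_def)
  then have "act (Bijn (\<lambda>q. if q \<in> S then f q else q)) = (\<lambda>q. if q \<in> S then f q else q)"
    by (intro act_Bijn) simp
  then show ?thesis by (intro that[of "Bijn (\<lambda>q. if q \<in> S then f q else q)"]) auto
qed

lemma act_power_preserves: "act g q = q \<Longrightarrow> act (g ^ k) q = q"
  by (induction k) simp_all

context parameters
begin

text \<open>The points are the residues \<open>1, \<dots>, p\<close> with \<open>p\<close> in the role of \<open>0\<close>, the points
  \<open>\<infinity> = p + 1\<close> and \<open>\<infinity>' = p + 2\<close>, and the additional points up to \<open>n = f + L + 3\<close>.\<close>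

definition pt :: "nat \<Rightarrow> nat" where "pt k = (if k mod p = 0 then p else k mod p)"
definition n :: nat where "n = f + L + 3"
definition T :: "nat \<Rightarrow> nat bijn" where "T q = tri (p + 1) (p + 2) q"
definition Q :: "nat \<Rightarrow> nat" where "Q i = pt (r ^ i)"
definition w :: nat where "w = p - 1 - f"
text \<open>The order in which the long cycle runs: first the window, that is the powers of the root
  with exponents \<open>f\<close> to \<open>p - 2\<close>, then the additional points.\<close>

definition P :: "nat \<Rightarrow> nat" where "P j = (if j < w then Q (f + j) else p + 3 + (j - w))"

lemma pt_in: "pt k \<in> {1..p}"
  using p_ge by (auto simp: pt_def less_imp_le)

lemma pt_range: "pt k \<le> p" "0 < pt k"
  using pt_in[of k] by auto

lemma cong_pt: "[pt k = k] (mod p)"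
  by (simp add: pt_def cong_def)

lemma pt_eq_iff: "pt k = pt l \<longleftrightarrow> [k = l] (mod p)"
proof
  assume "pt k = pt l"
  then show "[k = l] (mod p)" using cong_pt by (metis cong_sym cong_trans)
qed (simp add: pt_def cong_def)

lemma pt_id: "q \<in> {1..p} \<Longrightarrow> pt q = q"
  by (cases "q = p") (auto simp: pt_def)

lemma pt_cong: "[k = l] (mod p) \<Longrightarrow> pt k = pt l"
  by (simp add: pt_eq_iff)

lemma Q_range: "0 < Q i" "Q i < p"
proof -
  have "coprime p r" using root by (simp add: residue_primroot_def)
  have "\<not> p dvd r ^ i"
  proof
    assume "p dvd r ^ i"
    then have "p dvd r" using prime_p prime_dvd_power by blast
    then have "p dvd 1" using coprime_common_divisor[OF \<open>coprime p r\<close>, of p] by simp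
    then show False using p_ge by simp
  qed
  then show "0 < Q i" "Q i < p" using p_ge by (auto simp: Q_def pt_def dvd_eq_mod_eq_0)
qed

lemma Q_neq [simp]: "Q i \<noteq> p" "p \<noteq> Q i" "Q i \<noteq> Suc p" "Q i \<noteq> Suc (Suc p)"
    "Suc p \<noteq> Q i" "Suc (Suc p) \<noteq> Q i"
  using Q_range(2)[of i] by auto

lemma Q_eq_iff: "Q i = Q j \<longleftrightarrow> [i = j] (mod (p - 1))"
  by (simp add: Q_def pt_eq_iff root_power_cong)

lemma Q_eq_iff': "i < p - 1 \<Longrightarrow> j < p - 1 \<Longrightarrow> Q i = Q j \<longleftrightarrow> i = j"
  by (simp add: Q_eq_iff cong_def)

lemma Q_last: "Q (Suc (p - 2)) = Q 0" "Q (p - Suc 0) = Q 0"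
proof -
  have "Suc (p - 2) = p - 1" using p_ge by simp
  then show "Q (Suc (p - 2)) = Q 0" "Q (p - Suc 0) = Q 0" by (simp_all add: Q_eq_iff cong_def)
qed

lemma Q_surj:
  assumes "q \<in> {1..<p}"
  shows "\<exists>i<p - 1. q = Q i"
proof -
  have "\<not> p dvd q" using assms by (auto dest: dvd_imp_le)
  then obtain i where "[r ^ i = q] (mod p)" using root_power_surj by blast
  then have "Q i = q" using assms pt_id[of q] by (simp add: Q_def flip: pt_eq_iff)
  moreover have "Q i = Q (i mod (p - 1))" by (simp add: Q_eq_iff cong_def)
  ultimately show ?thesis using p_ge by (intro exI[of _ "i mod (p - 1)"]) auto
qed

lemma w_pos: "0 < w" "w \<le> L" "L < 2 * w" "f + w = p - 1"
  using f L p_ge by (auto simp: w_def)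

lemma P_window: "j < w \<Longrightarrow> P j = Q (f + j)"
  by (simp add: P_def)

lemma inj_P: "inj_on P {..<L}"
proof (rule inj_onI)
  fix i j assume "i \<in> {..<L}" "j \<in> {..<L}" "P i = P j"
  then show "i = j"
    using w_pos Q_range(2)[of "f + i"] Q_range(2)[of "f + j"] Q_eq_iff'[of "f + i" "f + j"]
    by (auto simp: P_def split: if_splits)
qed

lemma P_eq_iff: "i < L \<Longrightarrow> j < L \<Longrightarrow> P i = P j \<longleftrightarrow> i = j"
  using inj_P by (auto simp: inj_on_def)

lemma P_in: "j < L \<Longrightarrow> P j \<in> {1..n} - {p, p + 1, p + 2}"
  using Q_range[of "f + j"] w_pos by (auto simp: P_def n_def)

lemma P_neq: "j < L \<Longrightarrow> P j \<noteq> p" "j < L \<Longrightarrow> P j \<noteq> p + 1" "j < L \<Longrightarrow> P j \<noteq> p + 2"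
  using P_in by auto

lemma P_surj:
  assumes "q \<in> {p + 3..n}"
  shows "\<exists>j<L. q = P j"
  using assms w_pos by (intro exI[of _ "q - (p + 3) + w"]) (auto simp: P_def n_def)

lemma dbl_T:
  assumes "q \<notin> {p + 1, p + 2}" "q' \<notin> {p + 1, p + 2}" "q \<noteq> q'"
  shows "T q * inverse (T q') * T q = sw (p + 1) (p + 2) * sw q q'"
  using dbl_tri[of "p + 1" "p + 2" q q'] assms unfolding dbl_def T_def by simp

lemma T_rels:
  assumes "q \<noteq> p + 1" "q \<noteq> p + 2"
  shows "T q ^ 3 = 1" "inverse (T q) = tri (p + 2) (p + 1) q"
    "act (T q) t = (if t = p + 1 then p + 2 else if t = p + 2 then q else if t = q then p + 1 else t)"
  using assms by (auto simp: T_def tri_cube inverse_tri act_tri)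

end

section \<open>The permutations and their relations\<close>

locale witness = parameters +
  fixes A B C :: "nat bijn"
  assumes A: "q \<in> {1..p} \<Longrightarrow> act A q = pt (q + 1)" "q \<notin> {1..p} \<Longrightarrow> act A q = q"
    and B: "q \<in> {1..p} \<Longrightarrow> act B q = pt (r * q)" "act B (p + 1) = p + 2" "act B (p + 2) = p + 1"
      "q \<notin> {1..p + 2} \<Longrightarrow> act B q = q"
    and C: "j < L \<Longrightarrow> act C (P j) = P (Suc j mod L)" "q \<notin> P ` {..<L} \<Longrightarrow> act C q = q"
begin

lemma A_power:
  shows "q \<in> {1..p} \<Longrightarrow> act (A ^ k) q = pt (q + k)" and "q \<notin> {1..p} \<Longrightarrow> act (A ^ k) q = q"
proof -
  assume q: "q \<in> {1..p}"
  show "act (A ^ k) q = pt (q + k)"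
  proof (induction k)
    case 0
    then show ?case using q by (simp add: pt_id)
  next
    case (Suc k)
    have "act (A ^ Suc k) q = pt (pt (q + k) + 1)"
      using pt_in[of "q + k"] by (simp add: power_Suc2 Suc A del: power_Suc)
    also have "\<dots> = pt (q + Suc k)"
      using cong_add[OF cong_pt[of "q + k"] cong_refl[of 1]] by (intro pt_cong) (simp add: add.assoc)
    finally show ?case .
  qed
qed (simp add: A(2) act_power_preserves)

lemma A_power_p: "A ^ p = 1"
proof (rule bijn_eqI)
  fix q
  show "act (A ^ p) q = act 1 q"
    using A_power[of q p] pt_id[of q] pt_eq_iff[of "q + p" q] by (cases "q \<in> {1..p}") (auto simp: cong_def)
qed

lemma B_Q: "act B (Q i) = Q (Suc i)"
proof -
  have "act B (Q i) = pt (r * Q i)" using Q_range[of i] by (intro B) auto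
  also have "\<dots> = Q (Suc i)" unfolding Q_def by (intro pt_cong) (simp add: cong_mult cong_pt)
  finally show ?thesis .
qed

lemma B_p: "act B p = p"
proof -
  have "act B p = pt (r * p)" using p_ge by (intro B) auto
  then show ?thesis by (simp add: pt_def)
qed

lemma R2_bijn: "cj (A ^ s) B = A ^ (s - 1)"
proof -
  have "A ^ s * B = B * A ^ (s - 1)"
  proof (rule bijn_eqI)
    fix q
    show "act (A ^ s * B) q = act (B * A ^ (s - 1)) q"
    proof (cases "q \<in> {1..p}")
      case True
      have "[r * pt (q + s) = r * (q + s)] (mod p)" by (intro cong_mult cong_pt cong_refl)
      moreover have "[pt (r * q) + (s - 1) = r * q + r * s] (mod p)" by (intro cong_add cong_pt s_pred)
      ultimately have "[r * pt (q + s) = pt (r * q) + (s - 1)] (mod p)"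
        unfolding distrib_left by (metis cong_sym cong_trans)
      then show ?thesis using True pt_in by (simp add: A_power B pt_cong)
    next
      case False
      then have "act B q \<notin> {1..p}" using B by (cases "q \<in> {p + 1, p + 2}") auto
      then show ?thesis using False by (simp add: A_power)
    qed
  qed
  then show ?thesis by (simp add: cj_def mult.assoc)
qed

lemma cj_T_A: "cj (T q) (A ^ k) = T (act (A ^ k) q)"
  by (simp add: T_def cj_tri A_power)

lemma cj_T_B: "q \<noteq> p + 1 \<Longrightarrow> q \<noteq> p + 2 \<Longrightarrow> cj (T q) B = inverse (T (act B q))"
  using B(2,3) act_inject_iff[of B q "p + 2"] act_inject_iff[of B q "p + 1"] inverse_tri[of "p + 1" "p + 2" "act B q"]
  by (auto simp: T_def cj_tri)

lemma C_fix: "act C p = p" "act C (p + 1) = p + 1" "act C (p + 2) = p + 2"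
proof -
  have "act C q = q" if q: "q \<in> {p, p + 1, p + 2}" for q
  proof (rule C(2), rule notI)
    assume "q \<in> P ` {..<L}"
    then obtain j where "j < L" "q = P j" by blast
    then show False using P_in[of j] q by blast
  qed
  then show "act C p = p" "act C (p + 1) = p + 1" "act C (p + 2) = p + 2" by blast+
qed

lemma cj_T_C: "cj (T q) C = T (act C q)"
  using C_fix by (simp add: T_def cj_tri)

lemma C_power_L: "C ^ L = 1"
  using C by (rule cycle_power)

lemma C_window: "Suc j < w \<Longrightarrow> act C (Q (f + j)) = Q (Suc (f + j))"
  using C(1)[of j] w_pos by (simp add: P_window)

lemma C_below: "i < f \<Longrightarrow> act C (Q i) = Q i"
proof (rule C(2), safe)
  fix j assume "i < f" "j < L" "Q i = P j"
  then show False
    using w_pos Q_eq_iff'[of i "f + j"] Q_range(2)[of i] by (auto simp: P_def split: if_splits)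
qed

text \<open>As in the Chinese remainder theorem, \<open>e3\<close> inverts \<open>L\<close> modulo 3
  and \<open>eL\<close> inverts 3 modulo \<open>L\<close>, so that the powers \<open>Z ^ L\<close>
  and \<open>Z ^ 3\<close> separate the two commuting factors.\<close>

definition e3 :: nat where "e3 = (SOME i. [L * i = 1] (mod 3))"
definition eL :: nat where "eL = (SOME i. [3 * i = 1] (mod L))"
definition Z :: "nat bijn" where "Z = T p ^ e3 * C ^ eL"

lemma Z_powers: "Z ^ L = T p" "Z ^ 3 = C"
proof -
  have "coprime 3 L" using L(3) by (simp add: prime_imp_coprime)
  then have e3: "[L * e3 = 1] (mod 3)" and eL: "[3 * eL = 1] (mod L)"
    unfolding e3_def eL_def by (metis cong_solve_coprime_nat coprime_commute someI_ex One_nat_def)+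
  have "cj (T p) C = T p" using cj_T_C[of p] C_fix by simp
  then have "T p * C = C * T p" by (metis cj_swap)
  then have "C ^ k * T p = T p * C ^ k" for k by (rule power_commuting_commutes[OF sym])
  then have comm: "T p ^ e3 * C ^ eL = C ^ eL * T p ^ e3" by (rule power_commuting_commutes[OF sym])
  have pow: "Z ^ k = T p ^ (k * e3) * C ^ (k * eL)" for k
    unfolding Z_def power_times_commute[OF comm] power_mult[symmetric] by (simp only: mult.commute)
  have T3: "T p ^ 3 = 1" by (simp add: T_rels)
  show "Z ^ L = T p"
    unfolding pow using power_cong_nat[OF T3 e3] by (simp add: power_mult C_power_L)
  show "Z ^ 3 = C"
    unfolding pow using power_cong_nat[OF C_power_L eL] by (simp add: power_mult T3)
qed

lemma wY_bijn: "wY L A Z = T (Q 0)"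
proof -
  have "[p + 1 = 0 + 1] (mod p)" by (intro cong_add) (simp_all add: cong_0_iff)
  then have "act A p = Q 0" using p_ge A(1)[of p] by (simp add: Q_def pt_cong)
  then show ?thesis using cj_T_A[of p 1] by (simp add: wY_def Z_powers)
qed

lemma wV_bijn: "wV L A B Z = inverse (T (Q (p - 2)))"
proof -
  have "cj (inverse (T (Q (p - 2)))) B = T (Q 0)"
    by (simp add: cj_inverse cj_T_B B_Q Q_last)
  from cj_inverse_eqI[OF this] show ?thesis by (simp add: wV_def wY_bijn cj_def)
qed

lemma wD_bijn: "cj (wD L A B Z) (B ^ k) = sw (p + 1) (p + 2) * sw (Q k) (Q (Suc k))"
proof (induction k)
  case 0
  have "Q 0 \<noteq> Q (Suc 0)" using p_ge by (simp add: Q_eq_iff cong_def)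
  then show ?case
    using dbl_T[of "Q 0" "Q (Suc 0)"] by (simp add: wD_def wY_bijn cj_T_B B_Q)
next
  case (Suc k)
  have "cj (wD L A B Z) (B ^ Suc k) = cj (cj (wD L A B Z) (B ^ k)) B"
    by (simp add: cj_cj power_Suc2 del: power_Suc)
  then show ?case using B(2,3) by (simp add: Suc cj_times cj_sw B_Q sw_commute)
qed

text \<open>Of \<infinity> and \<infinity>' only the pair is tracked: whether they are exchanged
  depends on the parity of \<open>k\<close>, but \<open>wE\<close> exchanges them, and its conjugate
  does so in either case.\<close>

lemma wB_bijn:
  assumes "k + 2 \<le> p"
  shows "act (wB k L A B Z) p = p \<and> act (wB k L A B Z) ` {p + 1, p + 2} = {p + 1, p + 2} \<and>
    (\<forall>i < p - 1. act (wB k L A B Z) (Q i) = Q (shift k i))"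
  using assms
proof (induction k)
  case 0
  have "act B (Q i) = Q (shift 0 i)" if "i < p - 1" for i
  proof (cases "i < p - 2")
    case False
    then have "i = p - 2" using that by simp
    then show ?thesis using B_Q[of i] by (simp add: shift_def Q_last del: B_Q)
  qed (simp add: B_Q shift_def)
  then show ?case using B(2,3) B_p by (auto simp: wB_def)
next
  case (Suc k)
  let ?D = "sw (p + 1) (p + 2) * sw (Q k) (Q (Suc k))"
  have k: "Suc k < p - 1" using Suc.prems by simp
  have IH: "act (wB k L A B Z) p = p" "act (wB k L A B Z) ` {p + 1, p + 2} = {p + 1, p + 2}"
    "\<And>i. i < p - 1 \<Longrightarrow> act (wB k L A B Z) (Q i) = Q (shift k i)"
    using Suc by auto
  have W: "act (wB (Suc k) L A B Z) q = act ?D (act (wB k L A B Z) q)" for q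
    by (simp only: wB_Suc wD_bijn act_times comp_apply)
  have "act ?D (Q (shift k i)) = Q (shift (Suc k) i)" if "i < p - 1" for i
  proof -
    have "shift k i < p - 1" using that k by (auto simp: shift_def)
    moreover have "shift (Suc k) i = (if shift k i = k then Suc k else if shift k i = Suc k then k else shift k i)"
      using that k by (auto simp: shift_def split: if_splits)
    ultimately show ?thesis using k Q_eq_iff'[of "shift k i" k] Q_eq_iff'[of "shift k i" "Suc k"]
      by (auto simp: transpose_def)
  qed
  then have Q: "act (wB (Suc k) L A B Z) (Q i) = Q (shift (Suc k) i)" if "i < p - 1" for i
    using that by (simp only: W IH)
  have D: "act ?D p = p" "act ?D (p + 1) = p + 2" "act ?D (p + 2) = p + 1"
    by (simp_all add: transpose_def)
  have "act (wB (Suc k) L A B Z) ` {p + 1, p + 2} = act ?D ` act (wB k L A B Z) ` {p + 1, p + 2}"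
    unfolding image_image by (intro image_cong refl W)
  also have "act (wB k L A B Z) ` {p + 1, p + 2} = {p + 1, p + 2}" by (rule IH(2))
  also have "act ?D ` {p + 1, p + 2} = {p + 1, p + 2}" unfolding image_insert image_empty D by blast
  finally show ?case using Q IH(1) D(1) by (simp only: W) blast
qed

lemma wE_bijn:
  defines "S \<equiv> {1..p} - {Q (p - 2)}"
  shows "q \<in> S \<Longrightarrow> act (wE L A B Z) q \<in> S"
    and "act (wE L A B Z) (p + 1) = p + 2" "act (wE L A B Z) (p + 2) = p + 1"
    and "q \<notin> S \<union> {p + 1, p + 2} \<Longrightarrow> act (wE L A B Z) q = q"
proof -
  let ?E = "wE L A B Z" and ?d = "sw (p + 1) (p + 2) * sw p (Q (p - 2))"
  have E: "?E = ?d * B * ?d"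
    unfolding wE_def Z_powers wV_bijn by (subst (1 2) dbl_T) auto
  have d: "act ?d t = (if t = p then Q (p - 2) else if t = Q (p - 2) then p
      else if t = p + 1 then p + 2 else if t = p + 2 then p + 1 else t)" for t
    by (auto simp: transpose_def)
  have E_act: "act ?E t = act ?d (act B (act ?d t))" for t by (simp only: E act_times comp_apply)
  show "act ?E (p + 1) = p + 2" "act ?E (p + 2) = p + 1"
    unfolding E_act d using B(2,3) by auto
  have fix_Q: "act ?E (Q (p - 2)) = Q (p - 2)"
    unfolding E_act d using B_p by auto
  have Q2: "Q (p - 2) \<in> {1..p}" using Q_range[of "p - 2"] by auto
  show "act ?E q = q" if "q \<notin> S \<union> {p + 1, p + 2}"
  proof (cases "q = Q (p - 2)")
    case False
    then have "q \<notin> {1..p}" "q \<noteq> p + 1" "q \<noteq> p + 2" using that by (auto simp: S_def)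
    moreover from this have "act B q = q" by (intro B) auto
    moreover have "q \<noteq> p" using \<open>q \<notin> {1..p}\<close> p_ge by auto
    ultimately show ?thesis unfolding E_act d using False by simp
  qed (simp add: fix_Q)
  show "act ?E q \<in> S" if q: "q \<in> S"
  proof -
    have "act ?d t \<in> {1..p}" if "t \<in> {1..p}" for t unfolding d using that Q2 p_ge by auto
    moreover have "act B t \<in> {1..p}" if "t \<in> {1..p}" for t using B(1)[OF that] pt_in by simp
    ultimately have "act ?E q \<in> {1..p}" unfolding E_act using q unfolding S_def by blast
    moreover have "act ?E q \<noteq> Q (p - 2)"
      using fix_Q act_inject_iff[of ?E q "Q (p - 2)"] q by (auto simp: S_def)
    ultimately show ?thesis by (simp add: S_def)
  qed
qed

text \<open>\<open>C\<close> and \<open>wB f\<close> agree on the points moved by \<open>wE\<close> other than \<open>\<infinity>\<close> and \<open>\<infinity>'\<close>.\<close>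

lemma R5_bijn: "cj (wE L A B Z) (wB f L A B Z) = cj (wE L A B Z) C"
proof (rule bijn_eqI)
  fix t
  let ?E = "wE L A B Z" and ?B = "wB f L A B Z"
  let ?S = "{1..p} - {Q (p - 2)}"
  have B_f: "act ?B p = p" "act ?B ` {p + 1, p + 2} = {p + 1, p + 2}"
    "\<And>i. i < p - 1 \<Longrightarrow> act ?B (Q i) = Q (shift f i)"
    using wB_bijn[of f] f by auto
  have agree: "act ?B q = act C q" if "q \<in> ?S" for q
  proof (cases "q = p")
    case False
    then have "q \<in> {1..<p}" using that by auto
    then obtain i where i: "i < p - 1" "q = Q i" using Q_surj by blast
    then have i2: "i < p - 2" using that by (cases "i = p - 2") auto
    show ?thesis
    proof (cases "i < f")
      case True
      then show ?thesis using i B_f C_below by (simp add: shift_def)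
    next
      case False
      then have "Suc (i - f) < w" using i2 w_pos by simp
      from C_window[OF this] show ?thesis using i i2 False B_f by (simp add: shift_def)
    qed
  qed (simp add: B_f C_fix)
  obtain q where t: "t = act ?B q" using act_inverse_act(2)[of ?B t] by metis
  have "act (cj ?E C) (act ?B q) = act ?B (act ?E q)"
  proof (cases "q \<in> ?S")
    case True
    then show ?thesis using wE_bijn(1)[OF True] agree by (simp add: act_cj)
  next
    case out: False
    have CE: "act (cj ?E C) (p + 1) = p + 2" "act (cj ?E C) (p + 2) = p + 1"
      using act_cj[of ?E C "p + 1"] act_cj[of ?E C "p + 2"] C_fix wE_bijn(2,3) by simp_all
    show ?thesis
    proof (cases "q \<in> {p + 1, p + 2}")
      case True
      have "(act ?B (p + 1) = p + 1 \<and> act ?B (p + 2) = p + 2) \<or>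
          (act ?B (p + 1) = p + 2 \<and> act ?B (p + 2) = p + 1)"
        using B_f(2) by (auto simp: doubleton_eq_iff)
      then show ?thesis using True CE wE_bijn(2,3) by auto
    next
      case False
      \<comment> \<open>\<open>?B\<close> and \<open>C\<close> agree on \<open>?S\<close> and both
        preserve the pair of points at infinity; so the point \<open>q'\<close> lies outside these
        sets, like \<open>q\<close>, and \<open>?E\<close> fixes both.\<close>
      obtain q' where q': "act ?B q = act C q'" using act_inverse_act(2)[of C "act ?B q"] by metis
      have "q' \<notin> ?S"
      proof
        assume "q' \<in> ?S"
        then have "act ?B q = act ?B q'" using q' agree by simp
        then show False using \<open>q' \<in> ?S\<close> out by simp
      qed
      moreover have "q' \<notin> {p + 1, p + 2}"
      proof
        assume "q' \<in> {p + 1, p + 2}"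
        then have "act ?B q \<in> act ?B ` {p + 1, p + 2}" using q' C_fix B_f(2) by auto
        then show False using False by auto
      qed
      ultimately have "act ?E q' = q'" by (intro wE_bijn(4)) auto
      moreover have "act ?E q = q" using out False by (intro wE_bijn(4)) auto
      ultimately show ?thesis using q' by (simp add: act_cj)
    qed
  qed
  then show "act (cj ?E ?B) t = act (cj ?E C) t" by (simp add: t act_cj)
qed

lemma R6_bijn: "(B * wY L A Z) ^ p = B ^ (p - 1)"
proof -
  have B_pow: "B ^ (p - 1) = 1"
  proof (rule bijn_eqI)
    fix q
    have Q: "act (B ^ k) (Q i) = Q (i + k)" for k i
      by (induction k) (simp_all add: B_Q power_Suc2 del: power_Suc)
    have inf: "act (B ^ k) (p + 1) = (if even k then p + 1 else p + 2)"
      "act (B ^ k) (p + 2) = (if even k then p + 2 else p + 1)" for k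
      using B(2,3) by (induction k) (simp_all add: power_Suc2 del: power_Suc)
    consider "q = p" | "q \<in> {1..<p}" | "q = p + 1" | "q = p + 2" | "q \<notin> {1..p + 2}"
      by fastforce
    then show "act (B ^ (p - 1)) q = act 1 q"
    proof cases
      case 2
      then obtain i where "q = Q i" using Q_surj by blast
      then show ?thesis using Q[of "p - 1" i] by (simp add: Q_eq_iff cong_def)
    qed (use odd_p B_p B(4)[of q] act_power_preserves[of B] inf[of "p - 1"] in auto)
  qed
  have "(B * T (Q 0)) ^ p = 1"
  \<comment> \<open>The cycle is \<open>Q 0\<close>, ..., \<open>Q (p - 2)\<close>, \<infinity>. The
    point \<infinity>' is fixed, since \<open>B\<close> takes it to \<infinity> and the 3-cycle
    takes it back.\<close>
  proof (rule cycle_power[where P = "\<lambda>j. if j < p - 1 then Q j else p + 1"])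
    fix j assume j: "j < p"
    consider "Suc j < p - 1" | "j = p - 2" | "j = p - 1" using j by linarith
    then show "act (B * T (Q 0)) (if j < p - 1 then Q j else p + 1) =
      (if Suc j mod p < p - 1 then Q (Suc j mod p) else p + 1)"
    proof cases
      case 1
      then have "Q (Suc j) \<noteq> Q 0" using Q_eq_iff'[of "Suc j" 0] by simp
      then show ?thesis using 1 by (simp add: B_Q T_rels)
    next
      case 2
      then have "Suc j = p - 1" "j < p - 1" using p_ge by auto
      then show ?thesis using 2 p_ge by (simp add: B_Q T_rels Q_last)
    next
      case 3
      then have "Suc j mod p = 0" using p_ge by simp
      then show ?thesis using 3 p_ge B(2) by (simp add: T_rels)
    qed
  next
    fix q assume q: "q \<notin> (\<lambda>j. if j < p - 1 then Q j else p + 1) ` {..<p}"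
    have "q \<noteq> Q j" if "j < p - 1" for j using q that by (auto simp: image_iff Bex_def split: if_splits)
    then have "q \<notin> {1..<p}" using Q_surj by blast
    moreover have "q \<noteq> p + 1" using q p_ge by (auto simp: image_iff Bex_def dest: spec[of _ "p - 1"])
    ultimately consider "q = p" | "q = p + 2" | "q \<notin> {1..p + 2}" by fastforce
    then show "act (B * T (Q 0)) q = q"
      by cases (use B_p B(3) B(4)[of q] Q_range[of 0] in \<open>auto simp: T_rels\<close>)
  qed
  then show ?thesis using B_pow by (simp add: wY_bijn)
qed

lemma R7_bijn: "(C * wV L A B Z) ^ (L + 2) = 1"
proof -
  have m: "Q (p - 2) = P (w - 1)" using w_pos by (simp add: P_window numeral_2_eq_2)
  have V: "act (wV L A B Z) t = (if t = p + 1 then P (w - 1) else if t = p + 2 then p + 1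
      else if t = P (w - 1) then p + 2 else t)" for t
    using P_neq[of "w - 1"] w_pos by (simp add: wV_bijn T_rels m act_tri)
  \<comment> \<open>The product follows \<open>C\<close> from \<open>P (w - 1)\<close> once around,
    and instead of returning there directly it passes through \<infinity>' and \<infinity>.\<close>
  define P' where "P' j = (if j < L then P ((w - 1 + j) mod L) else if j = L then p + 2 else p + 1)" for j
  have CV: "act (C * wV L A B Z) t = act (wV L A B Z) (act C t)" for t by simp
  have CP: "act C (P ((w - 1 + j) mod L)) = P ((w - 1 + Suc j) mod L)" for j
    using C(1)[of "(w - 1 + j) mod L"] w_pos by (simp add: mod_Suc_eq)
  show ?thesis
  proof (rule cycle_power[where P = P'])
    fix j assume "j < L + 2"
    then consider "Suc j < L" | "Suc j = L" | "j = L" | "j = Suc L" by linarith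
    then show "act (C * wV L A B Z) (P' j) = P' (Suc j mod (L + 2))"
    proof cases
      case 1
      have "(w - 1 + Suc j) mod L \<noteq> w - 1"
      proof
        assume "(w - 1 + Suc j) mod L = w - 1"
        then have "[w - 1 + Suc j = w - 1 + 0] (mod L)" using w_pos by (simp add: cong_def)
        then have "[Suc j = 0] (mod L)" by (rule cong_add_lcancel_nat[THEN iffD1])
        then show False using 1 by (simp add: cong_def)
      qed
      then have "P ((w - 1 + Suc j) mod L) \<noteq> P (w - 1)" using 1 w_pos by (simp add: P_eq_iff)
      then show ?thesis using 1 CP[of j] P_neq[of "(w - 1 + Suc j) mod L"] unfolding CV V
        by (simp add: P'_def)
    next
      case 2
      note CP[of j]
      also have "(w - 1 + Suc j) mod L = w - 1"
        unfolding 2 using w_pos by (subst mod_add_self2) simp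
      finally show ?thesis using 2 P_neq[of "w - 1"] w_pos unfolding CV V by (simp add: P'_def)
    next
      case 3
      then show ?thesis using C_fix unfolding CV V by (simp add: P'_def)
    next
      case 4
      then show ?thesis using C_fix w_pos unfolding CV V by (simp add: P'_def)
    qed
  next
    fix q assume q: "q \<notin> P' ` {..<L + 2}"
    have "q \<noteq> P' L" "q \<noteq> P' (Suc L)" using q by auto
    then have "q \<noteq> p + 1" "q \<noteq> p + 2" by (auto simp: P'_def)
    moreover have "q \<noteq> P i" if i: "i < L" for i
    proof -
      define k where "k = (i + (L - (w - 1))) mod L"
      have "k < L" using i by (simp add: k_def)
      have "(w - 1 + k) mod L = (w - 1 + (i + (L - (w - 1)))) mod L"
        by (simp only: k_def mod_add_right_eq)
      also have "w - 1 + (i + (L - (w - 1))) = i + L" using w_pos by linarith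
      also have "(i + L) mod L = i" using i by simp
      finally have "P' k = P i" using \<open>k < L\<close> by (simp add: P'_def)
      moreover have "P' k \<in> P' ` {..<L + 2}" using \<open>k < L\<close> by simp
      ultimately show ?thesis using q by auto
    qed
    moreover from this have "act C q = q" by (intro C(2)) auto
    ultimately show "act (C * wV L A B Z) q = q" using w_pos unfolding CV V by simp
  qed
qed

lemma relations_bijn: "relations p s f L A B Z"
proof -
  have "A ^ p = Z ^ (3 * L)" by (simp add: A_power_p power_mult Z_powers C_power_L)
  moreover have "cj (T p) B = inverse (T p)" by (simp add: cj_T_B B_p)
  moreover have "(T p * T (Q 0)) ^ 2 = 1" unfolding T_def by (rule tri_tri) auto
  ultimately show ?thesis
    unfolding relations_def using R2_bijn R5_bijn R6_bijn R7_bijn by (simp add: Z_powers wY_bijn)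
qed

text \<open>Powers of \<open>A\<close> carry \<open>T p\<close> to all points up to
  \<open>p\<close>; \<open>C\<close> then carries it from the window to the additional
  points.\<close>

lemma tri_in_gen:
  assumes "q \<in> {1..n} - {p + 1, p + 2}"
  shows "tri (p + 1) (p + 2) q \<in> gen {A, B, Z}"
proof -
  have C_in: "C ^ k \<in> gen {A, B, Z}" for k
    using Z_powers gen_power gen_base by (metis insertI1 insertI2)
  have A_in: "A ^ k \<in> gen {A, B, Z}" for k using gen_power gen_base by (metis insertI1)
  have cj_in: "cj g h \<in> gen {A, B, Z}" if "g \<in> gen {A, B, Z}" "h \<in> gen {A, B, Z}" for g h
    using that by (simp add: cj_def gen_times)
  have Tp: "T p \<in> gen {A, B, Z}" using Z_powers gen_power gen_base by (metis insertI1 insertI2)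
  have small: "T q \<in> gen {A, B, Z}" if "q \<in> {1..p}" for q
  proof -
    have "act (A ^ q) p = q" using that p_ge pt_id[OF that] A_power(1)[of p q] pt_eq_iff[of "p + q" q]
      by (simp add: cong_def)
    then show ?thesis using cj_in[OF Tp A_in, of q] cj_T_A[of p q] by simp
  qed
  have "T (P j) \<in> gen {A, B, Z}" if "j < L" for j
    using that
  proof (induction j)
    case 0
    have "P 0 \<in> {1..p}" using w_pos Q_range[of f] by (simp add: P_window)
    then show ?case by (rule small)
  next
    case (Suc j)
    then have "cj (T (P j)) C \<in> gen {A, B, Z}" using cj_in C_in[of 1] by simp
    then show ?case using Suc.prems by (simp add: cj_T_C C(1))
  qed
  then have "T q \<in> gen {A, B, Z}" using small P_surj[of q] assms by (cases "q \<le> p") auto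
  then show ?thesis by (simp add: T_def)
qed

lemma permutes_bijn: "g \<in> {A, B, Z} \<Longrightarrow> act g permutes {1..n}"
proof -
  have np: "p + 2 \<le> n" using w_pos f by (simp add: n_def w_def)
  have "act A q = q" if "q \<notin> {1..n}" for q using that np by (intro A) auto
  moreover have "act B q = q" if "q \<notin> {1..n}" for q using that np by (intro B) auto
  moreover have "act C q = q" if "q \<notin> {1..n}" for q using that P_in by (intro C) blast
  ultimately have *: "act A permutes {1..n}" "act B permutes {1..n}" "act C permutes {1..n}"
    by (auto simp: permutes_def bij_def[symmetric] bij_iff[symmetric])
  have "T p \<in> gen {T p, C}" "C \<in> gen {T p, C}" by (auto intro: gen_base)
  then have "Z \<in> gen {T p, C}" by (simp add: Z_def gen_times gen_power)
  moreover have "act g permutes {1..n}" if "g \<in> {T p, C}" for g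
    using that * np p_ge by (auto simp: T_def intro!: tri_permutes)
  ultimately have "act Z permutes {1..n}" by (rule gen_permutes[rotated])
  then show "g \<in> {A, B, Z} \<Longrightarrow> act g permutes {1..n}" using * by auto
qed

end

context parameters
begin

lemma bijn_exist:
  obtains A B Z :: "nat bijn" where "relations p s f L A B Z"
    and "\<And>q. q \<in> {1..n} - {p + 1, p + 2} \<Longrightarrow> tri (p + 1) (p + 2) q \<in> gen {A, B, Z}"
    and "\<And>g. g \<in> {A, B, Z} \<Longrightarrow> act g permutes {1..n}"
    and "evenperm (act (Z ^ 3)) \<longleftrightarrow> odd L"
proof -
  have "inj_on (\<lambda>q. pt (q + 1)) {1..p}"
    by (rule inj_onI) (metis add.commute cong_add_lcancel_nat pt_eq_iff pt_id)
  then obtain A :: "nat bijn" where A: "\<And>q. q \<in> {1..p} \<Longrightarrow> act A q = pt (q + 1)"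
    "\<And>q. q \<notin> {1..p} \<Longrightarrow> act A q = q"
    using pt_in extend_bijn[of "\<lambda>q. pt (q + 1)" "{1..p}"] by (metis finite_atLeastAtMost image_subsetI)
  have "coprime r p" using root by (simp add: residue_primroot_def coprime_commute)
  then have "inj_on (\<lambda>q. pt (r * q)) {1..p}"
    by (intro inj_onI) (metis cong_mult_lcancel_nat pt_eq_iff pt_id)
  then obtain B' :: "nat bijn" where B': "\<And>q. q \<in> {1..p} \<Longrightarrow> act B' q = pt (r * q)"
    "\<And>q. q \<notin> {1..p} \<Longrightarrow> act B' q = q"
    using pt_in extend_bijn[of "\<lambda>q. pt (r * q)" "{1..p}"] by (metis finite_atLeastAtMost image_subsetI)
  define B where "B = B' * sw (p + 1) (p + 2)"
  have B: "act B q = pt (r * q)" if "q \<in> {1..p}" for q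
    using that pt_range[of "r * q"] by (auto simp: B_def B' transpose_def)
  have B2: "act B (p + 1) = p + 2" "act B (p + 2) = p + 1" "\<And>q. q \<notin> {1..p + 2} \<Longrightarrow> act B q = q"
    by (auto simp: B_def B' transpose_def)
  have "L > 0" using w_pos by simp
  then obtain C0 :: "nat bijn" where C0: "\<And>j. j < L \<Longrightarrow> act C0 (P j) = P (Suc j mod L)"
    "\<And>q. q \<notin> P ` {..<L} \<Longrightarrow> act C0 q = q" "evenperm (act C0) \<longleftrightarrow> odd L"
    by (rule cycle_bijn[OF inj_P]) (rule that)
  interpret witness p r s f L A B C0
    by unfold_locales (use A B B2 C0 in auto)
  show ?thesis
    by (rule that[of A B Z]) (use relations_bijn tri_in_gen permutes_bijn C0(3) Z_powers in auto)
qed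

end

section \<open>Primes in short intervals\<close>

lemma prod_primes_dvd:
  fixes k :: nat
  assumes "finite A" and "\<And>q. q \<in> A \<Longrightarrow> prime q \<and> q dvd k"
  shows "\<Prod>A dvd k"
  using assms
proof (induction A)
  case (insert a A)
  have "coprime a (\<Prod>A)"
    using insert by (intro prod_coprime_right) (auto intro!: primes_coprime)
  then show ?case using insert by (simp add: divides_mult)
qed simp

lemma choose_odd_middle_le: "(2 * m + 1) choose m \<le> 4 ^ m"
proof -
  have "2 * ((2 * m + 1) choose m) = (\<Sum>k\<in>{m, m + 1}. (2 * m + 1) choose k)"
    using binomial_symmetric[of m "2 * m + 1"] by simp
  also have "\<dots> \<le> (\<Sum>k\<le>2 * m + 1. (2 * m + 1) choose k)" by (intro sum_mono2) auto
  also have "\<dots> = 2 * 4 ^ m" by (simp only: choose_row_sum) (simp add: power_mult)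
  finally show ?thesis by simp
qed

text \<open>An even \<open>n > 2\<close> contributes no prime. For \<open>n = 2 * m + 1\<close> the
  primes above \<open>m + 1\<close> divide \<open>(2 * m + 1) choose m\<close>, which is at most
  \<open>4 ^ m\<close>.\<close>

lemma primorial_le: "\<Prod>{q. prime q \<and> q \<le> n} \<le> (4 :: nat) ^ n"
proof (induction n rule: less_induct)
  case (less n)
  have fin: "finite {q. prime q \<and> q \<le> k}" for k :: nat by simp
  consider "n \<le> 2" | "n > 2" "even n" | m where "n = 2 * m + 1" "m > 0"
    by (metis One_nat_def add_cancel_left_left gr0I less_numeral_extra(4) mult_0_right not_le oddE one_le_numeral)
  then show ?case
  proof cases
    case 1
    have "{q::nat. prime q \<and> q \<le> n} = (if n = 2 then {2} else {})"
      using 1 by (auto dest: prime_ge_2_nat)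
    then show ?thesis by simp
  next
    case 2
    then have "{q. prime q \<and> q \<le> n} = {q. prime q \<and> q \<le> n - 1}"
      using prime_odd_nat[of n] by (auto simp: le_less)
    then have "\<Prod>{q. prime q \<and> q \<le> n} \<le> 4 ^ (n - 1)" using less[of "n - 1"] 2 by simp
    also have "\<dots> \<le> (4 :: nat) ^ n" by (intro power_increasing) auto
    finally show ?thesis .
  next
    case 3
    let ?A = "{q. prime q \<and> m + 1 < q \<and> q \<le> 2 * m + 1}"
    have "{q. prime q \<and> q \<le> n} = {q. prime q \<and> q \<le> m + 1} \<union> ?A" using 3 by auto
    moreover have "finite ?A" by simp
    ultimately have "\<Prod>{q. prime q \<and> q \<le> n} = \<Prod>{q. prime q \<and> q \<le> m + 1} * \<Prod>?A"
      using fin by (simp only:) (intro prod.union_disjoint, auto)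
    also have "\<Prod>{q. prime q \<and> q \<le> m + 1} \<le> 4 ^ (m + 1)" using 3 by (intro less) simp
    also have "\<Prod>?A \<le> 4 ^ m"
    proof -
      have "q dvd (2 * m + 1) choose m" if "q \<in> ?A" for q
      proof -
        have q: "prime q" "m + 1 < q" "q \<le> 2 * m + 1" using that by auto
        have eq: "fact m * fact (m + 1) * ((2 * m + 1) choose m) = fact (2 * m + 1)"
          using binomial_fact_lemma[of m "2 * m + 1"] by simp
        have "q dvd fact (2 * m + 1)" using q by (simp add: prime_dvd_fact_iff del: fact_Suc)
        then have "q dvd fact m * fact (m + 1) * ((2 * m + 1) choose m)" by (simp only: eq)
        moreover have "\<not> q dvd fact m" "\<not> q dvd fact (m + 1)"
          using q by (simp_all add: prime_dvd_fact_iff del: fact_Suc)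
        ultimately show ?thesis using q(1) by (simp only: prime_dvd_mult_iff) blast
      qed
      then have "\<Prod>?A dvd (2 * m + 1) choose m" by (intro prod_primes_dvd) auto
      then have "\<Prod>?A \<le> (2 * m + 1) choose m" by (rule dvd_imp_le) simp
      then show ?thesis using choose_odd_middle_le[of m] by simp
    qed
    also have "4 ^ (m + 1) * 4 ^ m = (4 :: nat) ^ n" by (simp only: 3 mult_2 flip: power_add) (simp add: ac_simps)
    finally show ?thesis by simp
  qed
qed

text \<open>Legendre's formula. The summation range is independent of \<open>m\<close>, so that the
  factorials in a binomial coefficient can be compared term by term.\<close>

lemma multiplicity_fact:
  fixes q :: nat
  assumes "prime q" "m \<le> N"
  shows "multiplicity q (fact m) = (\<Sum>i=1..N. m div q ^ i)"
  using assms(2)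
proof (induction m)
  case (Suc m)
  have q: "Suc 0 < q" using prime_gt_1_nat[OF assms(1)] by simp
  have "multiplicity q (Suc m) = card {1..multiplicity q (Suc m)}" by simp
  also have "{1..multiplicity q (Suc m)} = {i \<in> {1..N}. q ^ i dvd Suc m}"
  proof -
    have "i \<le> N" if "q ^ i dvd Suc m" for i
    proof -
      have "i < q ^ i" using q by (rule power_gt_expt)
      also have "q ^ i \<le> Suc m" using that by (rule dvd_imp_le) simp
      finally show ?thesis using Suc.prems by simp
    qed
    then show ?thesis using q by (auto simp: power_dvd_iff_le_multiplicity)
  qed
  also have "card \<dots> = (\<Sum>i=1..N. if q ^ i dvd Suc m then 1 else 0)" by (simp add: sum.If_cases Int_def)
  finally have Suc_m: "multiplicity q (Suc m) = (\<Sum>i=1..N. if q ^ i dvd Suc m then 1 else 0)" .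
  have "multiplicity q (fact (Suc m)) = multiplicity q (Suc m * fact m)"
    by (simp only: fact_Suc of_nat_id)
  also have "\<dots> = multiplicity q (Suc m) + multiplicity q (fact m)"
    using assms(1) by (intro prime_elem_multiplicity_mult_distrib) auto
  also have "\<dots> = (\<Sum>i=1..N. (if q ^ i dvd Suc m then 1 else 0) + m div q ^ i)"
    using Suc by (simp add: Suc_m sum.distrib)
  also have "\<dots> = (\<Sum>i=1..N. Suc m div q ^ i)"
    by (intro sum.cong refl) (simp add: div_Suc dvd_eq_mod_eq_0)
  finally show ?case .
qed simp

section \<open>Prime powers in the central binomial coefficient\<close>

context
  fixes M q :: nat
  assumes q: "prime q" and M: "M > 0"
begin

text \<open>The share of \<open>q ^ i\<close> in the multiplicity, 0 or 1: a carry in Kummer's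
  theorem for \<open>M + M\<close> in base \<open>q\<close>.\<close>

private definition t where "t i = 2 * M div q ^ i - 2 * (M div q ^ i)"

private lemma t_eq: "2 * M div q ^ i = t i + 2 * (M div q ^ i)" "t i \<le> 1"
proof -
  have d: "q ^ i > 0" using q prime_gt_0_nat by simp
  have "2 * (M div q ^ i) \<le> 2 * M div q ^ i"
    using d by (simp add: less_eq_div_iff_mult_less_eq)
  moreover have "2 * M div q ^ i < 2 * (M div q ^ i) + 2"
  proof -
    have "M < q ^ i * (M div q ^ i + 1)" using d dividend_less_times_div by simp
    then have "2 * M < (2 * (M div q ^ i) + 2) * q ^ i" by (simp add: algebra_simps)
    then show ?thesis using d by (simp add: div_less_iff_less_mult)
  qed
  ultimately show "2 * M div q ^ i = t i + 2 * (M div q ^ i)" "t i \<le> 1" by (auto simp: t_def)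
qed

private lemma multiplicity_eq: "multiplicity q (2 * M choose M) = (\<Sum>i=1..2 * M. t i)"
proof -
  have "multiplicity q (fact (2 * M)) = multiplicity q (fact M * fact M * (2 * M choose M))"
    using binomial_fact_lemma[of M "2 * M"] by simp
  also have "\<dots> = 2 * multiplicity q (fact M) + multiplicity q (2 * M choose M)"
    using q by (simp add: prime_elem_multiplicity_mult_distrib)
  finally have "(\<Sum>i=1..2 * M. t i + 2 * (M div q ^ i)) =
      2 * (\<Sum>i=1..2 * M. M div q ^ i) + multiplicity q (2 * M choose M)"
    using q by (simp add: multiplicity_fact[of q _ "2 * M"] flip: t_eq(1))
  then show ?thesis by (simp add: sum.distrib sum_distrib_left)
qed

private lemma multiplicity_le_card: "multiplicity q (2 * M choose M) \<le> card {i. i \<ge> 1 \<and> q ^ i \<le> 2 * M}"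
proof -
  have q1: "Suc 0 < q" using prime_gt_1_nat[OF q] by simp
  have bd: "i \<le> 2 * M" if "q ^ i \<le> 2 * M" for i
    using power_gt_expt[OF q1, of i] that by simp
  have fin: "finite {i. i \<ge> 1 \<and> q ^ i \<le> 2 * M}"
    by (rule finite_subset[of _ "{..2 * M}"]) (auto dest: bd)
  have "(\<Sum>i=1..2 * M. t i) = (\<Sum>i\<in>{i. i \<ge> 1 \<and> q ^ i \<le> 2 * M}. t i)"
  proof (intro sum.mono_neutral_right ballI)
    fix i assume "i \<in> {1..2 * M} - {i. i \<ge> 1 \<and> q ^ i \<le> 2 * M}"
    then have "2 * M < q ^ i" by auto
    then show "t i = 0" by (simp add: t_def)
  qed (auto dest: bd)
  also have "\<dots> \<le> (\<Sum>i\<in>{i. i \<ge> 1 \<and> q ^ i \<le> 2 * M}. 1)" by (intro sum_mono t_eq)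
  finally show ?thesis by (simp add: multiplicity_eq)
qed

text \<open>The multiplicity is at most the number of \<open>i \<ge> 1\<close> with
  \<open>q ^ i \<le> 2 * M\<close>; were the claim false, all these \<open>i\<close> would be
  smaller than the multiplicity.\<close>

lemma prime_power_choose_le: "q ^ multiplicity q (2 * M choose M) \<le> 2 * M"
proof -
  have q1: "q > 1" using q prime_gt_1_nat by blast
  let ?a = "multiplicity q (2 * M choose M)"
  show ?thesis
  proof (rule ccontr)
    assume a: "\<not> ?thesis"
    have "i < ?a" if "q ^ i \<le> 2 * M" for i
    proof (rule ccontr)
      assume "\<not> i < ?a"
      then have "q ^ ?a \<le> q ^ i" using q1 by (intro power_increasing) auto
      then show False using a that by simp
    qed
    then have "card {i. i \<ge> 1 \<and> q ^ i \<le> 2 * M} \<le> card {1..<?a}" by (intro card_mono) auto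
    then have "?a \<le> ?a - 1" using multiplicity_le_card by simp
    moreover have "?a > 0" using a M by (cases "?a = 0") auto
    ultimately show False by simp
  qed
qed

lemma multiplicity_choose_le_1:
  assumes "2 * M < q ^ 2"
  shows "multiplicity q (2 * M choose M) \<le> 1"
proof -
  have q1: "q > 1" using q prime_gt_1_nat by blast
  have "i = 1" if "i \<ge> 1" "q ^ i \<le> 2 * M" for i
  proof (rule ccontr)
    assume "i \<noteq> 1"
    then have "q ^ 2 \<le> q ^ i" using that q1 by (intro power_increasing) auto
    then show False using that assms by simp
  qed
  then have "card {i. i \<ge> 1 \<and> q ^ i \<le> 2 * M} \<le> card {1 :: nat}" by (intro card_mono) auto
  then show ?thesis using multiplicity_le_card by simp
qed

text \<open>Here \<open>2 * M div q = 2\<close> is compensated by twice \<open>M div q = 1\<close>,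
  and higher powers of \<open>q\<close> exceed \<open>2 * M\<close>.\<close>

lemma multiplicity_choose_eq_0:
  assumes "2 * M < q ^ 2" "2 * M < 3 * q" "q \<le> M"
  shows "multiplicity q (2 * M choose M) = 0"
proof -
  have q1: "q > 1" using q prime_gt_1_nat by blast
  have "t i = 0" if "i \<in> {1..2 * M}" for i
  proof (cases "i = 1")
    case True
    have "M div q = 1" "2 * M div q = 2"
      using assms by (auto intro!: div_nat_eqI)
    then show ?thesis using True by (simp add: t_def)
  next
    case False
    then have "q ^ 2 \<le> q ^ i" using that q1 by (intro power_increasing) auto
    then show ?thesis using assms by (simp add: t_def)
  qed
  then show ?thesis by (simp add: multiplicity_eq)
qed

end

text \<open>The start is \<open>45 ^ 8 \<le> 2 ^ 44\<close>; afterwards the left side grows by a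
  factor of at most \<open>(46 / 45) ^ 8 < 2\<close>.\<close>

lemma power_8_le_power: "y \<ge> 44 \<Longrightarrow> (y + 1) ^ 8 \<le> (2 :: nat) ^ y"
proof (induction y rule: dec_induct)
  case (step y)
  have "(45 * (Suc y + 1)) ^ 8 \<le> (46 * (y + 1)) ^ 8" using step by (intro power_mono) auto
  also have "\<dots> = 46 ^ 8 * (y + 1) ^ 8" by (rule power_mult_distrib)
  also have "\<dots> \<le> (2 * 45 ^ 8) * 2 ^ y" using step.IH by (intro mult_le_mono) auto
  finally have "45 ^ 8 * (Suc y + 1) ^ 8 \<le> 45 ^ 8 * (2 * 2 ^ y)"
    by (simp only: power_mult_distrib mult.assoc mult.left_commute[of 2])
  then show ?case by simp
qed simp

text \<open>Erdos's proof of Bertrand's postulate; the two numbers after \<open>M\<close> that are left out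
  cost a factor of at most \<open>(2 M)\<^sup>2\<close>.\<close>

lemma prime_between:
  assumes M: "M \<ge> 968"
  shows "\<exists>q::nat. prime q \<and> M + 3 \<le> q \<and> q \<le> 2 * M"
proof (rule ccontr)
  assume none: "\<not> ?thesis"
  define x where "x = 2 * M"
  have x1: "x \<ge> 1" using M by (simp add: x_def)
  define y where "y = floor_sqrt x"
  have y_le: "y ^ 2 \<le> x" and y_gt: "x < (y + 1) ^ 2"
    using floor_sqrt_power2_le[of x] Suc_floor_sqrt_power2_gt[of x] by (simp_all add: y_def)
  \<comment> \<open>The bound 968 is \<open>44 ^ 2 / 2\<close>, which brings the square root to the
    start of \<open>power_8_le_power\<close>.\<close>
  have y44: "y \<ge> 44"
  proof (rule ccontr)
    assume "\<not> y \<ge> 44"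
    then have "(y + 1) ^ 2 \<le> 44 ^ 2" by (intro power_mono) auto
    then show False using y_gt M by (simp add: x_def)
  qed
  let ?k = "2 * M choose M"
  let ?g = "\<lambda>q. q ^ multiplicity q ?k"
  \<comment> \<open>Primes in \<open>A\<close> contribute at most \<open>x\<close> each; those in
    \<open>B\<close> exceed the square root, occur once and are bounded by the primorial; in
    \<open>C\<close> only \<open>M + 1\<close> and \<open>M + 2\<close> can remain.\<close>
  define A where "A = {q \<in> prime_factors ?k. q \<le> y}"
  define B where "B = {q \<in> prime_factors ?k. y < q \<and> q \<le> x div 3}"
  define C where "C = {q \<in> prime_factors ?k. y < q \<and> x div 3 < q}"
  have fin: "finite A" "finite B" "finite C" by (auto simp: A_def B_def C_def)
  have mult_1: "multiplicity q ?k \<le> 1" if "prime q" "y < q" for q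
  proof (rule multiplicity_choose_le_1)
    have "(y + 1) ^ 2 \<le> q ^ 2" using that by (intro power_mono) auto
    then show "2 * M < q ^ 2" using y_gt unfolding x_def by (rule order.strict_trans2[rotated])
  qed (use that M in auto)
  have "?k = prod ?g (prime_factors ?k)" by (subst prod_prime_factors) auto
  also have "prime_factors ?k = A \<union> (B \<union> C)" by (auto simp: A_def B_def C_def)
  also have "prod ?g \<dots> = prod ?g A * (prod ?g B * prod ?g C)"
    using fin by (subst prod.union_disjoint, simp, simp, force simp: A_def B_def C_def)
      (subst prod.union_disjoint, auto simp: B_def C_def)
  finally have k: "?k = prod ?g A * (prod ?g B * prod ?g C)" .
  have A: "prod ?g A \<le> x ^ y"
  proof -
    have "prod ?g A \<le> (\<Prod>q\<in>A. x)"
      using M by (intro prod_mono) (auto simp: A_def x_def intro!: prime_power_choose_le)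
    also have "\<dots> \<le> x ^ y"
    proof -
      have "A \<subseteq> {1..y}" by (auto simp: A_def Suc_le_eq intro!: prime_gt_0_nat)
      then have "card A \<le> y" using card_mono[of "{1..y}" A] by simp
      then show ?thesis using x1 by (simp add: power_increasing)
    qed
    finally show ?thesis .
  qed
  have B: "prod ?g B \<le> 4 ^ (x div 3)"
  proof -
    have "?g q \<le> q" if "q \<in> B" for q
    proof -
      have "prime q" "y < q" using that by (auto simp: B_def)
      then have "?g q \<le> q ^ 1" using mult_1 prime_gt_0_nat by (intro power_increasing) auto
      then show ?thesis by simp
    qed
    then have "prod ?g B \<le> \<Prod>B" by (intro prod_mono) auto
    also have "\<dots> \<le> \<Prod>{q. prime q \<and> q \<le> x div 3}"
      by (intro dvd_imp_le prod_dvd_prod_subset) (auto simp: B_def prime_gt_0_nat intro!: prod_pos)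
    also have "\<dots> \<le> 4 ^ (x div 3)" by (rule primorial_le)
    finally show ?thesis .
  qed
  have C: "prod ?g C \<le> x ^ 2"
  proof -
    have "C \<subseteq> {M + 1, M + 2}"
    proof
      fix q assume q: "q \<in> C"
      then have pq: "prime q" "y < q" "x < 3 * q" "q dvd ?k" by (auto simp: C_def)
      have "q \<le> 2 * M"
      proof (rule ccontr)
        assume "\<not> q \<le> 2 * M"
        then have "\<not> q dvd fact (2 * M)" using pq(1) by (simp add: prime_dvd_fact_iff)
        moreover have "?k dvd fact (2 * M)"
          using binomial_fact_lemma[of M "2 * M"] by (metis dvd_triv_right mult.commute le_add2 mult_2)
        ultimately show False using pq(4) dvd_trans by blast
      qed
      moreover have "M < q"
      proof (rule ccontr)
        assume "\<not> M < q"
        have "(y + 1) ^ 2 \<le> q ^ 2" using pq by (intro power_mono) auto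
        then have "x < q ^ 2" by (rule order.strict_trans2[OF y_gt])
        then have "multiplicity q ?k = 0"
          using pq M \<open>\<not> M < q\<close> by (intro multiplicity_choose_eq_0) (auto simp: x_def)
        then show False using q by (auto simp: C_def prime_factors_multiplicity)
      qed
      moreover have "\<not> M + 3 \<le> q" using none pq(1) \<open>q \<le> 2 * M\<close> by blast
      ultimately have "q = M + 1 \<or> q = M + 2" by linarith
      then show "q \<in> {M + 1, M + 2}" by simp
    qed
    then have "card C \<le> card {M + 1, M + 2}" by (intro card_mono) auto
    then have "card C \<le> 2" by simp
    have "prod ?g C \<le> (\<Prod>q\<in>C. x)"
      using M by (intro prod_mono) (auto simp: C_def x_def intro!: prime_power_choose_le)
    also have "\<dots> \<le> x ^ 2" using \<open>card C \<le> 2\<close> x1 by (simp add: power_increasing)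
    finally show ?thesis .
  qed
  have "4 ^ M \<le> x * ?k"
  proof -
    have "4 ^ M / real x \<le> real ?k"
      using central_binomial_lower_bound[of M] M by (simp add: x_def)
    then have "real (4 ^ M) \<le> real (x * ?k)" using M by (simp add: x_def field_simps)
    then show ?thesis by (simp only: of_nat_le_iff)
  qed
  also have "\<dots> \<le> x * (x ^ y * (4 ^ (x div 3) * x ^ 2))"
    by (intro mult_le_mono le_refl ord_eq_le_trans[OF k] A B C)
  also have "\<dots> = x ^ (y + 3) * 4 ^ (x div 3)" by (simp add: power_add power3_eq_cube power2_eq_square)
  finally have main: "4 ^ M \<le> x ^ (y + 3) * 4 ^ (x div 3)" .
  have x4: "x ^ 4 \<le> 2 ^ y"
  proof -
    have "x ^ 4 \<le> ((y + 1) ^ 2) ^ 4" using y_gt by (intro power_mono) auto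
    also have "\<dots> = (y + 1) ^ 8" by (simp flip: power_mult)
    finally show ?thesis using power_8_le_power[OF y44] by simp
  qed
  have four: "(4 :: nat) ^ M = 2 ^ x" unfolding x_def power_mult by simp
  \<comment> \<open>The twelfth power removes the division by 3 and produces the fourth powers of
    \<open>x\<close> needed for \<open>x4\<close>.\<close>
  have "(2 :: nat) ^ (12 * x) = (4 ^ M) ^ 12"
    unfolding four power_mult[symmetric] by (simp only: mult.commute)
  also have "\<dots> \<le> (x ^ (y + 3) * 4 ^ (x div 3)) ^ 12" using main by (intro power_mono) auto
  also have "\<dots> = (x ^ 4) ^ (3 * (y + 3)) * 4 ^ (12 * (x div 3))"
    unfolding power_mult_distrib power_mult[symmetric] by (simp add: algebra_simps)
  also have "\<dots> \<le> (2 ^ y) ^ (3 * (y + 3)) * 4 ^ (4 * x)"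
    by (rule mult_le_mono[OF power_mono[OF x4] power_increasing]) auto
  also have "\<dots> = 2 ^ (y * (3 * (y + 3)) + 8 * x)"
  proof -
    have "(4 :: nat) ^ (4 * x) = 2 ^ (8 * x)"
      using power_mult[of "2 :: nat" 2 "4 * x"] by simp
    then show ?thesis by (simp add: power_add power_mult)
  qed
  finally have "12 * x \<le> y * (3 * (y + 3)) + 8 * x" by (simp add: power_increasing_iff)
  then have "4 * x \<le> 3 * y ^ 2 + 9 * y" by (simp add: algebra_simps power2_eq_square)
  then have "4 * y ^ 2 \<le> 3 * y ^ 2 + 9 * y" using y_le by linarith
  then have "y * y \<le> 9 * y" by (simp add: power2_eq_square)
  then show False using y44 by simp
qed

lemma prime_by_trial_division:
  fixes m k :: nat
  assumes "1 < m" "m < k ^ 2" "list_all (\<lambda>d. \<not> d dvd m) [2..<k]"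
  shows "prime m"
  unfolding prime_nat_iff
proof (intro conjI allI impI assms(1))
  fix d assume "d dvd m"
  then obtain e where e: "m = d * e" by blast
  have small: "c \<notin> {2..<k}" if "c dvd m" for c
    using assms(3) that by (auto simp: list_all_iff)
  have "d < k \<or> e < k"
  proof (rule ccontr)
    assume "\<not> ?thesis"
    then have "k * k \<le> d * e" by (intro mult_le_mono) auto
    then show False using assms(2) e by (simp add: power2_eq_square)
  qed
  moreover have "d \<noteq> 0" "e \<noteq> 0" using e assms(1) by (cases d; cases e; simp)+
  ultimately have "d = 1 \<or> e = 1" using small[of d] small[of e] e by auto
  then show "d = 1 \<or> d = m" using e by auto
qed

text \<open>The inequalities are \<open>p - 1 - f \<le> L\<close> and, for the largest
  \<open>f = 3\<close>, \<open>L < 2 * (p - 1 - f)\<close>, with \<open>L = n - 3 - f\<close>. A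
  prime \<open>q\<close> serves \<open>q + 2 \<le> n \<le> 2 * q - 3\<close>; in the list each prime
  is at most \<open>2 * q - 5\<close> for its predecessor \<open>q\<close>, so these intervals
  overlap.\<close>

lemma prime_for:
  assumes "n \<ge> 13"
  shows "\<exists>q::nat. prime q \<and> q + 2 \<le> n \<and> n + 3 \<le> 2 * q"
proof -
  have p11: "prime (11::nat)" by (rule prime_by_trial_division[where k = 4]) simp_all
  have p17: "prime (17::nat)" by (rule prime_by_trial_division[where k = 5]) simp_all
  have p29: "prime (29::nat)" by (rule prime_by_trial_division[where k = 6]) simp_all
  have p53: "prime (53::nat)" by (rule prime_by_trial_division[where k = 8]) simp_all
  have p101: "prime (101::nat)" by (rule prime_by_trial_division[where k = 11]) simp_all
  have p197: "prime (197::nat)" by (rule prime_by_trial_division[where k = 15]) simp_all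
  have p389: "prime (389::nat)" by (rule prime_by_trial_division[where k = 20]) simp_all
  have p773: "prime (773::nat)" by (rule prime_by_trial_division[where k = 28]) simp_all
  have p1531: "prime (1531::nat)" by (rule prime_by_trial_division[where k = 40]) simp_all
  consider "n \<le> 19" | "19 \<le> n" "n \<le> 31" | "31 \<le> n" "n \<le> 55" | "55 \<le> n" "n \<le> 103" | "103 \<le> n" "n \<le> 199"
    | "199 \<le> n" "n \<le> 391" | "391 \<le> n" "n \<le> 775" | "775 \<le> n" "n \<le> 1543" | "1543 \<le> n" "n \<le> 3059" | "n \<ge> 3059"
    by linarith
  then show ?thesis
  proof cases
    case 1 then show ?thesis using assms by (intro exI[of _ 11] conjI p11) linarith+
  next
    case 2 then show ?thesis by (intro exI[of _ 17] conjI p17) linarith+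
  next
    case 3 then show ?thesis by (intro exI[of _ 29] conjI p29) linarith+
  next
    case 4 then show ?thesis by (intro exI[of _ 53] conjI p53) linarith+
  next
    case 5 then show ?thesis by (intro exI[of _ 101] conjI p101) linarith+
  next
    case 6 then show ?thesis by (intro exI[of _ 197] conjI p197) linarith+
  next
    case 7 then show ?thesis by (intro exI[of _ 389] conjI p389) linarith+
  next
    case 8 then show ?thesis by (intro exI[of _ 773] conjI p773) linarith+
  next
    case 9 then show ?thesis by (intro exI[of _ 1531] conjI p1531) linarith+
  next
    case 10
    \<comment> \<open>Then \<open>n\<close> is \<open>2 * M + 2\<close> or \<open>2 * M + 3\<close>,
      for which the bounds \<open>M + 3 \<le> q \<le> 2 * M\<close> are sufficient.\<close>
    define M where "M = n div 2 - 1"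
    have M: "M \<ge> 968" "2 * M + 2 \<le> n" "n \<le> 2 * M + 3" unfolding M_def using 10 by linarith+
    obtain q where q: "prime q" "M + 3 \<le> q" "q \<le> 2 * M" using prime_between[OF M(1)] by blast
    then have "q + 2 \<le> n" "n + 3 \<le> 2 * q" using M by linarith+
    then show ?thesis using q(1) by blast
  qed
qed

section \<open>The presentations\<close>

lemma parameters_exist:
  assumes "n \<ge> 5" "n \<noteq> 6"
  shows "\<exists>p r s f L. parameters p r s f L \<and> n = f + L + 3 \<and> odd L = b \<and> s < p \<and> f \<le> 3"
proof -
  have "\<exists>p f L. prime p \<and> odd p \<and> f + 2 \<le> p \<and> p - 1 - f \<le> L \<and> L < 2 * (p - 1 - f) \<and>
    \<not> 3 dvd L \<and> n = f + L + 3 \<and> odd L = b \<and> f \<le> (3 :: nat)" (is "\<exists>p f L. ?P p f L")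
  proof (cases "n \<ge> 13")
    case True
    then obtain p where p: "prime p" "p + 2 \<le> n" "n + 3 \<le> 2 * p" using prime_for by blast
    \<comment> \<open>The parity leaves two values of \<open>f\<close> that differ by 2, and 3
      divides at most one of the corresponding \<open>L\<close>.\<close>
    have "\<exists>f\<le>3. odd (n - 3 - f) = b \<and> \<not> 3 dvd (n - 3 - f)"
    proof -
      have "\<exists>f\<le>3. odd (k + 3 - f) = b \<and> \<not> 3 dvd (k + 3 - f)" for k :: nat
        by (cases b) presburger+
      from this[of "n - 6"] show ?thesis using True by simp
    qed
    then obtain f where f: "f \<le> 3" "odd (n - 3 - f) = b" "\<not> 3 dvd (n - 3 - f)" by blast
    have "odd p" using p True prime_odd_nat[of p] by simp
    moreover have "f + 2 \<le> p" "p - 1 - f \<le> n - 3 - f" "n - 3 - f < 2 * (p - 1 - f)" "n = f + (n - 3 - f) + 3"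
      using p f(1) True by linarith+
    ultimately have "?P p f (n - 3 - f)" using p f by blast
    then show ?thesis by blast
  next
    case False
    then consider "n = 5" | "n = 7" | "n = 8" | "n = 9" | "n = 10" | "n = 11" | "n = 12"
      using assms by linarith
    then show ?thesis
    proof cases
      case 1
      then have "?P 3 (if b then 1 else 0) (if b then 1 else 2)" by (cases b) auto
      then show ?thesis by blast
    next
      case 2
      then have "?P 5 (if b then 3 else 0) (if b then 1 else 4)" by (cases b) auto
      then show ?thesis by blast
    next
      case 3
      then have "?P 5 (if b then 0 else 1) (if b then 5 else 4)" by (cases b) auto
      then show ?thesis by blast
    next
      case 4
      then have "?P (if b then 5 else 7) (if b then 1 else 2) (if b then 5 else 4)" by (cases b) auto
      then show ?thesis by blast
    next
      case 5
      then have "?P 7 (if b then 0 else 3) (if b then 7 else 4)" by (cases b) auto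
      then show ?thesis by blast
    next
      case 6
      then have "?P 7 (if b then 1 else 0) (if b then 7 else 8)" by (cases b) auto
      then show ?thesis by blast
    next
      case 7
      then have "?P 7 (if b then 2 else 1) (if b then 7 else 8)" by (cases b) auto
      then show ?thesis by blast
    qed
  qed
  then obtain p f L where P: "?P p f L" by blast
  then have p: "prime p" "p > 2" using prime_ge_2_nat[of p] by (auto simp: le_less)
  obtain r where r: "residue_primroot p r" using prime_primitive_root_exists[of p] p by auto
  have "\<not> [r = 1] (mod p)"
  proof
    assume "[r = 1] (mod p)"
    then have "[r ^ 1 = 1] (mod p)" by simp
    then have "ord p r dvd 1" by (simp only: ord_divides)
    then have "p - 1 = 1" using r p by (simp add: residue_primroot_def totient_prime)
    then show False using p by linarith
  qed
  \<comment> \<open>The sum \<open>r + p - 1\<close> stands for \<open>r - 1\<close> modulo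
    \<open>p\<close>, free of truncated subtraction; likewise \<open>p - 1\<close> stands for
    \<open>-1\<close> in the definition of \<open>s\<close>.\<close>
  have "\<not> p dvd r + p - 1"
  proof
    assume "p dvd r + p - 1"
    then have "[r + p - 1 + 1 = 0 + 1] (mod p)" by (intro cong_add cong_refl) (simp add: cong_0_iff)
    moreover have "r + p - 1 + 1 = r + p" using p by simp
    ultimately have "[r = 1] (mod p)" by (simp add: cong_def)
    then show False using \<open>\<not> [r = 1] (mod p)\<close> by blast
  qed
  then have "coprime (r + p - 1) p" using p by (simp add: coprime_commute prime_imp_coprime)
  then obtain s' where s': "[(r + p - 1) * s' = 1] (mod p)" using cong_solve_coprime_nat by auto
  define s where "s = ((p - 1) * s') mod p"
  have "[s = (p - 1) * s'] (mod p)" by (simp add: s_def cong_def)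
  have "[(r + p - 1) * s = (r + p - 1) * ((p - 1) * s')] (mod p)"
    using \<open>[s = (p - 1) * s'] (mod p)\<close> by (intro cong_mult cong_refl)
  also have "(r + p - 1) * ((p - 1) * s') = (p - 1) * ((r + p - 1) * s')" by (simp only: ac_simps)
  also have "[\<dots> = (p - 1) * 1] (mod p)" using s' by (intro cong_mult cong_refl)
  finally have "[1 + (r + p - 1) * s = 1 + (p - 1) * 1] (mod p)" by (intro cong_add cong_refl)
  moreover have "1 + (r + p - 1) * s = 1 + r * s + (p - 1) * s"
    using p by (cases p) (simp_all add: algebra_simps)
  moreover have "s + (p - 1) * s = p * s" "1 + (p - 1) * 1 = p" using p by (cases p; simp)+
  then have "[1 + (p - 1) * 1 = s + (p - 1) * s] (mod p)" by (simp only:) (simp add: cong_def)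
  ultimately have "[1 + r * s + (p - 1) * s = s + (p - 1) * s] (mod p)" by (metis cong_trans)
  then have s: "[s = 1 + r * s] (mod p)" by (simp only: cong_add_rcancel_nat cong_sym_eq)
  moreover have "s > 0"
  proof (rule ccontr)
    assume "\<not> s > 0"
    then show False using s p by (simp add: cong_def)
  qed
  moreover have "s < p" using p by (simp add: s_def)
  ultimately have "parameters p r s f L" using P r by unfold_locales auto
  then show ?thesis using P \<open>s < p\<close> by blast
qed

text \<open>Words trivial in every group but pairwise distinct as expressions. They fill up the
  relators to exactly seven: for \<open>n = 6\<close> there are at most six, and in general only an
  upper bound on their number is established.\<close>

fun pad :: "nat \<Rightarrow> nat word_expr"
  where
    "pad 0 = Pow (Gen 0) 0"
  | "pad (Suc k) = Mul (pad k) (Pow (Gen 0) 0)"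

lemma weval_pad: "weval h (pad k) = 1"
  by (induction k) auto

lemma set_pad: "set_word_expr (pad k) = {0}"
  by (induction k) auto

lemma inj_pad: "inj pad"
proof (rule injI)
  fix i j assume "pad i = pad j"
  then show "i = j"
  proof (induction i arbitrary: j)
    case 0
    then show ?case by (cases j) auto
  next
    case (Suc i)
    then show ?case by (cases j) auto
  qed
qed

section \<open>Lengths of words\<close>

fun leaves :: "'a word_expr \<Rightarrow> nat"
  where
    "leaves (Gen x) = 1"
  | "leaves (Mul u v) = leaves u + leaves v"
  | "leaves (Pow u m) = leaves u"

fun bounded_exponents :: "nat \<Rightarrow> 'a word_expr \<Rightarrow> bool"
  where
    "bounded_exponents K (Gen x) \<longleftrightarrow> True"
  | "bounded_exponents K (Mul u v) \<longleftrightarrow> bounded_exponents K u \<and> bounded_exponents K v"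
  | "bounded_exponents K (Pow u m) \<longleftrightarrow> bounded_exponents K u \<and> \<bar>m\<bar> \<le> int K"

text \<open>The number of leaves is exactly 60 for the fifth relator, the longest one; the factor 3
  comes from the exponent \<open>3 * L\<close>.\<close>

definition short :: "nat \<Rightarrow> 'a word_expr \<Rightarrow> bool"
  where "short n w \<longleftrightarrow> leaves w \<le> 60 \<and> num_exponents w \<le> 60 \<and> bounded_exponents (3 * n) w"

text \<open>With \<open>K \<ge> 2\<close> the logarithm is at least 1 and thus also covers the
  single bit charged for the exponents 0, 1 and -1.\<close>

lemma bl_le:
  assumes "K \<ge> 2" "bounded_exponents K w"
  shows "bl w \<le> leaves w + num_exponents w * log 2 K"
  using assms(2)
proof (induction w)
  case (Pow u m)
  have K: "1 \<le> log 2 (real K)" using assms(1) by (subst le_log_iff) auto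
  have "exponent_bits m \<le> log 2 K"
  proof (cases "\<bar>m\<bar> \<ge> 2")
    case True
    have "\<bar>real_of_int m\<bar> \<le> real K" using Pow.prems by (simp, linarith)
    moreover have "0 < \<bar>real_of_int m\<bar>" using True by simp
    ultimately show ?thesis using True by (simp add: exponent_bits_def)
  qed (use K in \<open>simp add: exponent_bits_def\<close>)
  then show ?case using Pow by (simp add: distrib_right)
qed (auto simp: distrib_right)

lemma pad_relations:
  fixes R :: "nat word_expr set"
  assumes "card R \<le> 7" "finite R"
  obtains R' where "R \<subseteq> R'" "card R' = 7" "R' \<subseteq> R \<union> pad ` {..<7}"
proof -
  have "card (pad ` {..<7}) = 7" using inj_pad by (subst card_image) (auto simp: inj_on_def)
  then have "7 \<le> card (R \<union> pad ` {..<7})"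
    using assms(2) card_mono[of "R \<union> pad ` {..<7}" "pad ` {..<7}"] by simp
  then show ?thesis using exists_subset_between[OF assms(1), of "R \<union> pad ` {..<7}"] assms(2) that by auto
qed

lemma short_pad: "k < 7 \<Longrightarrow> short n (pad k)"
proof -
  have "leaves (pad k) = k + 1 \<and> num_exponents (pad k) = k + 1 \<and> bounded_exponents (3 * n) (pad k)"
    by (induction k) auto
  then show "k < 7 \<Longrightarrow> short n (pad k)" by (simp add: short_def)
qed

text \<open>As \<open>3 * n \<le> n ^ 2\<close>, each word costs at most
  \<open>60 + 120 * log 2 n\<close>. Seven of them and 10 for the lists give
  \<open>430 + 840 * log 2 n\<close>, and \<open>log 2 n \<ge> 1\<close>.\<close>

lemma cost:
  fixes R :: "nat word_expr set"
  assumes n: "n \<ge> 5" and R: "card R = 7" "\<And>w. w \<in> R \<Longrightarrow> short n w" and X: "card X = 3"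
  shows "presentation_bit_length X R \<le> 1300 * log 2 (real n)" "presentation_num_exponents R \<le> 420"
proof -
  have lg: "1 \<le> log 2 (real n)" using n by (subst le_log_iff) auto
  have "log 2 (real (3 * n)) \<le> log 2 (real n ^ 2)"
    using n by (intro log_mono) (auto simp: power2_eq_square)
  then have lg3: "log 2 (real (3 * n)) \<le> 2 * log 2 (real n)" using n by (simp add: log_nat_power)
  have pos: "0 \<le> log 2 (real (3 * n))" using n by (subst zero_le_log_cancel_iff) auto
  have "bl w \<le> 60 + 60 * (2 * log 2 (real n))" if "w \<in> R" for w
  proof -
    have w: "leaves w \<le> 60" "num_exponents w \<le> 60" "bounded_exponents (3 * n) w"
      using R(2)[OF that] by (auto simp: short_def)
    have "bl w \<le> leaves w + num_exponents w * log 2 (3 * n)"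
      using n w by (intro bl_le) auto
    also have "\<dots> \<le> 60 + 60 * log 2 (real (3 * n))"
      using w pos by (intro add_mono mult_right_mono) auto
    also have "\<dots> \<le> 60 + 60 * (2 * log 2 (real n))" using lg3 by simp
    finally show ?thesis .
  qed
  then have "(\<Sum>w\<in>R. bl w) \<le> real (card R) * (60 + 60 * (2 * log 2 (real n)))"
    by (rule sum_bounded_above)
  then show "presentation_bit_length X R \<le> 1300 * log 2 (real n)"
    using lg by (simp add: presentation_bit_length_def R(1) X)
  have "(\<Sum>w\<in>R. num_exponents w) \<le> card R * 60"
    using sum_bounded_above[of R num_exponents 60] R(2) by (simp add: short_def)
  then show "presentation_num_exponents R \<le> 420" by (simp add: presentation_num_exponents_def R(1))
qed

section \<open>The relators as expressions\<close>

abbreviation wpow :: "'a word_expr \<Rightarrow> nat \<Rightarrow> 'a word_expr" where "wpow w k \<equiv> Pow w (int k)"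
abbreviation winv :: "'a word_expr \<Rightarrow> 'a word_expr" where "winv w \<equiv> Pow w (- 1)"
abbreviation wcj :: "'a word_expr \<Rightarrow> 'a word_expr \<Rightarrow> 'a word_expr" where "wcj w v \<equiv> Mul (Mul (winv v) w) v"
abbreviation weq :: "'a word_expr \<Rightarrow> 'a word_expr \<Rightarrow> 'a word_expr" where "weq w v \<equiv> Mul w (winv v)"

lemma times_inverse_eq_one_iff: "(g :: 'g::mgroup) * inverse h = 1 \<longleftrightarrow> g = h"
  by (metis inverse_invol inverse_unique rinv)

lemma weval_wpow: "weval h (wpow w k) = weval h w ^ k"
  and weval_winv: "weval h (winv w) = inverse (weval h w)"
  by simp_all

definition relators :: "nat \<Rightarrow> nat \<Rightarrow> nat \<Rightarrow> nat \<Rightarrow> nat word_expr set"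
  where "relators p s f L =
    (let a = Gen 0; b = Gen 1; z = Gen 2; x = wpow z L; y = wcj x a; v = Mul (Mul b y) (winv b);
       d = Mul (Mul y (wcj y b)) y; t = Mul (Mul b (wpow (Mul d (winv b)) f)) (wpow b f);
       m = Mul (Mul x v) x; e = Mul (Mul m b) m
     in {weq (wpow a p) (wpow z (3 * L)), weq (wcj (wpow a s) b) (wpow a (s - 1)),
         weq (wcj x b) (winv x), wpow (Mul x y) 2, weq (wcj e t) (wcj e (wpow z 3)),
         weq (wpow (Mul b y) p) (wpow b (p - 1)), wpow (Mul (wpow z 3) v) (L + 2)})"

lemma relators_weval:
  "(\<forall>w\<in>relators p s f L. weval h w = 1) \<longleftrightarrow> relations p s f L (h 0) (h 1) (h 2)"
  by (simp only: relators_def relations_def Let_def ball_simps simp_thms times_inverse_eq_one_iff weval_wpow weval_winv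
    weval.simps(1,2) wE_def wB_def wD_def wV_def wY_def cj_def)

lemma relators_facts:
  assumes "w \<in> relators p s f L" "p \<le> 3 * n" "s \<le> 3 * n" "L \<le> n" "L + 2 \<le> 3 * n" "f \<le> 3" "n \<ge> 5"
  shows "short n w" "set_word_expr w \<subseteq> {0, 1, 2}"
  using assms unfolding relators_def Let_def by (auto simp: short_def)

lemma card_relators: "card (relators p s f L) \<le> 7" "finite (relators p s f L)"
  unfolding relators_def Let_def by (simp_all add: card_insert_if)


lemma presentation_general:
  assumes "parameters p r s f L" "n = f + L + 3" "s < p" "f \<le> 3" "n \<ge> 5"
  shows "\<exists>R :: nat word_expr set. is_presentation_of {0, 1, 2} R (if odd L then alt_group n else sym_group n) \<and>
    card R = 7 \<and> (\<forall>w\<in>R. short n w)"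
proof -
  interpret parameters p r s f L by fact
  have n_eq: "parameters.n f L = n" using assms(2) by (simp add: n_def)
  have p_n: "p + 2 \<le> n" using L f assms(2) by linarith
  have facts: "p \<le> 3 * n" "s \<le> 3 * n" "L \<le> n" "L + 2 \<le> 3 * n" "f \<le> 3" "n \<ge> 5"
    using p_n assms by linarith+
  obtain R where R: "relators p s f L \<subseteq> R" "card R = 7" "R \<subseteq> relators p s f L \<union> pad ` {..<7}"
    using pad_relations[OF card_relators] by blast
  have words: "set_word_expr w \<subseteq> {0, 1, 2}" if "w \<in> R" for w
    using that R(3) relators_facts(2)[OF _ facts] set_pad by blast
  have short: "short n w" if "w \<in> R" for w
    using that R(3) relators_facts(1)[OF _ facts] short_pad by blast
  obtain A B Z where ABZ: "relations p s f L A B Z"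
    and tri: "\<And>q. q \<in> {1..n} - {p + 1, p + 2} \<Longrightarrow> tri (p + 1) (p + 2) q \<in> gen {A, B, Z}"
    and perm: "\<And>g. g \<in> {A, B, Z} \<Longrightarrow> act g permutes {1..n}"
    and even: "evenperm (act (Z ^ 3)) \<longleftrightarrow> odd L"
    using bijn_exist unfolding n_eq by metis
  define h where "h i = (if i = 0 then A else if i = 1 then B else Z)" for i :: nat
  have h: "h ` {0, 1, 2} = {A, B, Z}" by (auto simp: h_def)
  have rels: "weval h w = 1" if "w \<in> R" for w
    using that R(3) ABZ relators_weval[of p s f L h] weval_pad[of h] by (auto simp: h_def)
  \<comment> \<open>The type of points is left open: the bound is applied to the permutations
    \<open>h\<close> of numbers and to bijections of cosets of words.\<close>
  have bound: "finite (gen (k ` {0, 1, 2})) \<and> card (gen (k ` {0, 1, 2})) \<le> fact n \<and>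
      (odd L \<longrightarrow> 2 * card (gen (k ` {0, 1, 2})) \<le> fact n)"
    if "\<And>w. w \<in> R \<Longrightarrow> weval k w = 1" for k :: "nat \<Rightarrow> 'b bijn"
  proof -
    have "relations p s f L (k 0) (k 1) (k 2)"
      using that R(1) by (subst relators_weval[symmetric]) blast
    then interpret related p r s f L "k 0" "k 1" "k 2" by unfold_locales
    show ?thesis using card_gen assms(2) by simp
  qed
  have uv: "p + 1 \<in> {1..n}" "p + 2 \<in> {1..n}" "p + 1 \<noteq> p + 2" using p_n by auto
  have tri_h: "\<And>q. q \<in> {1..n} - {p + 1, p + 2} \<Longrightarrow> tri (p + 1) (p + 2) q \<in> gen (h ` {0, 1, 2})"
    using tri unfolding h .
  have "is_presentation_of {0, 1, 2} R (if odd L then alt_group n else sym_group n)"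
  proof (cases "odd L")
    case True
    have "is_presentation_of {0, 1, 2} R (alt_group n)"
      by (rule presentation_of_alt_group[OF uv tri_h words rels]) (use True bound rels in blast)+
    then show ?thesis using True by simp
  next
    case False
    have Z: "Z ^ 3 \<in> gen (h ` {0, 1, 2})" unfolding h by (intro gen_power gen_base) simp
    have "act (h x) permutes {1..n}" if "x \<in> {0, 1, 2}" for x
      using perm that h by blast
    from presentation_of_sym_group[OF uv tri_h words rels this Z]
    have "is_presentation_of {0, 1, 2} R (sym_group n)" using False even bound by blast
    then show ?thesis using False by simp
  qed
  then show ?thesis using R(2) short by blast
qed

text \<open>For \<open>n = 6\<close> no prime fits; there a permutation \<open>g\<close> that moves 1, 2, 3, 4 cyclically
  normalizes Carmichael's four generators.\<close>

definition relations6 :: "bool \<Rightarrow> 'g::mgroup \<Rightarrow> 'g \<Rightarrow> bool"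
  where "relations6 e x g \<longleftrightarrow> x ^ 3 = 1 \<and> g ^ 4 = 1 \<and> (x * sg e (cj x g)) ^ 2 = 1 \<and>
    (x * cj x (g ^ 2)) ^ 2 = 1 \<and> (g * x) ^ (if e then 5 else 6) = 1"

text \<open>Conjugation by \<open>g\<close> spreads the relations for index distances 1 and 2 to all
  six pairs of the \<open>X i\<close>, since distance 3 is distance 1 modulo 4. Collecting in the
  last relation captures \<open>g ^ 5 = g\<close> or \<open>g ^ 6 = g ^ 2\<close>.\<close>

lemma card_gen_relations6:
  fixes x g :: "'g::mgroup"
  assumes "relations6 e x g"
  shows "finite (gen {x, g}) \<and> card (gen {x, g}) \<le> fact 6 \<and> (e \<longrightarrow> 2 * card (gen {x, g}) \<le> fact 6)"
proof -
  have x: "x ^ 3 = 1" and g: "g ^ 4 = 1" and r1: "(x * sg e (cj x g)) ^ 2 = 1"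
    and r2: "(x * cj x (g ^ 2)) ^ 2 = 1" and r3: "(g * x) ^ (if e then 5 else 6) = 1"
    using assms by (auto simp: relations6_def)
  define X where "X i = sg (e \<and> odd i) (cj x (g ^ i))" for i :: nat
  have sg_sq: "(sg e u * sg e v) ^ 2 = 1 \<longleftrightarrow> (u * v) ^ 2 = 1" for u v :: 'g
    by (simp add: sg_def sq_inverse_inverse)
  have sg_inj: "sg e u = sg e v \<longleftrightarrow> u = v" for u v :: 'g by (simp add: sg_def)
  have X_cj: "cj (X i) g = sg e (X (Suc i))" for i
    by (auto simp: X_def cj_sg cj_cj power_Suc2 simp del: power_Suc) (auto simp: sg_def)
  have X4: "X 4 = X 0" by (simp add: X_def g)
  have step: "(X (Suc i) * X (Suc j)) ^ 2 = 1" if "(X i * X j) ^ 2 = 1" for i j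
  proof -
    have "cj ((X i * X j) ^ 2) g = (sg e (X (Suc i)) * sg e (X (Suc j))) ^ 2"
      by (simp only: cj_power cj_times X_cj)
    then show ?thesis using that sg_sq by simp
  qed
  have x01: "(X 0 * X 1) ^ 2 = 1" using r1 by (simp add: X_def)
  have x02: "(X 0 * X 2) ^ 2 = 1" using r2 by (simp add: X_def)
  note x12 = step[OF x01] note x23 = step[OF x12] note x34 = step[OF x23] note x13 = step[OF x02]
  let ?S = "{X 0, X 1, X 2, X 3}"
  have cube: "t ^ 3 = 1" if "t \<in> ?S" for t
    using that x by (auto simp: X_def sg_def cj_inverse inverse_pow[symmetric] simp flip: cj_power)
  have pair: "(t * t') ^ 2 = 1" if "t \<in> ?S" "t' \<in> ?S" "t \<noteq> t'" for t t'
    using that x01 x02 x12 x23 x34 x13 X4 sq_commute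
    by (auto simp: numeral_2_eq_2 numeral_3_eq_3 eval_nat_numeral)
  have "card ?S \<le> 4" by (simp add: card_insert_if)
  then have "fact (card ?S + 2) \<le> (fact 6 :: nat)" by (intro fact_mono_nat) simp
  moreover have "finite (gen ?S) \<and> 2 * card (gen ?S) \<le> fact (card ?S + 2)"
    by (rule carmichael) (use cube pair in auto)
  ultimately have S: "finite (gen ?S)" "2 * card (gen ?S) \<le> fact 6" by linarith+
  have cj: "cj u g \<in> gen ?S" if "u \<in> gen ?S" for u
    using that
  proof (rule gen_cj[rotated])
    fix t assume "t \<in> ?S"
    then have "t \<in> X ` {0, 1, 2, 3}" by simp
    then obtain i where "i \<in> {0, 1, 2, 3}" "t = X i" by (rule imageE)
    moreover have "X (Suc i) \<in> ?S" if "i \<in> {0, 1, 2, 3}" for i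
      using that X4 by (auto simp: eval_nat_numeral)
    ultimately show "cj t g \<in> gen ?S" by (simp only: X_cj sg_def) (auto intro: gen_base simp del: insert_iff)
  qed
  have x_in: "x \<in> gen ?S" by (rule gen_base) (simp add: X_def)
  obtain \<nu> where \<nu>: "\<nu> \<in> gen ?S" "(g * x) ^ (if e then 5 else 6) = g ^ (if e then 5 else 6) * \<nu>"
    using collect_power[OF x_in cj] by blast
  then have "g ^ (if e then 5 else 6) = inverse \<nu>" using r3 by (metis inverse_invol inverse_unique)
  moreover have "g ^ 5 = g ^ 4 * g" "g ^ 6 = g ^ 4 * g ^ 2" by (simp_all flip: power_add power_Suc2)
  ultimately have g': "(if e then g else g ^ 2) = inverse \<nu>" using g by (auto split: if_splits)
  show ?thesis
  proof (cases e)
    case True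
    then have "{x, g} \<subseteq> gen ?S" using g' \<nu>(1) x_in by simp
    from gen_subset[OF this] have "finite (gen {x, g})" "card (gen {x, g}) \<le> card (gen ?S)"
      using S by (auto intro: finite_subset card_mono)
    then show ?thesis using S by linarith
  next
    case False
    then have "g ^ 2 \<in> gen ?S" using g' \<nu>(1) by simp
    from gen_insert_normalizing[OF S(1) cj this]
    have H: "finite (gen (insert g ?S))" "card (gen (insert g ?S)) \<le> 2 * card (gen ?S)" by auto
    have "{x, g} \<subseteq> gen (insert g ?S)" using x_in gen_mono[of ?S "insert g ?S"] by (auto intro: gen_base)
    from gen_subset[OF this] have "finite (gen {x, g})" "card (gen {x, g}) \<le> card (gen (insert g ?S))"
      using H by (auto intro: finite_subset card_mono)
    then show ?thesis using S H False by linarith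
  qed
qed


text \<open>Two generators suffice here; the relator \<open>Gen 2\<close> kills the third.\<close>

definition relators6 :: "bool \<Rightarrow> nat word_expr set"
  where "relators6 e =
    (let x = Gen 0; g = Gen 1; y = wcj x g
     in {wpow x 3, wpow g 4, wpow (Mul x (if e then winv y else y)) 2,
         wpow (Mul x (wcj x (wpow g 2))) 2, wpow (Mul g x) (if e then 5 else 6), Gen 2})"

lemma relators6_weval:
  "(\<forall>w\<in>relators6 e. weval h w = 1) \<longleftrightarrow> relations6 e (h 0) (h 1) \<and> h 2 = 1"
  by (cases e) (simp_all only: relators6_def relations6_def Let_def ball_simps simp_thms if_True if_False
    weval_wpow weval_winv weval.simps(1,2) cj_def sg_def conj_assoc)

lemma relators6_facts:
  assumes "w \<in> relators6 e"
  shows "short 6 w" "set_word_expr w \<subseteq> {0, 1, 2}"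
  using assms unfolding relators6_def Let_def by (cases e; auto simp: short_def)+

lemma card_relators6: "card (relators6 e) \<le> 7" "finite (relators6 e)"
  unfolding relators6_def Let_def by (simp_all add: card_insert_if)

lemma bijn6_exist:
  obtains g :: "nat bijn" where "relations6 e (tri 5 6 1) g"
    and "\<And>q. q \<in> {1..6} - {5, 6} \<Longrightarrow> tri 5 6 q \<in> gen {tri 5 6 1, g}"
    and "act g permutes {1..6}" and "\<not> e \<Longrightarrow> \<not> evenperm (act g)"
proof -
  obtain g0 :: "nat bijn" where g0: "\<And>j. j < 4 \<Longrightarrow> act g0 (Suc j) = Suc (Suc j mod 4)"
    "\<And>q. q \<notin> Suc ` {..<4} \<Longrightarrow> act g0 q = q" "evenperm (act g0) \<longleftrightarrow> odd (4::nat)"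
    by (rule cycle_bijn[of Suc 4]) (use that in auto)
  \<comment> \<open>For the alternating group the odd 4-cycle is made even by exchanging \<infinity>
    = 5 and \<infinity>' = 6. This inverts the 3-cycles, hence the sign in
    \<open>relations6\<close>.\<close>
  define g where "g = (if e then g0 * sw 5 6 else g0)"
  have act_g0: "act g0 q = (if q = 1 then 2 else if q = 2 then 3 else if q = 3 then 4 else if q = 4 then 1 else q)" for q
  proof -
    consider "q = Suc 0" | "q = Suc 1" | "q = Suc 2" | "q = Suc 3" | "q \<notin> Suc ` {..<4}"
      by (cases q) (auto simp: image_iff less_Suc_eq eval_nat_numeral)
    then show ?thesis
    proof cases
      case 5
      then have "q \<noteq> Suc 0" "q \<noteq> Suc 1" "q \<noteq> Suc 2" "q \<noteq> Suc 3" by auto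
      then show ?thesis using g0(2)[OF 5] by simp
    qed (use g0(1)[of 0] g0(1)[of 1] g0(1)[of 2] g0(1)[of 3] in simp_all)
  qed
  have act_g: "act g q = (if q = 1 then 2 else if q = 2 then 3 else if q = 3 then 4 else if q = 4 then 1
      else if e \<and> q = 5 then 6 else if e \<and> q = 6 then 5 else q)" for q
    by (auto simp: g_def act_g0 transpose_def)
  have cj_tri_g: "cj (tri 5 6 q) g = sg e (tri 5 6 (act g q))" if "q \<noteq> 5" "q \<noteq> 6" for q
  proof -
    have "act g q \<noteq> 5" "act g q \<noteq> 6" using that by (auto simp: act_g)
    then have "inverse (tri 5 6 (act g q)) = tri 6 5 (act g q)" by (simp add: inverse_tri)
    then show ?thesis by (cases e) (simp_all add: cj_tri sg_def act_g)
  qed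
  let ?x = "tri 5 6 1"
  \<comment> \<open>The product is the cycle (1 2 3 4 5) or (1 2 3 4 5 6), the origin of the
    exponents 5 and 6.\<close>
  have act_gx: "act (g * ?x) q = (if q = 1 then 2 else if q = 2 then 3 else if q = 3 then 4 else if q = 4 then 5
      else if q = 5 then (if e then 1 else 6) else if q = 6 then (if e then 6 else 1) else q)" for q
    by (simp add: act_g act_tri)
  have pow: "y ^ 5 = y * (y * (y * (y * y)))" "y ^ 6 = y * (y * (y * (y * (y * y))))" for y :: "nat bijn"
    by (simp_all add: eval_nat_numeral)
  have points: "q = 1 \<or> q = 2 \<or> q = 3 \<or> q = 4 \<or> q = 5 \<or> q = 6 \<or>
      q \<noteq> 1 \<and> q \<noteq> 2 \<and> q \<noteq> 3 \<and> q \<noteq> 4 \<and> q \<noteq> 5 \<and> q \<noteq> 6" for q :: nat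
    by blast
  have "g ^ 4 = 1"
  proof (rule bijn_eqI)
    fix q
    show "act (g ^ 4) q = act 1 q"
      using points[of q] by (elim disjE conjE; cases e; simp add: act_g power4_eq_xxxx)
  qed
  moreover have "(?x * sg e (cj ?x g)) ^ 2 = 1"
    using tri_tri[of 5 6 1 2] by (simp add: cj_tri_g act_g)
  moreover have "cj ?x (g ^ 2) = tri 5 6 3"
    by (simp add: power2_eq_square cj_tri_g cj_sg act_g flip: cj_cj)
  then have "(?x * cj ?x (g ^ 2)) ^ 2 = 1" using tri_tri[of 5 6 1 3] by simp
  moreover have "(g * ?x) ^ (if e then 5 else 6) = 1"
  proof (rule bijn_eqI)
    fix q
    show "act ((g * ?x) ^ (if e then 5 else 6)) q = act 1 q"
      using points[of q] by (elim disjE conjE; cases e; simp only: if_True if_False pow act_times[of "g * ?x"] comp_apply act_gx act_one id_apply; simp)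
  qed
  moreover have "?x ^ 3 = 1" by (rule tri_cube) auto
  ultimately have rel: "relations6 e ?x g" by (simp add: relations6_def)
  have "tri 5 6 q \<in> gen {?x, g}" if q: "q \<in> {1..6} - {5, 6}" for q
  proof -
    have x: "?x \<in> gen {?x, g}" and g: "g \<in> gen {?x, g}" by (auto intro: gen_base)
    have step: "tri 5 6 (act g q) \<in> gen {?x, g}" if "tri 5 6 q \<in> gen {?x, g}" "q \<noteq> 5" "q \<noteq> 6" for q
    proof -
      have "cj (tri 5 6 q) g \<in> gen {?x, g}" using that g by (simp add: cj_def gen_times)
      then show ?thesis using that by (simp add: cj_tri_g sg_def split: if_splits)
    qed
    have 2: "tri 5 6 2 \<in> gen {?x, g}" using step[OF x] by (simp add: act_g)
    have 3: "tri 5 6 3 \<in> gen {?x, g}" using step[OF 2] by (simp add: act_g)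
    have 4: "tri 5 6 4 \<in> gen {?x, g}" using step[OF 3] by (simp add: act_g)
    have "q = 1 \<or> q = 2 \<or> q = 3 \<or> q = 4" using q by auto
    then show ?thesis using x 2 3 4 by blast
  qed
  moreover have "act g permutes {1..6}"
  proof -
    have "\<forall>q. q \<notin> {1..6} \<longrightarrow> act g q = q" by (auto simp: act_g)
    then show ?thesis using bij_act[of g] unfolding permutes_def bij_iff by blast
  qed
  moreover have "\<not> e \<Longrightarrow> \<not> evenperm (act g)" using g0(3) by (simp add: g_def)
  ultimately show ?thesis using that rel by blast
qed

lemma presentation_6:
  "\<exists>R :: nat word_expr set. is_presentation_of {0, 1, 2} R (if e then alt_group 6 else sym_group 6) \<and>
    card R = 7 \<and> (\<forall>w\<in>R. short 6 w)"
proof -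
  obtain R where R: "relators6 e \<subseteq> R" "card R = 7" "R \<subseteq> relators6 e \<union> pad ` {..<7}"
    using pad_relations[OF card_relators6] by blast
  have words: "set_word_expr w \<subseteq> {0, 1, 2}" if "w \<in> R" for w
    using that R(3) relators6_facts(2) set_pad by blast
  have short: "short 6 w" if "w \<in> R" for w
    using that R(3) relators6_facts(1) short_pad by blast
  obtain g :: "nat bijn" where g: "relations6 e (tri 5 6 1) g"
    and tri: "\<And>q. q \<in> {1..6} - {5, 6} \<Longrightarrow> tri 5 6 q \<in> gen {tri 5 6 1, g}"
    and perm: "act g permutes {1..6}" and odd: "\<not> e \<Longrightarrow> \<not> evenperm (act g)"
    using bijn6_exist by metis
  have gen_one_insert: "gen (insert 1 S) = gen S" for S :: "'g::mgroup set"
    by (intro antisym gen_subset gen_mono) (auto intro: gen_base gen_one)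
  define h where "h i = (if i = 0 then tri 5 6 1 else if i = 1 then g else 1)" for i :: nat
  have "h ` {0, 1, 2} = insert 1 {tri 5 6 1, g}" by (auto simp: h_def)
  then have h: "gen (h ` {0, 1, 2}) = gen {tri 5 6 1, g}" by (simp only: gen_one_insert)
  have rels: "weval h w = 1" if "w \<in> R" for w
    using that R(3) g relators6_weval[of e h] weval_pad[of h] by (auto simp: h_def)
  have bound: "finite (gen (k ` {0, 1, 2})) \<and> card (gen (k ` {0, 1, 2})) \<le> fact 6 \<and>
      (e \<longrightarrow> 2 * card (gen (k ` {0, 1, 2})) \<le> fact 6)"
    if "\<And>w. w \<in> R \<Longrightarrow> weval k w = 1" for k :: "nat \<Rightarrow> 'b bijn"
  proof -
    have k: "relations6 e (k 0) (k 1) \<and> k 2 = 1"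
      using that R(1) by (subst relators6_weval[symmetric]) blast
    then have "k ` {0, 1, 2} = insert 1 {k 0, k 1}" by auto
    then have "gen (k ` {0, 1, 2}) = gen {k 0, k 1}" by (simp only: gen_one_insert)
    then show ?thesis using card_gen_relations6 k by metis
  qed
  have uv: "(5::nat) \<in> {1..6}" "(6::nat) \<in> {1..6}" "(5::nat) \<noteq> 6" by auto
  have tri_h: "\<And>q. q \<in> {1..6} - {5, 6} \<Longrightarrow> tri 5 6 q \<in> gen (h ` {0, 1, 2})"
    using tri unfolding h .
  have "is_presentation_of {0, 1, 2} R (if e then alt_group 6 else sym_group 6)"
  proof (cases e)
    case True
    have "is_presentation_of {0, 1, 2} R (alt_group 6)"
      by (rule presentation_of_alt_group[OF uv tri_h words rels]) (use True bound rels in blast)+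
    then show ?thesis using True by simp
  next
    case False
    have g_in: "g \<in> gen (h ` {0, 1, 2})" unfolding h by (intro gen_base) simp
    have "act (tri 5 6 1) permutes {1..6}" by (rule tri_permutes) auto
    then have "act (h x) permutes {1..6}" for x
      using perm permutes_id[of "{1..6 :: nat}"] by (auto simp: h_def simp del: id_apply)
    from presentation_of_sym_group[OF uv tri_h words rels this g_in odd[OF False]]
    have "is_presentation_of {0, 1, 2} R (sym_group 6)" using bound by blast
    then show ?thesis using False by simp
  qed
  then show ?thesis using R(2) short by blast
qed

lemma presentation_exists:
  assumes "n \<ge> 5"
  shows "\<exists>R :: nat word_expr set. is_presentation_of {0, 1, 2} R (if b then alt_group n else sym_group n) \<and>
    card R = 7 \<and> (\<forall>w\<in>R. short n w)"
proof (cases "n = 6")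
  case True
  then show ?thesis using presentation_6 by blast
next
  case False
  then obtain p r s f L where P: "parameters p r s f L" "n = f + L + 3" "s < p" "f \<le> 3" and b: "odd L = b"
    using parameters_exist[OF assms] by blast
  from presentation_general[OF P assms] show ?thesis unfolding b .
qed

theorem theoremC:
  shows "\<exists>(C :: real) (K :: nat). \<forall>n :: nat. n \<ge> 5 \<longrightarrow>
    (\<forall>G \<in> {alt_group n, sym_group n}.
      \<exists>(X :: nat set) (R :: nat word_expr set).
        is_presentation_of X R G \<and> card X = 3 \<and> card R = 7 \<and>
        presentation_bit_length X R \<le> C * log 2 (real n) \<and>
        presentation_num_exponents R \<le> K)"
proof (rule exI[of _ 1300], rule exI[of _ 420], intro allI impI ballI)
  fix n :: nat and G assume n: "n \<ge> 5" and "G \<in> {alt_group n, sym_group n}"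
  then obtain b where G: "G = (if b then alt_group n else sym_group n)"
    by (metis (full_types) insertE singletonD)
  obtain R :: "nat word_expr set"
    where R: "is_presentation_of {0, 1, 2} R G" "card R = 7" "\<And>w. w \<in> R \<Longrightarrow> short n w"
    using presentation_exists[OF n, of b] unfolding G by blast
  have "card {0, 1, 2 :: nat} = 3" by simp
  from cost[OF n R(2,3) this]
  show "\<exists>(X :: nat set) R. is_presentation_of X R G \<and> card X = 3 \<and> card R = 7 \<and>
      presentation_bit_length X R \<le> 1300 * log 2 (real n) \<and> presentation_num_exponents R \<le> 420"
    using R(1,2) \<open>card {0, 1, 2 :: nat} = 3\<close> by blast
qed

end
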